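(* Let $d\ge 2$, $G:\mathbb{R}^{n_1\times\cdots\times n_d}\times[0,T]\to\mathbb{R}^{n_1\times\cdots\times n_d}$, $Y(t_0)\in\mathcal{M}_{\mathbf r}$ and $t_1=t_0+\Delta t$. Consider the $2d-1$ split differential equations on $[t_0,t_1]$, solved in the order $Y_1^+,Y_1^-,Y_2^+,\dots,Y_{d-1}^-,Y_d^+$, $$\frac{dY_j^+(t)}{dt}=P_j^+G(Y_j^+(t),t)\quad(1\le j\le d),\qquad \frac{dY_j^-(t)}{dt}=-P_j^-G(Y_j^-(t),t)\quad(1\le j\le d-1),$$ with $Y_1^+(t_0)=Y(t_0)$, $Y_j^-(t_0)=Y_j^+(t_1)$ and $Y_{j+1}^+(t_0)=Y_j^-(t_1)$. Here $P_j^{\pm}$ are the interpolatory oblique operators defined in the context; they depend on the solution $Y_j^{\pm}(t)$ of the substep and thus are time-dependent. The multi-index sets $\mathcal I^{\le k},\mathcal I^{>k}$ may depend on $t$ (the dependence is suppressed in the notation), and it is assumed that they are selected at each time $t$ so that the interpolatory tangent space projector $P_Y$ defined in the context is well-defined. (i) Each split differential equation is solved exactly using time-independent projectors $P_j^+$ and $P_j^-$ at $Y_j^+(t_0)$ and $Y_j^-(t_0)$, respectively. (ii) Moreover, if $Y_j^+(t_0)$ has the TT representation $Y_j^+(t_0)=U_{\le j-1}[U_j\mathbf S_j]V_{>j}$, then $Y_j^+(t)=U_{\le j-1}K_j(t)V_{>j}$, where $$\frac{dK_j(t)}{dt}=\bigl[\mathbf U_{\le j-1}(\mathcal I^{\le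 j-1},:)\bigr]^{-1}G_j^+\bigl(\mathcal I^{\le j-1},:,\mathcal I^{>j},t\bigr)\bigl[\mathbf V_{>j}(\mathcal I^{>j},:)\bigr]^{-\top},\qquad K_j(t_0)=U_j\mathbf S_j,$$ and $G_j^+(t)=G(Y_j^+(t),t)$. (iii) Similarly, if $Y_j^-(t_0)$ has the TT representation $Y_j^-(t_0)=U_{\le j}\mathbf S_j(t_0)V_{>j}$, then $Y_j^-(t)=U_{\le j}\mathbf S_j(t)V_{>j}$, where $$\frac{d\mathbf S_j(t)}{dt}=-\bigl[\mathbf U_{\le j}(\mathcal I^{\le j},:)\bigr]^{-1}G_j^-\bigl(\mathcal I^{\le j},\mathcal I^{>j},t\bigr)\bigl[\mathbf V_{>j}(\mathcal I^{>j},:)\bigr]^{-\top},$$ and $G_j^-(t)=G(Y_j^-(t),t)$.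
   Context: Unfoldings and manifold: for $Z\in\mathbb{R}^{n_1\times\cdots\times n_d}$, $\mathbf Z^{\langle k\rangle}\in\mathbb{R}^{(n_1\cdots n_k)\times(n_{k+1}\cdots n_d)}$ is the matrix with rows indexed by $(i_1,\dots,i_k)$ and columns by $(i_{k+1},\dots,i_d)$, ordered colexicographically; $\mathrm{Ten}_k$ is the inverse operation. The TT-rank of $Y$ is $\mathbf r=(1,r_1,\dots,r_{d-1},1)$ with $r_k=\operatorname{rank}\mathbf Y^{\langle k\rangle}$ (so $r_0=r_d=1$); $\mathcal{M}_{\mathbf r}=\{Y:\text{TT-rank}(Y)=\mathbf r\}$. TT notation: TT-cores $C_k\in\mathbb{R}^{r_{k-1}\times n_k\times r_k}$ have $r_{k-1}\times r_k$ slices $C_k(i_k)$. A core is left-orthogonal if its $r_{k-1}n_k\times r_k$ reshaping has orthonormal columns, and right-orthogonal if its $r_{k-1}\times n_kr_k$ reshaping has orthonormal rows; $U_k$ always denotes left-orthogonal cores and $V_k$ right-orthogonal cores. Partial products: $U_{\le k}(i_1,\dots,i_k,:)=U_1(i_1)\cdots U_k(i_k)$ and $V_{>k}(:,i_{k+1},\dots,i_d)=V_{k+1}(i_{k+1})\cdots V_d(i_d)$, with $U_{\le 0}=1$, $V_{>d}=1$. The matrices $\mathbf U_{\le k}\in\mathbb{R}^{(n_1\cdots n_k)\times r_k}$ and $\mathbf V_{>k}\in\mathbb{R}^{(n_{k+1}\cdots n_d)\times r_k}$ have rows $\mathbf U_{\le k}(i_1\cdots i_k,:)=U_{\le k}(i_1,\dots,i_k,:)$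 and $\mathbf V_{>k}(i_{k+1}\cdots i_d,:)=V_{>k}(:,i_{k+1},\dots,i_d)^{\top}$. $U_j\mathbf S_j$ denotes the core with slices $U_j(i_j)\mathbf S_j$, with $\mathbf S_j\in\mathbb{R}^{r_j\times r_j}$. For $K_j\in\mathbb{R}^{r_{j-1}\times n_j\times r_j}$, $U_{\le j-1}K_jV_{>j}$ is the tensor with entries $U_1(i_1)\cdots U_{j-1}(i_{j-1})K_j(i_j)V_{j+1}(i_{j+1})\cdots V_d(i_d)$, and $U_{\le j}\mathbf S_jV_{>j}$ is the tensor with entries $U_1(i_1)\cdots U_j(i_j)\mathbf S_jV_{j+1}(i_{j+1})\cdots V_d(i_d)$. Interpolatory operators: $\mathcal I^{\le k}$ is a set of $r_k$ multi-indices $(i_1,\dots,i_k)$ and $\mathcal I^{>k}$ a set of $r_k$ multi-indices $(i_{k+1},\dots,i_d)$, identified with row and column indices of the $k$-th unfolding; $\mathcal I^{\le 0},\mathcal I^{>d}$ are trivial (argument omitted, corresponding matrices equal $1$). At a point $A\in\mathcal{M}_{\mathbf r}$, let $\mathbf U_{\le k}$ and $\mathbf V_{>k}$ be orthonormal bases of the range and co-range of $\mathbf A^{\langle k\rangle}$ (obtained from left- and right-orthogonal TT-cores of $A$), let $\mathbf X_{\le k},\mathbf X_{>k}$ consist of the columns of the identity matrix indexed by $\mathcal I^{\le k}$, $\mathcal I^{>k}$, so that $\mathbf X_{\le k}^{\top}\mathbf U_{\le k}=\mathbf U_{\le k}(\mathcal I^{\le k},:)$ and $\mathbf X_{>k}^{\top}\mathbf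 V_{>k}=\mathbf V_{>k}(\mathcal I^{>k},:)$, and set $$P_{\le k}Z=\mathrm{Ten}_k\bigl[\mathbf U_{\le k}(\mathbf X_{\le k}^{\top}\mathbf U_{\le k})^{-1}\mathbf X_{\le k}^{\top}\mathbf Z^{\langle k\rangle}\bigr],\qquad P_{>k}Z=\mathrm{Ten}_k\bigl[\mathbf Z^{\langle k\rangle}\mathbf X_{>k}(\mathbf X_{>k}^{\top}\mathbf V_{>k})^{-\top}\mathbf V_{>k}^{\top}\bigr],$$ with $P_{\le 0}=1$, $P_{>d}=1$. Then $P_j^+=P_{\le j-1}P_{>j}$ and $P_j^-=P_{\le j}P_{>j}$ at $A$, and the interpolatory tangent space projector at $A$ is $P_A=\sum_{j=1}^{d-1}(P_j^+-P_j^-)+P_d^+$. It is well-defined when the matrices $\mathbf U_{\le k}(\mathcal I^{\le k},:)$ and $\mathbf V_{>k}(\mathcal I^{>k},:)$, $k=1,\dots,d-1$, are invertible. Restrictions: $G_j^+(\mathcal I^{\le j-1},:,\mathcal I^{>j},t)$ is the $r_{j-1}\times n_j\times r_j$ array of entries of $G_j^+(t)$ at those indices, and left/right multiplication by matrices acts on each $r_{j-1}\times r_j$ slice (fixed $i_j$); $G_j^-(\mathcal I^{\le j},\mathcal I^{>j},t)$ is the $r_j\times r_j$ matrix of entries of $G_j^-(t)$. Origin of the split equations: they are the first-order Lie–Trotter substeps for the equation $dY/dt=P_YG(Y,t)$ from $t_0$ to $t_1$, and $Y_d^+(t_1)$ is the approximate solution at time $t_1$. *)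

theory Defs
  imports Complex_Main
    "Jordan_Normal_Form.DL_Rank"
    "Jordan_Normal_Form.Gauss_Jordan_Elimination"
begin

section \<open>Multi-indices and tensors\<close>

text \<open>
  Throughout, \<open>ns = [n_1, ..., n_d]\<close> is the list of dimensions. A multi-index is a list, whose
  entries start at 0. Note that \<open>ns ! (k - 1)\<close> is n_k, and that \<open>take k ns\<close> and \<open>drop k ns\<close> are the
  dimensions belonging to the rows and to the columns of the k-th unfolding.
\<close>

definition midx :: "nat list \<Rightarrow> nat list set" where
  "midx ns = {is. length is = length ns \<and> (\<forall>l < length ns. is ! l < ns ! l)}"

type_synonym tensor = "nat list \<Rightarrow> real"

text \<open>Tensors are extended by zero outside the index range, so that equality is entrywise.\<close>

definition tensors :: "nat list \<Rightarrow> tensor set" where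
  "tensors ns = {Z. \<forall>is. is \<notin> midx ns \<longrightarrow> Z is = 0}"

text \<open>Colexicographic position of a multi-index (the first index runs fastest), and its inverse.\<close>

fun colex :: "nat list \<Rightarrow> nat list \<Rightarrow> nat" where
  "colex (n # ns) (i # is) = i + n * colex ns is"
| "colex _ _ = 0"

fun uncolex :: "nat list \<Rightarrow> nat \<Rightarrow> nat list" where
  "uncolex [] a = []"
| "uncolex (n # ns) a = (a mod n) # uncolex ns (a div n)"

definition unfold :: "nat list \<Rightarrow> nat \<Rightarrow> tensor \<Rightarrow> real mat" where
  "unfold ns k Z = mat (prod_list (take k ns)) (prod_list (drop k ns))
     (\<lambda>(a, b). Z (uncolex (take k ns) a @ uncolex (drop k ns) b))"

definition Ten :: "nat list \<Rightarrow> nat \<Rightarrow> real mat \<Rightarrow> tensor" where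
  "Ten ns k M = (\<lambda>is. if is \<in> midx ns
     then M $$ (colex (take k ns) (take k is), colex (drop k ns) (drop k is)) else 0)"

definition mat_rank :: "real mat \<Rightarrow> nat" where
  "mat_rank M = vec_space.rank (dim_row M) M"

text \<open>The outer TT-ranks r_0 and r_d are 1 by convention; thus \<open>r ! k\<close> is r_k.\<close>

definition tt_rank :: "nat list \<Rightarrow> tensor \<Rightarrow> nat list" where
  "tt_rank ns Y = 1 # map (\<lambda>k. mat_rank (unfold ns k Y)) [1..<length ns] @ [1]"

definition tt_manifold :: "nat list \<Rightarrow> nat list \<Rightarrow> tensor set" where
  "tt_manifold ns r = {Y \<in> tensors ns. tt_rank ns Y = r}"


section \<open>TT-cores\<close>

text \<open>A core is given by its slices: \<open>C i\<close> is the matrix C(i). A family of cores is indexed by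
  1, ..., d.\<close>

type_synonym core = "nat \<Rightarrow> real mat"

definition is_core :: "nat list \<Rightarrow> nat list \<Rightarrow> nat \<Rightarrow> core \<Rightarrow> bool" where
  "is_core ns r k C \<longleftrightarrow> (\<forall>i < ns ! (k - 1). C i \<in> carrier_mat (r ! (k - 1)) (r ! k))"

definition reshape_left :: "nat \<Rightarrow> nat \<Rightarrow> nat \<Rightarrow> core \<Rightarrow> real mat" where
  "reshape_left p n q C = mat (p * n) q (\<lambda>(x, b). C (x div p) $$ (x mod p, b))"

definition reshape_right :: "nat \<Rightarrow> nat \<Rightarrow> nat \<Rightarrow> core \<Rightarrow> real mat" where
  "reshape_right p n q C = mat p (n * q) (\<lambda>(a, y). C (y mod n) $$ (a, y div n))"

definition left_orthogonal :: "nat list \<Rightarrow> nat list \<Rightarrow> nat \<Rightarrow> core \<Rightarrow> bool" where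
  "left_orthogonal ns r k C \<longleftrightarrow> is_core ns r k C \<and>
     (let M = reshape_left (r ! (k - 1)) (ns ! (k - 1)) (r ! k) C in M\<^sup>T * M = 1\<^sub>m (r ! k))"

definition right_orthogonal :: "nat list \<Rightarrow> nat list \<Rightarrow> nat \<Rightarrow> core \<Rightarrow> bool" where
  "right_orthogonal ns r k C \<longleftrightarrow> is_core ns r k C \<and>
     (let M = reshape_right (r ! (k - 1)) (ns ! (k - 1)) (r ! k) C in M * M\<^sup>T = 1\<^sub>m (r ! (k - 1)))"

text \<open>The row vector U_1(i_1) ... U_k(i_k) and the column vector V_{k+1}(i_{k+1}) ... V_d(i_d);
  in the latter, \<open>is\<close> is the list [i_{k+1}, ..., i_d]. Empty products are the 1 x 1 identity.\<close>

definition left_prod :: "(nat \<Rightarrow> core) \<Rightarrow> nat list \<Rightarrow> real mat" where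
  "left_prod U is = foldl (\<lambda>M l. M * U (l + 1) (is ! l)) (1\<^sub>m 1) [0..<length is]"

definition right_prod :: "(nat \<Rightarrow> core) \<Rightarrow> nat \<Rightarrow> nat list \<Rightarrow> real mat" where
  "right_prod V k is = foldr (\<lambda>l M. V (k + l + 1) (is ! l) * M) [0..<length is] (1\<^sub>m 1)"

definition U_le :: "nat list \<Rightarrow> nat list \<Rightarrow> (nat \<Rightarrow> core) \<Rightarrow> nat \<Rightarrow> real mat" where
  "U_le ns r U k = mat (prod_list (take k ns)) (r ! k)
     (\<lambda>(a, b). left_prod U (uncolex (take k ns) a) $$ (0, b))"

definition V_gt :: "nat list \<Rightarrow> nat list \<Rightarrow> (nat \<Rightarrow> core) \<Rightarrow> nat \<Rightarrow> real mat" where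
  "V_gt ns r V k = mat (prod_list (drop k ns)) (r ! k)
     (\<lambda>(a, b). right_prod V k (uncolex (drop k ns) a) $$ (b, 0))"

text \<open>The tensors $U_{\le j-1} K V_{>j}$ and $U_{\le j} S V_{>j}$.\<close>

definition tt_core_tensor ::
  "nat list \<Rightarrow> (nat \<Rightarrow> core) \<Rightarrow> nat \<Rightarrow> core \<Rightarrow> (nat \<Rightarrow> core) \<Rightarrow> tensor" where
  "tt_core_tensor ns U j K V = (\<lambda>is. if is \<in> midx ns
     then (left_prod U (take (j - 1) is) * K (is ! (j - 1)) * right_prod V j (drop j is)) $$ (0, 0)
     else 0)"

definition tt_mat_tensor ::
  "nat list \<Rightarrow> (nat \<Rightarrow> core) \<Rightarrow> nat \<Rightarrow> real mat \<Rightarrow> (nat \<Rightarrow> core) \<Rightarrow> tensor" where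
  "tt_mat_tensor ns U j S V = (\<lambda>is. if is \<in> midx ns
     then (left_prod U (take j is) * S * right_prod V j (drop j is)) $$ (0, 0) else 0)"


section \<open>Interpolatory operators\<close>

text \<open>Meaningful only for invertible matrices.\<close>

definition minv :: "real mat \<Rightarrow> real mat" where
  "minv A = the (mat_inverse A)"

text \<open>
  An orthonormal basis of the range of a matrix, chosen arbitrarily. For the unfoldings of a tensor A
  every family \<open>W k\<close> of such bases is obtained from left-orthogonal TT-cores of A, namely from those
  with slices $U_k(i) = W_{k-1}^T W_k^{(i)}$ for k < d, where $W_k^{(i)}$ is the block of rows of
  $W_k$ with $i_k = i$; similarly for co-ranges and right-orthogonal cores. The operators below do
  not depend on the choice.
\<close>

definition is_range_basis :: "real mat \<Rightarrow> real mat \<Rightarrow> bool" where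
  "is_range_basis M W \<longleftrightarrow> W \<in> carrier_mat (dim_row M) (mat_rank M) \<and> W\<^sup>T * W = 1\<^sub>m (mat_rank M) \<and>
     vec_space.col_space (dim_row M) W = vec_space.col_space (dim_row M) M"

definition range_basis :: "real mat \<Rightarrow> real mat" where
  "range_basis M = (SOME W. is_range_basis M W)"

definition corange_basis :: "real mat \<Rightarrow> real mat" where
  "corange_basis M = range_basis M\<^sup>T"

text \<open>A pair \<open>J\<close> of index selections: \<open>fst J k\<close> is the set of row multi-indices $(i_1,...,i_k)$ and
  \<open>snd J k\<close> the set of column multi-indices $(i_{k+1},...,i_d)$ of the k-th unfolding.\<close>

type_synonym selection = "(nat \<Rightarrow> nat list set) \<times> (nat \<Rightarrow> nat list set)"

definition valid_selection :: "nat list \<Rightarrow> nat list \<Rightarrow> selection \<Rightarrow> bool" where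
  "valid_selection ns r J \<longleftrightarrow> fst J 0 = {[]} \<and> snd J (length ns) = {[]} \<and>
     (\<forall>k \<in> {1..<length ns}.
        fst J k \<subseteq> midx (take k ns) \<and> card (fst J k) = r ! k \<and>
        snd J k \<subseteq> midx (drop k ns) \<and> card (snd J k) = r ! k)"

text \<open>The elements of a set of multi-indices, in colexicographic order. The order fixes the order of
  rows and columns in all submatrices below.\<close>

definition midx_list :: "nat list \<Rightarrow> nat list set \<Rightarrow> nat list list" where
  "midx_list ns I = map (uncolex ns) (sorted_list_of_set (colex ns ` I))"

text \<open>The columns of the identity matrix indexed by \<open>I\<close>.\<close>

definition sel_mat :: "nat list \<Rightarrow> nat list set \<Rightarrow> real mat" where
  "sel_mat ns I = mat_of_cols (prod_list ns)
     (map (\<lambda>is. unit_vec (prod_list ns) (colex ns is)) (midx_list ns I))"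

text \<open>The submatrix M(I,:).\<close>

definition row_sub :: "nat list \<Rightarrow> nat list set \<Rightarrow> real mat \<Rightarrow> real mat" where
  "row_sub ns I M = mat (card I) (dim_col M) (\<lambda>(a, b). M $$ (colex ns (midx_list ns I ! a), b))"

text \<open>In the following operators, \<open>A\<close> is the base point and \<open>Z\<close> the argument.\<close>

definition P_le :: "nat list \<Rightarrow> selection \<Rightarrow> nat \<Rightarrow> tensor \<Rightarrow> tensor \<Rightarrow> tensor" where
  "P_le ns J k A Z = (if k = 0 then Z else
     (let U = range_basis (unfold ns k A); X = sel_mat (take k ns) (fst J k)
      in Ten ns k (U * minv (X\<^sup>T * U) * X\<^sup>T * unfold ns k Z)))"

definition P_gt :: "nat list \<Rightarrow> selection \<Rightarrow> nat \<Rightarrow> tensor \<Rightarrow> tensor \<Rightarrow> tensor" where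
  "P_gt ns J k A Z = (if k = length ns then Z else
     (let V = corange_basis (unfold ns k A); X = sel_mat (drop k ns) (snd J k)
      in Ten ns k (unfold ns k Z * X * (minv (X\<^sup>T * V))\<^sup>T * V\<^sup>T)))"

definition P_plus :: "nat list \<Rightarrow> selection \<Rightarrow> nat \<Rightarrow> tensor \<Rightarrow> tensor \<Rightarrow> tensor" where
  "P_plus ns J j A Z = P_le ns J (j - 1) A (P_gt ns J j A Z)"

definition P_minus :: "nat list \<Rightarrow> selection \<Rightarrow> nat \<Rightarrow> tensor \<Rightarrow> tensor \<Rightarrow> tensor" where
  "P_minus ns J j A Z = P_le ns J j A (P_gt ns J j A Z)"

text \<open>Well-definedness at A of the interpolatory tangent space projector
  $P_A = \sum_{j=1}^{d-1} (P_j^+ - P_j^-) + P_d^+$.\<close>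

definition proj_wd :: "nat list \<Rightarrow> nat list \<Rightarrow> selection \<Rightarrow> tensor \<Rightarrow> bool" where
  "proj_wd ns r J A \<longleftrightarrow> A \<in> tt_manifold ns r \<and> valid_selection ns r J \<and>
     (\<forall>k \<in> {1..<length ns}.
        invertible_mat (row_sub (take k ns) (fst J k) (range_basis (unfold ns k A))) \<and>
        invertible_mat (row_sub (drop k ns) (snd J k) (corange_basis (unfold ns k A))))"

text \<open>$W(I,:,I')$ with $i_j = i$, and $W(I,I')$.\<close>

definition slice_sub ::
  "nat list \<Rightarrow> nat \<Rightarrow> nat list set \<Rightarrow> nat list set \<Rightarrow> tensor \<Rightarrow> core" where
  "slice_sub ns j I I' W = (\<lambda>i. mat (card I) (card I')
     (\<lambda>(a, b). W (midx_list (take (j - 1) ns) I ! a @ [i] @ midx_list (drop j ns) I' ! b)))"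

definition mat_sub ::
  "nat list \<Rightarrow> nat \<Rightarrow> nat list set \<Rightarrow> nat list set \<Rightarrow> tensor \<Rightarrow> real mat" where
  "mat_sub ns j I I' W = mat (card I) (card I')
     (\<lambda>(a, b). W (midx_list (take j ns) I ! a @ midx_list (drop j ns) I' ! b))"


section \<open>Differential equations\<close>

text \<open>Differentiability in these finite-dimensional spaces is entrywise; at the end points of the
  time interval \<open>I\<close> derivatives are one-sided.\<close>

definition tensor_deriv ::
  "nat list \<Rightarrow> (real \<Rightarrow> tensor) \<Rightarrow> tensor \<Rightarrow> real \<Rightarrow> real set \<Rightarrow> bool" where
  "tensor_deriv ns Y D t I \<longleftrightarrow>
     (\<forall>is \<in> midx ns. ((\<lambda>s. Y s is) has_real_derivative D is) (at t within I))"

definition mat_deriv ::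
  "nat \<Rightarrow> nat \<Rightarrow> (real \<Rightarrow> real mat) \<Rightarrow> real mat \<Rightarrow> real \<Rightarrow> real set \<Rightarrow> bool" where
  "mat_deriv p q F D t I \<longleftrightarrow>
     (\<forall>a < p. \<forall>b < q. ((\<lambda>s. F s $$ (a, b)) has_real_derivative D $$ (a, b)) (at t within I))"

text \<open>
  \<open>J t\<close> is the selection used at time t, and \<open>B t\<close> the point at which the operator is taken.
  The split equations are the case \<open>B = Y\<close>; for the equations with frozen projectors, \<open>B\<close> is
  constant.
\<close>

definition solves_plus ::
  "nat list \<Rightarrow> (tensor \<Rightarrow> real \<Rightarrow> tensor) \<Rightarrow> (real \<Rightarrow> selection) \<Rightarrow> real set \<Rightarrow> nat \<Rightarrow>
   (real \<Rightarrow> tensor) \<Rightarrow> (real \<Rightarrow> tensor) \<Rightarrow> bool" where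
  "solves_plus ns G J I j B Y \<longleftrightarrow>
     (\<forall>t \<in> I. tensor_deriv ns Y (P_plus ns (J t) j (B t) (G (Y t) t)) t I)"

definition solves_minus ::
  "nat list \<Rightarrow> (tensor \<Rightarrow> real \<Rightarrow> tensor) \<Rightarrow> (real \<Rightarrow> selection) \<Rightarrow> real set \<Rightarrow> nat \<Rightarrow>
   (real \<Rightarrow> tensor) \<Rightarrow> (real \<Rightarrow> tensor) \<Rightarrow> bool" where
  "solves_minus ns G J I j B Y \<longleftrightarrow>
     (\<forall>t \<in> I. tensor_deriv ns Y (\<lambda>is. - P_minus ns (J t) j (B t) (G (Y t) t) is) t I)"

end

theory Submission
  imports Defs "Jordan_Normal_Form.Gram_Schmidt"
begin

text \<open>
  Along a substep the derivative of the solution is an oblique projection onto the range of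
  $\mathbf Y^{\langle j-1\rangle}$ and the co-range of $\mathbf Y^{\langle j\rangle}$ (for the minus
  equations, of $\mathbf Y^{\langle j\rangle}$ on both sides). A matrix function \<open>M\<close> of constant rank whose
  derivative stays in the range of \<open>M t\<close> has a constant range. Since the operators depend on the base
  point only through these ranges, they can be frozen at the initial value. Contracting the solution
  with the orthonormal matrices $\mathbf U_{\le k}$ and $\mathbf V_{>k}$ then gives the equations for the cores.
\<close>

section \<open>Matrices\<close>

text \<open>The obstacle is that \<open>range_basis\<close> is an arbitrary choice:
  \<open>range_basis (M t)\<close> need not even be continuous in \<open>t\<close>, so its
  derivative cannot be shown to vanish directly. The local argument differentiates a basis built
  from \<open>M\<close> itself and compares it with the chosen one only at the end; connectedness of
  the interval makes the result global. Because the choice is made from a predicate that sees only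
  row count, rank and range, a constant range gives literally equal matrices, and hence literally
  equal operators. The constant rank comes from well-definedness: an invertible submatrix is square,
  so the rank equals the number of selected indices. A plus operator acts on two unfoldings at once,
  from the left on number \<open>j - 1\<close> and from the right on number \<open>j\<close>. The
  slices with fixed \<open>i_j\<close> are submatrices of both, which turns the operator into a
  two-sided matrix product.\<close>

lemma mult_assoc_dim:
  fixes A B C :: "'a :: semiring_0 mat"
  assumes "dim_col A = dim_row B" "dim_col B = dim_row C"
  shows "(A * B) * C = A * (B * C)"
  using assms by (intro assoc_mult_mat[of _ "dim_row A" "dim_row B" _ "dim_row C" _ "dim_col C"]) auto

lemma transpose_mult_dim:
  fixes A B :: "'a :: comm_semiring_0 mat"
  assumes "dim_col A = dim_row B"
  shows "(A * B)\<^sup>T = B\<^sup>T * A\<^sup>T"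
  using assms by (intro transpose_mult[of _ "dim_row A" "dim_row B" _ "dim_col B"]) auto

text \<open>Products are kept nested to the right, the normal form under
  \<open>mult_assoc_dim\<close>. In this shape an orthonormal factor \<open>B\<close> with
  \<open>A = B\<^sup>T\<close> cancels inside a longer product by rewriting alone.\<close>

lemma left_inverse_cancel:
  fixes A B X :: "'a :: semiring_1 mat"
  assumes "A * B = 1\<^sub>m n" "dim_col A = dim_row B" "dim_row X = n"
  shows "A * (B * X) = X"
proof -
  have "dim_col B = n" using assms(1) by (metis index_mult_mat(3) index_one_mat(3))
  then show ?thesis using assms by (simp flip: mult_assoc_dim)
qed

lemma mult_mat_index:
  fixes A B :: "'a :: semiring_0 mat"
  assumes "a < dim_row A" "b < dim_col B" "dim_col A = dim_row B"
  shows "(A * B) $$ (a, b) = (\<Sum>c<dim_row B. A $$ (a, c) * B $$ (c, b))"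
  using assms by (auto simp: scalar_prod_def lessThan_atLeast0 intro!: sum.cong)

lemma minv:
  assumes "A \<in> carrier_mat n n" "invertible_mat A"
  shows "minv A \<in> carrier_mat n n" "minv A * A = 1\<^sub>m n" "A * minv A = 1\<^sub>m n"
proof -
  obtain B where B: "inverts_mat A B" "inverts_mat B A"
    using assms(2) by (auto simp: invertible_mat_def)
  then have AB: "A * B = 1\<^sub>m n" and BA: "B * A = 1\<^sub>m (dim_row B)"
    using assms(1) by (auto simp: inverts_mat_def)
  have dims: "dim_col B = n" "dim_row B = n"
    using AB BA assms(1) by (metis index_mult_mat(3) index_one_mat(3),
        metis carrier_matD(2) index_mult_mat(3) index_one_mat(3))
  then have B': "B \<in> carrier_mat n n" by auto
  \<comment> \<open>\<open>mat_inverse\<close> returns \<open>None\<close> only on matrices outside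
    the units of the matrix ring, so membership in \<open>Units\<close> is what produces the
    \<open>Some\<close>.\<close>
  have unit: "A \<in> Units (ring_mat TYPE(real) n ())"
    unfolding Units_def using assms(1) B' AB BA dims by (auto simp: ring_mat_simps)
  then obtain C where C: "mat_inverse A = Some C"
    using mat_inverse(1)[OF assms(1), of "()"] by (cases "mat_inverse A") auto
  then show "minv A \<in> carrier_mat n n" "minv A * A = 1\<^sub>m n" "A * minv A = 1\<^sub>m n"
    using mat_inverse(2)[OF assms(1) C] by (auto simp: minv_def)
qed

lemma invertible_matI:
  fixes A B :: "'a :: field mat"
  assumes "A \<in> carrier_mat n n" "B \<in> carrier_mat n n" "A * B = 1\<^sub>m n"
  shows "invertible_mat A"
  using assms mat_mult_left_right_inverse[OF assms]
  by (auto simp: invertible_mat_def inverts_mat_def)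

lemma minv_unique:
  assumes "A \<in> carrier_mat n n" "B \<in> carrier_mat n n" "A * B = 1\<^sub>m n"
  shows "minv A = B"
proof -
  note m = minv[OF assms(1) invertible_matI[OF assms]]
  have "minv A = minv A * (A * B)" using m assms by simp
  also have "\<dots> = minv A * A * B" using m(1) assms by (intro mult_assoc_dim[symmetric]) auto
  also have "\<dots> = B" using m assms by simp
  finally show ?thesis .
qed

section \<open>Column spaces and orthonormal bases of ranges\<close>

lemma col_space_mult_subset:
  fixes B :: "real mat"
  assumes "B \<in> carrier_mat m q" "C \<in> carrier_mat q p"
  shows "vec_space.col_space m (B * C) \<subseteq> vec_space.col_space m B"
proof -
  have BC: "B * C \<in> carrier_mat m p" using assms by auto
  have "\<exists>y\<in>carrier_vec q. B *\<^sub>v y = (B * C) *\<^sub>v x" if "x \<in> carrier_vec p" for x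
    using assms that by (intro bexI[of _ "C *\<^sub>v x"]) auto
  then show ?thesis
    unfolding vec_space.col_space_eq[OF assms(1)] vec_space.col_space_eq[OF BC]
    using assms BC by auto
qed

lemma col_space_eqI:
  fixes A B :: "real mat"
  assumes "B \<in> carrier_mat m q" "C \<in> carrier_mat q p" "A = B * C"
    "D \<in> carrier_mat p q" "B = A * D"
  shows "vec_space.col_space m A = vec_space.col_space m B"
proof (rule subset_antisym)
  have A: "A \<in> carrier_mat m p" using assms(1,2,3) by simp
  show "vec_space.col_space m A \<subseteq> vec_space.col_space m B"
    unfolding assms(3) by (rule col_space_mult_subset[OF assms(1,2)])
  show "vec_space.col_space m B \<subseteq> vec_space.col_space m A"
    using col_space_mult_subset[OF A assms(4)] by (simp flip: assms(5))
qed

text \<open>The coefficient vectors of the columns of \<open>A\<close> with respect to the columns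
  of \<open>B\<close> form \<open>C\<close>. An inclusion of ranges thereby becomes a matrix
  identity, with which the later calculations can work.\<close>

lemma col_space_subset_factor:
  fixes A B :: "real mat"
  assumes "A \<in> carrier_mat m p" "B \<in> carrier_mat m q"
    "vec_space.col_space m A \<subseteq> vec_space.col_space m B"
  obtains C where "C \<in> carrier_mat q p" "A = B * C"
proof -
  have "\<exists>x\<in>carrier_vec q. B *\<^sub>v x = col A j" if "j < p" for j
  proof -
    have "A *\<^sub>v unit_vec p j = col A j"
      using assms(1) that by (intro eq_vecI) auto
    then have "col A j \<in> vec_space.col_space m A"
      unfolding vec_space.col_space_eq[OF assms(1)] using assms(1) that
      by (auto intro!: bexI[of _ "unit_vec p j"])
    then have "col A j \<in> vec_space.col_space m B" using assms(3) by blast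
    then show ?thesis unfolding vec_space.col_space_eq[OF assms(2)] using assms(2) by auto
  qed
  then obtain x where x: "\<And>j. j < p \<Longrightarrow> x j \<in> carrier_vec q \<and> B *\<^sub>v x j = col A j" by metis
  define C where "C = mat_of_cols q (map x [0..<p])"
  have C: "C \<in> carrier_mat q p" unfolding C_def by (intro carrier_matI) auto
  have "col (B * C) j = col A j" if "j < p" for j
  proof -
    have "col C j = x j" using that x by (simp add: C_def col_mat_of_cols)
    then show ?thesis using that x C assms(2) by (metis col_mult2)
  qed
  then have "A = B * C"
    using assms C by (intro mat_col_eqI) auto
  with C show ?thesis by (rule that)
qed

text \<open>The choice in \<open>range_basis\<close> is meaningful only if such a basis exists. A
  maximal independent set of columns of \<open>M\<close> has \<open>mat_rank M\<close> elements and
  spans the range; Gram-Schmidt followed by normalisation makes it orthonormal.\<close>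

lemma range_basis: "is_range_basis M (range_basis M)"
proof -
  define m where "m = dim_row M"
  interpret cof_vec_space m "TYPE(real)" .
  have M: "M \<in> carrier_mat m (dim_col M)" by (auto simp: m_def)
  have cM: "set (cols M) \<subseteq> carrier_vec m" using cols_dim by (auto simp: m_def)
  \<comment> \<open>The empty set is the starting point from which a maximal independent set of
    columns is grown.\<close>
  have "lin_indpt {}"
    by (metis empty_subsetI fin_dim finite_basis_exists subset_li_is_li vec_vs vectorspace.basis_def)
  then obtain S where S: "finite S" "maximal S (\<lambda>T. T \<subseteq> set (cols M) \<and> lin_indpt T)"
    using maximal_exists_superset[of "set (cols M)" "\<lambda>T. T \<subseteq> set (cols M) \<and> lin_indpt T" "{}"]
    by blast
  have Ssub: "S \<subseteq> set (cols M)" and Sind: "lin_indpt S" using S(2) by (auto simp: maximal_def)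
  have rank: "card S = mat_rank M"
    using rank_card_indpt[OF M S(2)] by (simp add: mat_rank_def m_def)
  \<comment> \<open>A column outside the span could be added to \<open>S\<close>, against
    maximality.\<close>
  have "set (cols M) \<subseteq> span S"
  proof (rule ccontr)
    assume "\<not> ?thesis"
    then obtain s where s: "s \<in> set (cols M)" "s \<notin> span S" by blast
    have Sc: "S \<subseteq> carrier_vec m" using Ssub cM by blast
    have sS: "s \<notin> S" using s span_mem[OF Sc] by blast
    moreover have "lin_indpt (S \<union> {s})"
      using lin_dep_iff_in_span[OF Sc Sind _ sS] s cM by blast
    ultimately show False using S(2) s Ssub unfolding maximal_def by blast
  qed
  then have spanS: "span S = span (set (cols M))"
    by (intro antisym span_is_monotone Ssub span_is_subset span_is_submodule) (use Ssub cM in auto)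
  obtain ws where ws: "set ws = S" "distinct ws" using finite_distinct_list[OF S(1)] by blast
  define us where "us = gram_schmidt m ws"
  have gs: "span S = span (set us)" "corthogonal us" "set us \<subseteq> carrier_vec m"
      "length us = mat_rank M"
    using gram_schmidt_result[OF _ ws(2) _ us_def] ws Ssub cM Sind rank distinct_card[OF ws(2)]
    by auto
  define r where "r = mat_rank M"
  define N where "N = mat_of_cols m us"
  have N: "N \<in> carrier_mat m r" using gs by (auto simp: N_def r_def)
  have colN: "col_space N = col_space M"
    using gs spanS by (simp add: col_space_def N_def cols_mat_of_cols)
  \<comment> \<open>The squared lengths. \<open>corthogonal\<close> gives orthogonality and
    non-vanishing, but no normalisation.\<close>
  define q where "q i = us ! i \<bullet> us ! i" for i
  have orth: "us ! i \<bullet> us ! j = (if i = j then q i else 0)" if "i < r" "j < r" for i j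
    using corthogonalD[OF gs(2), of i j] that gs by (auto simp: q_def r_def)
  have q: "q i > 0" if "i < r" for i
  proof -
    have "q i \<noteq> 0" using corthogonalD[OF gs(2), of i i] that gs by (auto simp: q_def r_def)
    moreover have "q i \<ge> 0" by (auto simp: q_def scalar_prod_def intro: sum_nonneg)
    ultimately show ?thesis by simp
  qed
  \<comment> \<open>\<open>D\<close> rescales the columns to unit length; its inverse
    \<open>E\<close> shows that the rescaling does not change the range.\<close>
  define D where "D = mat r r (\<lambda>(i, j). if i = j then 1 / sqrt (q i) else 0)"
  define E where "E = mat r r (\<lambda>(i, j). if i = j then sqrt (q i) else 0)"
  have DE: "D \<in> carrier_mat r r" "E \<in> carrier_mat r r" by (auto simp: D_def E_def)
  have "D * E = 1\<^sub>m r"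
  proof (rule eq_matI)
    fix i j assume "i < dim_row (1\<^sub>m r :: real mat)" "j < dim_col (1\<^sub>m r :: real mat)"
    then have ij: "i < r" "j < r" by auto
    have "(D * E) $$ (i, j) = (\<Sum>c<r. D $$ (i, c) * E $$ (c, j))"
      using ij DE by (subst mult_mat_index) auto
    also have "\<dots> = (\<Sum>c<r. if c = j then D $$ (i, j) * sqrt (q j) else 0)"
      using ij by (intro sum.cong) (auto simp: E_def)
    also have "\<dots> = 1\<^sub>m r $$ (i, j)" using ij q[of j] by (simp add: D_def)
    finally show "(D * E) $$ (i, j) = 1\<^sub>m r $$ (i, j)" .
  qed (use DE in auto)
  define W where "W = N * D"
  have W: "W \<in> carrier_mat m r" using N DE by (auto simp: W_def)
  have NE: "N = W * E"
    using N DE \<open>D * E = 1\<^sub>m r\<close> by (simp add: W_def mult_assoc_dim)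
  have colW: "col_space W = col_space N"
    by (rule col_space_eqI[OF N DE(1) W_def DE(2) NE])
  have Nidx: "N $$ (a, i) = us ! i $ a" if "a < m" "i < r" for a i
    using that gs by (simp add: N_def r_def mat_of_cols_index)
  have Wcol: "W $$ (a, i) = us ! i $ a / sqrt (q i)" if "a < m" "i < r" for a i
  proof -
    have "W $$ (a, i) = (\<Sum>c<r. N $$ (a, c) * D $$ (c, i))"
      using that N DE unfolding W_def by (subst mult_mat_index) auto
    also have "\<dots> = (\<Sum>c<r. if c = i then N $$ (a, i) / sqrt (q i) else 0)"
      using that by (intro sum.cong) (auto simp: D_def)
    finally show ?thesis using that Nidx by simp
  qed
  have "W\<^sup>T * W = 1\<^sub>m r"
  proof (rule eq_matI)
    fix i j assume "i < dim_row (1\<^sub>m r :: real mat)" "j < dim_col (1\<^sub>m r :: real mat)"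
    then have ij: "i < r" "j < r" by auto
    have "(W\<^sup>T * W) $$ (i, j) = (\<Sum>a<m. us ! i $ a / sqrt (q i) * (us ! j $ a / sqrt (q j)))"
      using W ij by (subst mult_mat_index) (auto simp: Wcol intro!: sum.cong)
    also have "\<dots> = us ! i \<bullet> us ! j / (sqrt (q i) * sqrt (q j))"
    proof -
      have "us ! j \<in> set us" using ij gs(4) by (simp add: r_def)
      then have "dim_vec (us ! j) = m" using gs(3) by (meson carrier_vecD subsetD)
      then show ?thesis
        by (simp add: scalar_prod_def sum_divide_distrib lessThan_atLeast0)
    qed
    also have "\<dots> = 1\<^sub>m r $$ (i, j)" using orth[OF ij] q[OF ij(1)] ij by (cases "i = j") simp_all
    finally show "(W\<^sup>T * W) $$ (i, j) = 1\<^sub>m r $$ (i, j)" .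
  qed (use W in auto)
  then have "is_range_basis M W"
    using W colW colN unfolding is_range_basis_def m_def[symmetric] r_def[symmetric] by blast
  then show ?thesis unfolding range_basis_def by (rule someI[of "is_range_basis M"])
qed

lemma range_basis_dim [simp]:
  "dim_row (range_basis M) = dim_row M" "dim_col (range_basis M) = mat_rank M"
  using range_basis[of M] by (auto simp: is_range_basis_def)

lemma range_basis_orthonormal: "(range_basis M)\<^sup>T * range_basis M = 1\<^sub>m (mat_rank M)"
  using range_basis[of M] by (auto simp: is_range_basis_def)

text \<open>The coefficients \<open>C\<close> can be kept while \<open>M\<close> varies with time,
  which yields a differentiable candidate for a basis.\<close>

lemma range_basis_factor:
  obtains C where "C \<in> carrier_mat (dim_col M) (mat_rank M)" "range_basis M = M * C"
proof (rule col_space_subset_factor)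
  show "range_basis M \<in> carrier_mat (dim_row M) (mat_rank M)" "M \<in> carrier_mat (dim_row M) (dim_col M)"
    by auto
  show "vec_space.col_space (dim_row M) (range_basis M) \<subseteq> vec_space.col_space (dim_row M) M"
    using range_basis[of M] unfolding is_range_basis_def by simp
qed

text \<open>With \<open>W = range_basis M\<close>, the product \<open>W * W\<^sup>T\<close> is the
  orthogonal projector onto the range: the columns of \<open>M\<close> are combinations of those of
  \<open>W\<close>, and \<open>W\<^sup>T * W\<close> cancels.\<close>

lemma range_basis_proj: "range_basis M * ((range_basis M)\<^sup>T * M) = M"
proof -
  have car: "M \<in> carrier_mat (dim_row M) (dim_col M)"
      "range_basis M \<in> carrier_mat (dim_row M) (mat_rank M)" by auto
  have "vec_space.col_space (dim_row M) M \<subseteq> vec_space.col_space (dim_row M) (range_basis M)"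
    using range_basis[of M] unfolding is_range_basis_def by simp
  from col_space_subset_factor[OF car this]
  obtain C where C: "C \<in> carrier_mat (mat_rank M) (dim_col M)" "M = range_basis M * C" .
  have "(range_basis M)\<^sup>T * (range_basis M * C) = C"
    using C(1) by (intro left_inverse_cancel[OF range_basis_orthonormal]) auto
  with C(2)[symmetric] show ?thesis by simp
qed

text \<open>The choice of \<open>range_basis M\<close> depends on \<open>M\<close> only through its range.\<close>

lemma range_basis_eqI:
  assumes "dim_row M = dim_row N" "mat_rank M = mat_rank N"
    "C \<in> carrier_mat (mat_rank N) (mat_rank N)" "range_basis M = range_basis N * C"
  shows "range_basis M = range_basis N"
proof -
  define U V where "U = range_basis M" and "V = range_basis N"
  define m r where "m = dim_row M" and "r = mat_rank N"
  have U: "U \<in> carrier_mat m r" "U\<^sup>T * U = 1\<^sub>m r" and V: "V \<in> carrier_mat m r" "V\<^sup>T * V = 1\<^sub>m r"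
    using range_basis_orthonormal[of M] range_basis_orthonormal[of N] assms(1,2)
    unfolding U_def V_def m_def r_def by (auto intro!: carrier_matI)
  have UV: "U = V * C" and C: "C \<in> carrier_mat r r" using assms by (auto simp: U_def V_def r_def)
  have "C\<^sup>T * C = U\<^sup>T * U"
    unfolding UV using C V by (simp add: transpose_mult_dim mult_assoc_dim left_inverse_cancel[OF V(2)])
  \<comment> \<open>Both bases are orthonormal, so \<open>C\<close> is an orthogonal matrix. Being
    square, it has \<open>C\<^sup>T\<close> as a two-sided inverse, and each range contains the
    other.\<close>
  then have "C * C\<^sup>T = 1\<^sub>m r" using U(2) C by (intro mat_mult_left_right_inverse[of "C\<^sup>T" r C]) auto
  then have VU: "V = U * C\<^sup>T" unfolding UV using C V by (simp add: mult_assoc_dim)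
  have "vec_space.col_space m U = vec_space.col_space m V"
    using C by (intro col_space_eqI[OF V(1) C UV _ VU]) auto
  then have "vec_space.col_space m M = vec_space.col_space m N"
    using range_basis[of M] range_basis[of N] assms
    by (simp add: is_range_basis_def U_def V_def m_def)
  \<comment> \<open>Both choices are made from the same set: row count, rank and range agree, hence
    so do the predicates and the values of \<open>SOME\<close>.\<close>
  then have "is_range_basis M = is_range_basis N"
    unfolding is_range_basis_def fun_eq_iff m_def assms(2) by (simp add: assms(1))
  then show ?thesis by (simp add: range_basis_def)
qed

section \<open>Multi-indices\<close>

lemma midx_Nil [simp]: "midx [] = {[]}"
  by (auto simp: midx_def)

lemma midx_Cons: "is \<in> midx (n # ns) \<longleftrightarrow> (\<exists>i js. is = i # js \<and> i < n \<and> js \<in> midx ns)"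
  by (cases "is") (auto simp: midx_def nth_Cons split: nat.splits)

lemma midx_append:
  assumes "is \<in> midx ms" "js \<in> midx ns"
  shows "is @ js \<in> midx (ms @ ns)"
  using assms by (auto simp: midx_def nth_append)

lemma midx_take: "is \<in> midx ns \<Longrightarrow> take k is \<in> midx (take k ns)"
  by (auto simp: midx_def)

lemma midx_drop: "is \<in> midx ns \<Longrightarrow> drop k is \<in> midx (drop k ns)"
  by (auto simp: midx_def)

lemma midx_length: "is \<in> midx ns \<Longrightarrow> length is = length ns"
  by (simp add: midx_def)

lemma uncolex_midx: "a < prod_list ns \<Longrightarrow> uncolex ns a \<in> midx ns"
proof (induction ns arbitrary: a)
  case (Cons n ns)
  then have "n > 0" by (cases n) auto
  moreover have "a div n < prod_list ns"
    using Cons.prems by (simp add: less_mult_imp_div_less mult.commute)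
  ultimately show ?case using Cons.IH by (auto simp: midx_Cons)
qed simp

lemma colex_uncolex: "a < prod_list ns \<Longrightarrow> colex ns (uncolex ns a) = a"
proof (induction ns arbitrary: a)
  case (Cons n ns)
  have "a div n < prod_list ns"
    using Cons.prems by (simp add: less_mult_imp_div_less mult.commute)
  then show ?case using Cons.IH by simp
qed simp

lemma add_mult_less:
  fixes i n b m :: nat
  assumes "i < n" "b < m"
  shows "i + n * b < n * m"
proof -
  have "i + n * b < n + n * b" using assms by simp
  also have "\<dots> = n * Suc b" by simp
  also have "\<dots> \<le> n * m" using assms by (intro mult_le_mono2) simp
  finally show ?thesis .
qed

lemma colex_less: "is \<in> midx ns \<Longrightarrow> colex ns is < prod_list ns"
  by (induction ns arbitrary: "is") (auto simp: midx_Cons add_mult_less)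

lemma uncolex_colex: "is \<in> midx ns \<Longrightarrow> uncolex ns (colex ns is) = is"
  by (induction ns arbitrary: "is") (auto simp: midx_Cons)

lemma colex_inj_on: "inj_on (colex ns) (midx ns)"
  by (metis inj_onI uncolex_colex)

text \<open>The recursion of \<open>uncolex\<close> splits off the first, fastest index. In the row
  index of an unfolding the last index is the slowest and has to be split off at the other end. The
  remainder appears because \<open>i\<close> carries no bound.\<close>

lemma uncolex_snoc:
  assumes "a < prod_list ns"
  shows "uncolex (ns @ [n]) (a + prod_list ns * i) = uncolex ns a @ [i mod n]"
  using assms
proof (induction ns arbitrary: a)
  case (Cons m ns)
  have m: "m > 0" using Cons.prems by (cases m) auto
  have "(a + m * prod_list ns * i) div m = a div m + prod_list ns * i"
    using m by (simp add: mult.assoc div_add1_eq)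
  moreover have "a div m < prod_list ns"
    using Cons.prems by (simp add: less_mult_imp_div_less mult.commute)
  ultimately show ?case using Cons.IH by (simp add: mult.assoc)
qed simp

lemma midx_list:
  assumes "I \<subseteq> midx ns"
  shows "length (midx_list ns I) = card I" "set (midx_list ns I) = I"
    "a < card I \<Longrightarrow> midx_list ns I ! a \<in> midx ns"
proof -
  have "finite (colex ns ` I)"
    by (rule finite_subset[of _ "{..<prod_list ns}"]) (use assms colex_less in auto)
  moreover have "inj_on (colex ns) I" using colex_inj_on assms by (rule inj_on_subset)
  moreover have "uncolex ns ` colex ns ` I = I"
  proof -
    have "(\<lambda>x. uncolex ns (colex ns x)) ` I = (\<lambda>x. x) ` I"
      using assms by (intro image_cong refl uncolex_colex) auto
    then show ?thesis by (simp add: image_image)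
  qed
  ultimately show len: "length (midx_list ns I) = card I" and set: "set (midx_list ns I) = I"
    by (simp_all add: midx_list_def card_image)
  show "a < card I \<Longrightarrow> midx_list ns I ! a \<in> midx ns"
    using len set assms nth_mem[of a "midx_list ns I"] by auto
qed

section \<open>Unfoldings and slices\<close>

lemma dim_unfold [simp]:
  "dim_row (unfold ns k Z) = prod_list (take k ns)"
  "dim_col (unfold ns k Z) = prod_list (drop k ns)"
  by (auto simp: unfold_def)

lemma unfold_index:
  assumes "is \<in> midx (take k ns)" "js \<in> midx (drop k ns)"
  shows "unfold ns k Z $$ (colex (take k ns) is, colex (drop k ns) js) = Z (is @ js)"
  using assms by (simp add: unfold_def colex_less uncolex_colex)

lemma unfold_Ten:
  assumes "M \<in> carrier_mat (prod_list (take k ns)) (prod_list (drop k ns))" "k \<le> length ns"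
  shows "unfold ns k (Ten ns k M) = M"
proof (rule eq_matI)
  fix a b assume "a < dim_row M" "b < dim_col M"
  then have ab: "a < prod_list (take k ns)" "b < prod_list (drop k ns)" using assms by auto
  have "length (uncolex (take k ns) a) = k"
    using midx_length[OF uncolex_midx[OF ab(1)]] assms(2) by simp
  moreover have "uncolex (take k ns) a @ uncolex (drop k ns) b \<in> midx ns"
    using midx_append[OF uncolex_midx[OF ab(1)] uncolex_midx[OF ab(2)]] by simp
  ultimately show "unfold ns k (Ten ns k M) $$ (a, b) = M $$ (a, b)"
    using ab by (simp add: unfold_def Ten_def colex_uncolex)
qed (use assms in auto)

lemma tensor_eqI:
  assumes "Y \<in> tensors ns" "Z \<in> tensors ns" "\<And>is. is \<in> midx ns \<Longrightarrow> Y is = Z is"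
  shows "Y = Z"
  using assms by (fastforce simp: tensors_def)

text \<open>The matrix with entries $Z(i_1,\dots,i_{j-1},i,i_{j+1},\dots,i_d)$, for fixed \<open>i\<close>.\<close>

definition slice :: "nat list \<Rightarrow> nat \<Rightarrow> nat \<Rightarrow> tensor \<Rightarrow> real mat" where
  "slice ns j i Z = mat (prod_list (take (j - 1) ns)) (prod_list (drop j ns))
     (\<lambda>(a, b). Z (uncolex (take (j - 1) ns) a @ i # uncolex (drop j ns) b))"

lemma dim_slice [simp]:
  "dim_row (slice ns j i Z) = prod_list (take (j - 1) ns)"
  "dim_col (slice ns j i Z) = prod_list (drop j ns)"
  by (auto simp: slice_def)

context
  fixes ns :: "nat list" and j :: nat
  assumes j: "1 \<le> j" "j \<le> length ns"
begin

lemma drop_pred: "drop (j - 1) ns = ns ! (j - 1) # drop j ns"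
  using j Cons_nth_drop_Suc[of "j - 1" ns] by simp

lemma take_pred: "take j ns = take (j - 1) ns @ [ns ! (j - 1)]"
  using j take_Suc_conv_app_nth[of "j - 1" ns] by simp

text \<open>\<open>i_j\<close> is the fastest column index of unfolding \<open>j - 1\<close>, so a
  slice consists of every \<open>n_j\<close>-th column of it.\<close>

lemma slice_unfold_left:
  assumes "i < ns ! (j - 1)" "a < prod_list (take (j - 1) ns)" "b < prod_list (drop j ns)"
  shows "slice ns j i Z $$ (a, b) = unfold ns (j - 1) Z $$ (a, i + ns ! (j - 1) * b)"
  using assms add_mult_less[OF assms(1,3)] by (simp add: slice_def unfold_def drop_pred del: One_nat_def)

text \<open>\<open>i_j\<close> is the slowest row index of unfolding \<open>j\<close>, so the same
  slice is a contiguous block of rows. Being a submatrix of both unfoldings, it sees left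
  multiplication of the one and right multiplication of the other.\<close>

lemma slice_unfold_right:
  assumes "i < ns ! (j - 1)" "a < prod_list (take (j - 1) ns)" "b < prod_list (drop j ns)"
  shows "slice ns j i Z $$ (a, b) = unfold ns j Z $$ (a + prod_list (take (j - 1) ns) * i, b)"
  using assms add_mult_less[OF assms(2,1)]
  by (simp add: slice_def unfold_def take_pred uncolex_snoc del: One_nat_def)

lemma midx_split:
  assumes "is \<in> midx ns"
  shows "is ! (j - 1) < ns ! (j - 1)" "is = take (j - 1) is @ is ! (j - 1) # drop j is"
proof -
  have "length is = length ns" using assms by (rule midx_length)
  then show "is = take (j - 1) is @ is ! (j - 1) # drop j is"
    using j id_take_nth_drop[of "j - 1" "is"] by simp
  show "is ! (j - 1) < ns ! (j - 1)" using assms j by (simp add: midx_def)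
qed

lemma midx_join:
  assumes "xs \<in> midx (take (j - 1) ns)" "i < ns ! (j - 1)" "ys \<in> midx (drop j ns)"
  shows "xs @ i # ys \<in> midx ns"
proof -
  have "i # ys \<in> midx (drop (j - 1) ns)" using assms unfolding drop_pred midx_Cons by blast
  from midx_append[OF assms(1) this] show ?thesis by simp
qed

lemma slice_index:
  assumes "xs \<in> midx (take (j - 1) ns)" "ys \<in> midx (drop j ns)"
  shows "slice ns j i Z $$ (colex (take (j - 1) ns) xs, colex (drop j ns) ys) = Z (xs @ i # ys)"
  using assms by (simp add: slice_def colex_less uncolex_colex)

lemma tensor_eq_slicesI:
  assumes "Y \<in> tensors ns" "Z \<in> tensors ns"
    "\<And>i. i < ns ! (j - 1) \<Longrightarrow> slice ns j i Y = slice ns j i Z"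
  shows "Y = Z"
proof (rule tensor_eqI[OF assms(1,2)])
  fix "is" assume "is \<in> midx ns"
  note s = midx_split[OF this] midx_take[OF this, of "j - 1"] midx_drop[OF this, of j]
  show "Y is = Z is"
    using slice_index[OF s(3,4), of "is ! (j - 1)"] assms(3)[OF s(1)] s(2) by metis
qed

end

lemma tensor_eq_unfoldI:
  assumes "Y \<in> tensors ns" "Z \<in> tensors ns" "unfold ns k Y = unfold ns k Z"
  shows "Y = Z"
proof (rule tensor_eqI[OF assms(1,2)])
  fix "is" assume "is \<in> midx ns"
  note s = midx_take[OF this, of k] midx_drop[OF this, of k]
  show "Y is = Z is" using unfold_index[OF s] assms(3) by (metis append_take_drop_id)
qed

section \<open>Matrix-valued functions of time\<close>

lemma mat_deriv_mult_left:
  assumes "mat_deriv p q F D t I" "A \<in> carrier_mat l p" "\<And>s. F s \<in> carrier_mat p q" "D \<in> carrier_mat p q"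
  shows "mat_deriv l q (\<lambda>s. A * F s) (A * D) t I"
  unfolding mat_deriv_def
proof (intro allI impI)
  fix a b assume ab: "a < l" "b < q"
  have dims: "dim_row (F s) = p" "dim_col (F s) = q" for s using assms(3)[of s] by auto
  have "((\<lambda>s. \<Sum>c<p. A $$ (a, c) * F s $$ (c, b)) has_real_derivative
      (\<Sum>c<p. A $$ (a, c) * D $$ (c, b))) (at t within I)"
    using assms(1) ab by (intro DERIV_sum DERIV_cmult) (auto simp: mat_deriv_def)
  then show "((\<lambda>s. (A * F s) $$ (a, b)) has_real_derivative (A * D) $$ (a, b)) (at t within I)"
    using assms(2,4) ab by (simp add: mult_mat_index dims del: index_mult_mat(1))
qed

lemma mat_deriv_transpose:
  assumes "mat_deriv p q F D t I" "\<And>s. F s \<in> carrier_mat p q" "D \<in> carrier_mat p q"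
  shows "mat_deriv q p (\<lambda>s. (F s)\<^sup>T) D\<^sup>T t I"
proof -
  have dims: "dim_row (F s) = p" "dim_col (F s) = q" for s using assms(2)[of s] by auto
  show ?thesis using assms(1,3) by (auto simp: mat_deriv_def dims)
qed

lemma mat_deriv_mult_right:
  assumes "mat_deriv p q F D t I" "B \<in> carrier_mat q l" "\<And>s. F s \<in> carrier_mat p q" "D \<in> carrier_mat p q"
  shows "mat_deriv p l (\<lambda>s. F s * B) (D * B) t I"
proof -
  have dims: "dim_row (F s) = p" "dim_col (F s) = q" for s using assms(3)[of s] by auto
  have dimsBD: "dim_row B = q" "dim_row D = p" "dim_col D = q" using assms(2,4) by auto
  have BT: "B\<^sup>T \<in> carrier_mat l q" and DT: "D\<^sup>T \<in> carrier_mat q p"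
    and FT: "(F s)\<^sup>T \<in> carrier_mat q p" for s using assms(2-4) by auto
  from mat_deriv_mult_left[OF mat_deriv_transpose[OF assms(1,3,4)] BT FT DT]
  have "mat_deriv l p (\<lambda>s. B\<^sup>T * (F s)\<^sup>T) (B\<^sup>T * D\<^sup>T) t I" .
  from mat_deriv_transpose[OF this mult_carrier_mat[OF BT FT] mult_carrier_mat[OF BT DT]]
  show ?thesis by (simp add: transpose_mult_dim dims dimsBD)
qed

text \<open>By the Leibniz formula the determinant is a polynomial in the entries.\<close>

lemma continuous_det:
  fixes A :: "'b :: t2_space \<Rightarrow> real mat"
  assumes "\<And>s. A s \<in> carrier_mat n n"
    "\<And>i j. i < n \<Longrightarrow> j < n \<Longrightarrow> continuous F (\<lambda>s. A s $$ (i, j))"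
  shows "continuous F (\<lambda>s. det (A s))"
proof -
  have "continuous F (\<lambda>s. \<Sum>p\<in>{p. p permutes {0..<n}}. signof p * (\<Prod>i = 0..<n. A s $$ (i, p i)))"
    by (intro continuous_sum continuous_mult continuous_const continuous_prod assms(2))
      (auto dest: permutes_in_image)
  then show ?thesis unfolding det_def'[OF assms(1)] .
qed

text \<open>Up to sign the entries of the adjugate are minors. Cramer's rule then gives continuity
  of the inverse of a matrix function, used for \<open>Hi\<close> below.\<close>

lemma continuous_adj_mat:
  fixes A :: "'b :: t2_space \<Rightarrow> real mat"
  assumes "\<And>s. A s \<in> carrier_mat n n"
    "\<And>i j. i < n \<Longrightarrow> j < n \<Longrightarrow> continuous F (\<lambda>s. A s $$ (i, j))" "a < n" "b < n"
  shows "continuous F (\<lambda>s. adj_mat (A s) $$ (a, b))"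
proof -
  have dims: "dim_row (A s) = n" "dim_col (A s) = n" for s using assms(1)[of s] by auto
  have "continuous F (\<lambda>s. det (mat_delete (A s) b a))"
    by (rule continuous_det[of _ "n - 1"]) (auto simp: mat_delete_def dims intro!: assms(2))
  then have "continuous F (\<lambda>s. (- 1) ^ (b + a) * det (mat_delete (A s) b a))"
    by (intro continuous_mult continuous_const)
  then show ?thesis using assms(3,4) by (simp add: adj_mat_def cofactor_def dims)
qed

text \<open>Since \<open>f t = 0\<close>, the difference quotient of the product is that of
  \<open>f\<close> times \<open>g s\<close>. The factor \<open>g\<close> has only to be continuous,
  as is the inverse given by Cramer's rule.\<close>

lemma DERIV_zero_times_continuous:
  fixes f g :: "real \<Rightarrow> real"
  assumes "(f has_real_derivative 0) (at t within I)" "f t = 0" "continuous (at t within I) g"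
  shows "((\<lambda>s. f s * g s) has_real_derivative 0) (at t within I)"
proof -
  have "((\<lambda>s. (f s - f t) / (s - t) * g s) \<longlongrightarrow> 0 * g t) (at t within I)"
    using assms(1,3) by (intro tendsto_mult) (simp_all add: has_field_derivative_iff continuous_within)
  then show ?thesis using assms(2) by (simp add: has_field_derivative_iff)
qed

lemma DERIV_zero_interval_const:
  fixes f :: "real \<Rightarrow> real"
  assumes "\<And>s. s \<in> {a..b} \<Longrightarrow> (f has_real_derivative 0) (at s within {a..b})" "s \<in> {a..b}"
  shows "f s = f a"
proof (cases "a < b")
  case True
  have "continuous_on {a..b} f"
    using assms(1) DERIV_continuous unfolding continuous_on_eq_continuous_within by blast
  moreover have "DERIV f x :> 0" if "a < x" "x < b" for x
    using assms(1)[of x] that by (simp add: at_within_Icc_at)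
  ultimately show ?thesis using DERIV_isconst2[OF True, of f s] assms(2) by auto
next
  case False
  then have "s = a" using assms(2) by auto
  then show ?thesis by simp
qed

text \<open>Only the segment between the two points has to lie in \<open>J\<close>, which will be
  the part of \<open>{a..b}\<close> near some time \<open>t\<close>. It may be open at one side and
  touch an end point at the other.\<close>

lemma DERIV_zero_interval_const2:
  fixes f :: "real \<Rightarrow> real"
  assumes "\<And>s. s \<in> J \<Longrightarrow> (f has_real_derivative 0) (at s within J)"
    "s \<in> J" "t \<in> J" "{min s t..max s t} \<subseteq> J"
  shows "f s = f t"
proof -
  have "(f has_real_derivative 0) (at x within {min s t..max s t})" if "x \<in> {min s t..max s t}" for x
    using assms(1)[of x] assms(4) that by (blast intro: DERIV_subset)
  note const = DERIV_zero_interval_const[OF this]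
  have "f s = f (min s t)" by (rule const) auto
  also have "\<dots> = f t" by (rule const[symmetric]) auto
  finally show ?thesis .
qed

text \<open>Near \<open>t\<close> a fixed combination \<open>M s * C\<close> of the columns is a basis of the range of \<open>M s\<close>.
  Normalised by \<open>(range_basis (M t))\<^sup>T * (M s * C)\<close> it becomes independent of the choice
  of the basis, so that its derivative vanishes.\<close>

lemma range_basis_locally_constant:
  fixes M D :: "real \<Rightarrow> real mat"
  assumes M: "\<And>s. M s \<in> carrier_mat m n" and D: "\<And>s. D s \<in> carrier_mat m n"
    and rank: "\<And>s. s \<in> {a..b} \<Longrightarrow> mat_rank (M s) = r"
    and deriv: "\<And>s. s \<in> {a..b} \<Longrightarrow> mat_deriv m n M (D s) s {a..b}"
    and range: "\<And>s. s \<in> {a..b} \<Longrightarrow> range_basis (M s) * ((range_basis (M s))\<^sup>T * D s) = D s"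
    and t: "t \<in> {a..b}"
  shows "eventually (\<lambda>s. range_basis (M t) = range_basis (M s)) (at t within {a..b})"
proof -
  define W where "W s = range_basis (M s)" for s
  have dimM [simp]: "dim_row (M s) = m" "dim_col (M s) = n" "dim_row (D s) = m" "dim_col (D s) = n" for s
    using M[of s] D[of s] by auto
  have dimW [simp]: "dim_row (W s) = m" for s by (simp add: W_def)
  have dimWc [simp]: "dim_col (W s) = r" if "s \<in> {a..b}" for s using rank[OF that] by (simp add: W_def)
  have WW: "(W s)\<^sup>T * W s = 1\<^sub>m r" if "s \<in> {a..b}" for s
    using range_basis_orthonormal[of "M s"] rank[OF that] by (simp add: W_def)
  obtain C where C: "C \<in> carrier_mat n r" "W t = M t * C"
    using range_basis_factor[of "M t"] rank[OF t] dimM(2) unfolding W_def by metis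
  have dimC [simp]: "dim_row C = n" "dim_col C = r" using C by auto
  \<comment> \<open>The chosen basis \<open>W s\<close> has no regularity in \<open>s\<close>.
    \<open>F s\<close> uses the coefficients of time \<open>t\<close> instead: it is differentiable
    and agrees with \<open>W t\<close> at \<open>s = t\<close>.\<close>
  define F where "F s = M s * C" for s
  define H where "H s = (W t)\<^sup>T * F s" for s
  have F: "F s \<in> carrier_mat m r" for s by (intro carrier_matI) (simp_all add: F_def)
  have dimF [simp]: "dim_row (F s) = m" "dim_col (F s) = r" for s using F[of s] by auto
  have H: "H s \<in> carrier_mat r r" for s by (intro carrier_matI) (use t in \<open>simp_all add: H_def\<close>)
  have dimH [simp]: "dim_row (H s) = r" "dim_col (H s) = r" for s using H[of s] by auto
  have Ht: "H t = 1\<^sub>m r" unfolding H_def F_def C(2)[symmetric] by (rule WW[OF t])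
  have derivF: "mat_deriv m r F (D s * C) s {a..b}" if "s \<in> {a..b}" for s
    unfolding F_def by (rule mat_deriv_mult_right[OF deriv[OF that] C(1) M D])
  have derivH: "mat_deriv r r H ((W t)\<^sup>T * (D s * C)) s {a..b}" if "s \<in> {a..b}" for s
    unfolding H_def by (intro mat_deriv_mult_left[OF derivF[OF that]] carrier_matI) (use t in auto)
  have contH: "continuous (at s within {a..b}) (\<lambda>s. H s $$ (i, j))"
    if "s \<in> {a..b}" "i < r" "j < r" for s i j
    using derivH[OF that(1)] that by (auto simp: mat_deriv_def intro: DERIV_continuous)
  have contdet: "continuous (at s within {a..b}) (\<lambda>s. det (H s))" if "s \<in> {a..b}" for s
    by (intro continuous_det[of H r] H contH that)
  \<comment> \<open>As \<open>H t\<close> is the identity, its determinant is 1 and stays positive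
    nearby, where \<open>H\<close> is therefore invertible.\<close>
  have "((\<lambda>s. det (H s)) \<longlongrightarrow> det (H t)) (at t within {a..b})"
    using contdet[OF t] by (simp add: continuous_within)
  moreover have dett: "det (H t) = 1" by (simp add: Ht)
  ultimately have "\<forall>\<^sub>F s in at t within {a..b}. det (H s) > 0"
    by (intro order_tendstoD(1)[of _ 1]) auto
  then obtain e where e: "e > 0" "\<And>s. s \<in> {a..b} \<Longrightarrow> s \<noteq> t \<Longrightarrow> dist s t < e \<Longrightarrow> det (H s) > 0"
    by (auto simp: eventually_at)
  \<comment> \<open>The neighbourhood of \<open>t\<close>, relative to the interval, on which
    \<open>H\<close> is invertible.\<close>
  define J where "J = {s \<in> {a..b}. dist s t < e}"
  have J: "J \<subseteq> {a..b}" and tJ: "t \<in> J" using t e(1) by (auto simp: J_def)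
  have det: "det (H s) \<noteq> 0" if "s \<in> J" for s
    using that e(2)[of s] dett by (cases "s = t") (auto simp: J_def)
  define Hi where "Hi s = (1 / det (H s)) \<cdot>\<^sub>m adj_mat (H s)" for s
  have adj: "adj_mat (H s) \<in> carrier_mat r r" for s using adj_mat(1)[OF H] .
  then have dimHi [simp]: "dim_row (Hi s) = r" "dim_col (Hi s) = r" for s
    using adj[of s] by (auto simp: Hi_def)
  have HHi: "H s * Hi s = 1\<^sub>m r" "Hi s * H s = 1\<^sub>m r" if "s \<in> J" for s
    using adj_mat[OF H, of s] det[OF that] mult_smult_distrib[OF H adj, of s "1 / det (H s)" s]
      mult_smult_assoc_mat[OF adj H, of "1 / det (H s)" s s]
    by (auto simp: Hi_def)
  have contHi: "continuous (at s within J) (\<lambda>s. Hi s $$ (i, j))" if "s \<in> J" "i < r" "j < r" for s i j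
  proof -
    have s: "s \<in> {a..b}" using that J by auto
    have "continuous (at s within {a..b}) (\<lambda>s. 1 / det (H s) * adj_mat (H s) $$ (i, j))"
      using det[OF that(1)] contH[OF s]
      by (intro continuous_mult continuous_at_within_divide contdet[OF s] continuous_const
          continuous_adj_mat[of H r] H that) auto
    then have "continuous (at s within J) (\<lambda>s. 1 / det (H s) * adj_mat (H s) $$ (i, j))"
      unfolding continuous_within using J by (rule tendsto_within_subset)
    moreover have "Hi s $$ (i, j) = 1 / det (H s) * adj_mat (H s) $$ (i, j)" for s
      using adj[of s] that by (simp add: Hi_def)
    ultimately show ?thesis by simp
  qed
  \<comment> \<open>On \<open>J\<close> this is the basis of the range of \<open>M s\<close> with
    \<open>(W t)\<^sup>T * N s = 1\<close>. That condition singles out one basis of a given range,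
    so \<open>N\<close> is constant if and only if the range is.\<close>
  define N where "N s = F s * Hi s" for s
  have dimN [simp]: "dim_row (N s) = m" "dim_col (N s) = r" for s by (simp_all add: N_def)
  have NH: "N s * H s = F s" if "s \<in> J" for s
    using HHi[OF that] by (simp add: N_def mult_assoc_dim right_mult_one_mat[OF F])
  define X where "X s = Hi s * ((W t)\<^sup>T * W s)" for s
  have dimX [simp]: "dim_row (X s) = r" "dim_col (X s) = r" if "s \<in> J" for s
    using that J by (auto simp: X_def)
  \<comment> \<open>Constancy of the rank enters here. The columns of \<open>F s\<close> lie in the
    range of \<open>M s\<close>, so \<open>F s = W s * E\<close> with \<open>E\<close> square.
    \<open>X s\<close> is a left inverse of \<open>E\<close>, hence also a right one, and
    \<open>F s\<close> spans the whole range.\<close>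
  have WFX: "W s = F s * X s" if "s \<in> J" for s
  proof -
    have s: "s \<in> {a..b}" using that J by auto
    define E where "E = (W s)\<^sup>T * F s"
    have E: "E \<in> carrier_mat r r" by (intro carrier_matI) (use s in \<open>simp_all add: E_def\<close>)
    have X: "X s \<in> carrier_mat r r" by (intro carrier_matI) (use that in simp_all)
    have WE: "W s * E = F s"
      using s range_basis_proj[of "M s"]
      by (simp add: E_def F_def W_def rank mult_assoc_dim[symmetric])
    have "X s * E = Hi s * ((W t)\<^sup>T * (W s * E))"
      using s t E by (simp add: X_def mult_assoc_dim)
    also have "\<dots> = 1\<^sub>m r" unfolding WE H_def[symmetric] by (rule HHi(2)[OF that])
    finally have "E * X s = 1\<^sub>m r" by (rule mat_mult_left_right_inverse[OF X E])
    then have "W s * (E * X s) = W s" using s by simp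
    then show ?thesis using s E that by (simp add: WE[symmetric] mult_assoc_dim)
  qed
  \<comment> \<open>\<open>N s * (W t)\<^sup>T\<close> is an oblique projector onto the range of
    \<open>M s\<close>. It fixes \<open>D s * C\<close>, because the derivative lies in that
    range.\<close>
  have zero: "N s * ((W t)\<^sup>T * (D s * C)) = D s * C" if "s \<in> J" for s
  proof -
    have s: "s \<in> {a..b}" using that J by auto
    define B where "B = X s * ((W s)\<^sup>T * (D s * C))"
    have dimB [simp]: "dim_row B = r" "dim_col B = r" using s that by (simp_all add: B_def)
    have "D s * C = W s * ((W s)\<^sup>T * (D s * C))"
      using range[OF s] s by (simp add: W_def[symmetric] mult_assoc_dim[symmetric])
    also have "\<dots> = F s * B"
      using s that by (subst WFX[OF that]) (simp add: B_def mult_assoc_dim)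
    finally have DC: "D s * C = F s * B" .
    have "N s * ((W t)\<^sup>T * (F s * B)) = N s * H s * B"
      using t by (simp add: H_def mult_assoc_dim)
    then show ?thesis by (simp add: DC NH[OF that])
  qed
  have derivN: "((\<lambda>x. N x $$ (i, j)) has_real_derivative 0) (at s within J)"
    if "s \<in> J" "i < m" "j < r" for s i j
  proof -
    have s: "s \<in> {a..b}" using that J by auto
    \<comment> \<open>\<open>\<phi>\<close> is the error made when \<open>N x\<close> is replaced by
      \<open>N s\<close> in \<open>F x = N x * H x\<close>. It vanishes at \<open>x = s\<close>
      together with its derivative, by \<open>zero\<close>; multiplication by the continuous inverse
      \<open>Hi\<close> preserves this.\<close>
    define \<phi> where "\<phi> c x = F x $$ (i, c) - (N s * H x) $$ (i, c)" for c x
    have derivNH: "mat_deriv m r (\<lambda>x. N s * H x) (D s * C) s {a..b}"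
    proof -
      have "N s \<in> carrier_mat m r" "(W t)\<^sup>T * (D s * C) \<in> carrier_mat r r"
        by (intro carrier_matI; use t in simp)+
      from mat_deriv_mult_left[OF derivH[OF s] this(1) H this(2)] show ?thesis
        by (simp add: zero[OF that(1)])
    qed
    have "(\<phi> c has_real_derivative 0) (at s within J)" if "c < r" for c
    proof -
      have "(\<phi> c has_real_derivative (D s * C) $$ (i, c) - (D s * C) $$ (i, c)) (at s within {a..b})"
        unfolding \<phi>_def using derivF[OF s] derivNH that \<open>i < m\<close>
        by (intro DERIV_diff) (auto simp: mat_deriv_def)
      then show ?thesis using J by (auto intro: DERIV_subset)
    qed
    moreover have "\<phi> c s = 0" if "c < r" for c using NH[OF \<open>s \<in> J\<close>] by (simp add: \<phi>_def)
    ultimately have dsum: "((\<lambda>x. N s $$ (i, j) + (\<Sum>c<r. \<phi> c x * Hi x $$ (c, j)))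
        has_real_derivative 0 + (\<Sum>c<r. 0)) (at s within J)"
      using that by (intro DERIV_add DERIV_const DERIV_sum DERIV_zero_times_continuous contHi) auto
    \<comment> \<open>Entrywise this is \<open>N x = N s + (F x - N s * H x) * Hi x\<close>, valid
      wherever \<open>H x\<close> is invertible.\<close>
    have Nx: "N x $$ (i, j) = N s $$ (i, j) + (\<Sum>c<r. \<phi> c x * Hi x $$ (c, j))" if "x \<in> J" for x
    proof -
      have "N s = N s * (H x * Hi x)" by (simp add: HHi(1)[OF that])
      also have "\<dots> = N s * H x * Hi x" by (simp add: mult_assoc_dim)
      finally have "N s $$ (i, j) = (\<Sum>c<r. (N s * H x) $$ (i, c) * Hi x $$ (c, j))"
        using \<open>i < m\<close> \<open>j < r\<close> mult_mat_index[of i "N s * H x" j "Hi x"] by simp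
      moreover have "N x $$ (i, j) = (\<Sum>c<r. F x $$ (i, c) * Hi x $$ (c, j))"
        using \<open>i < m\<close> \<open>j < r\<close> mult_mat_index[of i "F x" j "Hi x"] by (simp add: N_def)
      ultimately show ?thesis by (simp add: \<phi>_def left_diff_distrib sum_subtractf)
    qed
    have "((\<lambda>x. N x $$ (i, j)) has_real_derivative 0 + (\<Sum>c<r. 0)) (at s within J)"
    proof (rule has_field_derivative_transform_within)
      show "((\<lambda>x. N s $$ (i, j) + (\<Sum>c<r. \<phi> c x * Hi x $$ (c, j)))
        has_real_derivative 0 + (\<Sum>c<r. 0)) (at s within J)" by (rule dsum)
      show "(0::real) < 1" by simp
      show "s \<in> J" by (rule that(1))
    qed (rule Nx[symmetric])
    then show ?thesis by simp
  qed
  have "range_basis (M t) = range_basis (M s)" if "s \<in> J" for s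
  proof -
    have s: "s \<in> {a..b}" using that J by auto
    \<comment> \<open>\<open>J\<close> is the intersection of an interval with a ball, hence
      convex.\<close>
    have "{min s t..max s t} \<subseteq> J"
      using that tJ by (auto simp: J_def dist_real_def)
    then have "N s $$ (i, j) = N t $$ (i, j)" if "i < m" "j < r" for i j
      using \<open>s \<in> J\<close> tJ that derivN by (intro DERIV_zero_interval_const2[of J]) auto
    then have "N s = N t" by (intro eq_matI) auto
    also have "N t = W t"
      using NH[OF tJ] C(2) by (simp add: Ht F_def)
    \<comment> \<open>From \<open>W s = F s * X s = N s * H s * X s\<close> and
      \<open>N s = N t = W t\<close>. The square factor \<open>H s * X s\<close> is all that
      \<open>range_basis_eqI\<close> asks for.\<close>
    finally have "W s = W t * (H s * X s)"
      using WFX[OF that] NH[OF that] that t by (simp add: mult_assoc_dim[symmetric])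
    then have "range_basis (M s) = range_basis (M t)" 
    proof -
      assume *: "W s = W t * (H s * X s)"
      have "H s * X s \<in> carrier_mat r r" by (rule carrier_matI) (simp_all add: that)
      with * show ?thesis
        using range_basis_eqI[of "M s" "M t" "H s * X s"] unfolding rank[OF s] rank[OF t] W_def by simp
    qed
    then show ?thesis ..
  qed
  then show ?thesis using e(1) by (auto simp: eventually_at J_def)
qed

text \<open>A function that is locally constant around each point of a connected interval is
  constant.\<close>

lemma range_basis_constant:
  fixes M D :: "real \<Rightarrow> real mat"
  assumes "\<And>s. M s \<in> carrier_mat m n" "\<And>s. D s \<in> carrier_mat m n"
    "\<And>s. s \<in> {a..b} \<Longrightarrow> mat_rank (M s) = r"
    "\<And>s. s \<in> {a..b} \<Longrightarrow> mat_deriv m n M (D s) s {a..b}"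
    "\<And>s. s \<in> {a..b} \<Longrightarrow> range_basis (M s) * ((range_basis (M s))\<^sup>T * D s) = D s"
    "t \<in> {a..b}"
  shows "range_basis (M t) = range_basis (M a)"
proof -
  have "\<forall>t\<in>{a..b}. \<forall>\<^sub>F s in at t within {a..b}. range_basis (M t) = range_basis (M s)"
    using range_basis_locally_constant[OF assms(1-5)] by blast
  moreover have "a \<in> {a..b}" using assms(6) by simp
  ultimately show ?thesis
    using connected_local_const[OF connected_Icc assms(6), of a "\<lambda>s. range_basis (M s)"] by blast
qed

lemma range_basis_constant_frozen:
  fixes M D :: "real \<Rightarrow> real mat"
  assumes M: "\<And>s. M s \<in> carrier_mat m n" and D: "\<And>s. D s \<in> carrier_mat m n"
    and rank: "\<And>s. s \<in> {a..b} \<Longrightarrow> mat_rank (M s) = r"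
    and deriv: "\<And>s. s \<in> {a..b} \<Longrightarrow> mat_deriv m n M (D s) s {a..b}"
    and range: "\<And>s. s \<in> {a..b} \<Longrightarrow> range_basis (M a) * ((range_basis (M a))\<^sup>T * D s) = D s"
    and t: "t \<in> {a..b}"
  shows "range_basis (M t) = range_basis (M a)"
proof -
  define W where "W = range_basis (M a)"
  have a: "a \<in> {a..b}" using t by auto
  have dim [simp]: "dim_row (M s) = m" "dim_col (M s) = n" for s using M[of s] by auto
  have W: "W \<in> carrier_mat m r" by (intro carrier_matI) (simp_all add: W_def rank[OF a])
  have dimW [simp]: "dim_row W = m" "dim_col W = r" using W by auto
  have deriv': "mat_deriv m n (\<lambda>s. W * (W\<^sup>T * M s)) (W * (W\<^sup>T * D s)) s {a..b}" if "s \<in> {a..b}" for s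
  proof -
    have WT: "W\<^sup>T \<in> carrier_mat r m" using W by simp
    from mat_deriv_mult_left[OF mat_deriv_mult_left[OF deriv[OF that] WT M D] W
        mult_carrier_mat[OF WT M] mult_carrier_mat[OF WT D]]
    show ?thesis .
  qed
  have const: "(W * (W\<^sup>T * M t)) $$ (i, j) - M t $$ (i, j) = (W * (W\<^sup>T * M a)) $$ (i, j) - M a $$ (i, j)"
    if "i < m" "j < n" for i j
  proof (rule DERIV_zero_interval_const[of a b "\<lambda>s. (W * (W\<^sup>T * M s)) $$ (i, j) - M s $$ (i, j)", OF _ t])
    fix s assume s: "s \<in> {a..b}"
    have "((\<lambda>s. (W * (W\<^sup>T * M s)) $$ (i, j) - M s $$ (i, j)) has_real_derivative
        (W * (W\<^sup>T * D s)) $$ (i, j) - D s $$ (i, j)) (at s within {a..b})"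
      using deriv'[OF s] deriv[OF s] that unfolding mat_deriv_def by (intro DERIV_diff) blast+
    then show "((\<lambda>s. (W * (W\<^sup>T * M s)) $$ (i, j) - M s $$ (i, j)) has_real_derivative 0)
        (at s within {a..b})"
      unfolding W_def range[OF s] by simp
  qed
  have Wa: "W * (W\<^sup>T * M a) = M a" unfolding W_def by (rule range_basis_proj)
  have entries: "(W * (W\<^sup>T * M t)) $$ (i, j) = M t $$ (i, j)" if "i < m" "j < n" for i j
    using const[OF that] unfolding Wa by linarith
  have proj: "W * (W\<^sup>T * M t) = M t" by (rule eq_matI) (simp_all add: entries del: index_mult_mat(1))
  obtain C where C: "C \<in> carrier_mat n r" "range_basis (M t) = M t * C"
    using range_basis_factor[of "M t"] rank[OF t] dim(2) by metis
  have dimC: "dim_row C = n" "dim_col C = r" using C(1) by auto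
  have "range_basis (M t) = W * (W\<^sup>T * M t) * C" unfolding proj by (rule C(2))
  also have "\<dots> = W * (W\<^sup>T * M t * C)" using dimC by (simp add: mult_assoc_dim)
  finally have eq: "range_basis (M t) = range_basis (M a) * (W\<^sup>T * M t * C)" by (simp add: W_def)
  have "W\<^sup>T * M t * C \<in> carrier_mat r r" by (rule carrier_matI) (simp_all add: dimC)
  then show ?thesis
    using range_basis_eqI[of "M t" "M a", OF _ _ _ eq] unfolding rank[OF a] rank[OF t] by simp
qed

section \<open>Partial products of TT-cores\<close>

lemma sum_lessThan_mult:
  fixes f :: "nat \<Rightarrow> 'a :: comm_monoid_add"
  shows "(\<Sum>x<m * n. f x) = (\<Sum>i<n. \<Sum>a<m. f (a + m * i))"
proof (induction n)
  case (Suc n)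
  have "(\<Sum>x<p + q. f x) = (\<Sum>x<p. f x) + (\<Sum>x<q. f (x + p))" for p q
    by (induction q) (auto simp: ac_simps)
  from this[of "m * n" m] show ?case using Suc by (simp add: add.commute)
qed simp

lemma left_prod_Nil [simp]: "left_prod U [] = 1\<^sub>m 1"
  by (simp add: left_prod_def)

lemma left_prod_snoc: "left_prod U (is @ [i]) = left_prod U is * U (Suc (length is)) i"
proof -
  have "foldl (\<lambda>M l. M * U (l + 1) ((is @ [i]) ! l)) (1\<^sub>m 1) [0..<length is] =
      foldl (\<lambda>M l. M * U (l + 1) (is ! l)) (1\<^sub>m 1) [0..<length is]"
    by (intro foldl_cong) (auto simp: nth_append)
  then show ?thesis by (simp add: left_prod_def)
qed

lemma right_prod_Nil [simp]: "right_prod V k [] = 1\<^sub>m 1"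
  by (simp add: right_prod_def)

lemma right_prod_Cons: "right_prod V k (i # is) = V (Suc k) i * right_prod V (Suc k) is"
proof -
  have "[0..<length (i # is)] = 0 # map Suc [0..<length is]"
    by (simp add: upt_conv_Cons map_Suc_upt del: upt_Suc)
  then show ?thesis unfolding right_prod_def by (simp add: foldr_map o_def del: upt_Suc)
qed

lemma is_core_dim:
  assumes "is_core ns r (Suc k) C" "i < ns ! k"
  shows "dim_row (C i) = r ! k" "dim_col (C i) = r ! Suc k"
  using assms by (auto simp: is_core_def)

lemma dim_left_prod:
  assumes "k \<le> length ns" "r ! 0 = 1" "\<And>l. l \<in> {1..k} \<Longrightarrow> is_core ns r l (U l)" "is \<in> midx (take k ns)"
  shows "dim_row (left_prod U is) = 1 \<and> dim_col (left_prod U is) = r ! k"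
  using assms
proof (induction k arbitrary: "is")
  case (Suc k)
  have take: "take (Suc k) ns = take k ns @ [ns ! k]" using Suc.prems(1) by (simp add: take_Suc_conv_app_nth)
  have len: "length is = Suc k" using Suc.prems(1,4) midx_length by fastforce
  define js where "js = take k is"
  have split: "is = js @ [is ! k]" using len by (simp add: js_def take_Suc_conv_app_nth[symmetric])
  have js: "js \<in> midx (take k ns)"
    using midx_take[OF Suc.prems(4), of k] Suc.prems(1) by (simp add: js_def min_def)
  have "is ! k < ns ! k" using Suc.prems(1,4) by (auto simp: midx_def)
  from is_core_dim[OF Suc.prems(3) this]
  have "dim_col (U (Suc k) (is ! k)) = r ! Suc k" by simp
  moreover have "length js = k" using len by (simp add: js_def)
  moreover have "dim_row (left_prod U js) = 1"
    using Suc.IH[OF _ Suc.prems(2) _ js] Suc.prems(1,3) by simp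
  ultimately show ?case by (subst (1 2) split) (simp add: left_prod_snoc)
qed simp

lemma dim_right_prod:
  assumes "k \<le> length ns" "r ! length ns = 1"
    "\<And>l. l \<in> {k+1..length ns} \<Longrightarrow> is_core ns r l (V l)" "is \<in> midx (drop k ns)"
  shows "dim_row (right_prod V k is) = r ! k \<and> dim_col (right_prod V k is) = 1"
  using assms
proof (induction "length ns - k" arbitrary: k "is")
  case (Suc n)
  then have k: "k < length ns" by simp
  then have "drop k ns = ns ! k # drop (Suc k) ns" by (simp add: Cons_nth_drop_Suc)
  with Suc.prems(4) obtain i js where "is": "is = i # js" "i < ns ! k" "js \<in> midx (drop (Suc k) ns)"
    by (auto simp: midx_Cons)
  have "is_core ns r (Suc k) (V (Suc k))" using Suc.prems(3) k by simp
  then have "V (Suc k) i \<in> carrier_mat (r ! k) (r ! Suc k)" using "is"(2) by (simp add: is_core_def)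
  moreover have "dim_col (right_prod V (Suc k) js) = 1"
    using Suc.hyps(1)[of "Suc k" js] Suc.hyps(2) Suc.prems(2,3) k "is"(3) by simp
  ultimately show ?case by (simp add: "is"(1) right_prod_Cons)
next
  case 0
  then have "k = length ns" by simp
  then show ?case using 0 by simp
qed

lemma dim_U_le [simp]: "dim_row (U_le ns r U k) = prod_list (take k ns)" "dim_col (U_le ns r U k) = r ! k"
  by (auto simp: U_le_def)

lemma dim_V_gt [simp]: "dim_row (V_gt ns r V k) = prod_list (drop k ns)" "dim_col (V_gt ns r V k) = r ! k"
  by (auto simp: V_gt_def)

text \<open>The new index \<open>i\<close> is the slowest in the row index: the rows with fixed
  \<open>i\<close> form a block, which is the previous matrix times one slice of the core.\<close>

lemma U_le_Suc:
  assumes "Suc k \<le> length ns" "r ! 0 = 1" "\<And>l. l \<in> {1..Suc k} \<Longrightarrow> is_core ns r l (U l)"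
    "a < prod_list (take k ns)" "i < ns ! k" "b < r ! Suc k"
  shows "U_le ns r U (Suc k) $$ (a + prod_list (take k ns) * i, b) = (U_le ns r U k * U (Suc k) i) $$ (a, b)"
proof -
  have take: "take (Suc k) ns = take k ns @ [ns ! k]" using assms(1) by (simp add: take_Suc_conv_app_nth)
  have core: "dim_row (U (Suc k) i) = r ! k" "dim_col (U (Suc k) i) = r ! Suc k"
    using is_core_dim[OF assms(3) assms(5)] by simp_all
  define xs where "xs = uncolex (take k ns) a"
  have xs: "xs \<in> midx (take k ns)" unfolding xs_def by (rule uncolex_midx[OF assms(4)])
  then have len: "length xs = k" using assms(1) midx_length by fastforce
  have dim: "dim_row (left_prod U xs) = 1" "dim_col (left_prod U xs) = r ! k"
    using dim_left_prod[OF _ assms(2) _ xs, of U] assms(1,3) by auto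
  have "U_le ns r U (Suc k) $$ (a + prod_list (take k ns) * i, b) =
      (left_prod U xs * U (Suc k) i) $$ (0, b)"
    using assms(4-6) add_mult_less[OF assms(4,5)] len
    by (simp add: U_le_def take uncolex_snoc left_prod_snoc xs_def)
  also have "\<dots> = (\<Sum>c<r ! k. left_prod U xs $$ (0, c) * U (Suc k) i $$ (c, b))"
    using assms(6) by (subst mult_mat_index) (simp_all add: dim core)
  also have "\<dots> = (U_le ns r U k * U (Suc k) i) $$ (a, b)"
    using assms(4,6) by (subst mult_mat_index) (simp_all add: core U_le_def xs_def)
  finally show ?thesis .
qed

text \<open>Mirror image of \<open>U_le_Suc\<close>: the index split off is now the fastest, so the
  rows with fixed \<open>i\<close> are spaced by \<open>ns ! k\<close>.\<close>

lemma V_gt_pred: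
  assumes "k < length ns" "r ! length ns = 1" "\<And>l. l \<in> {k+1..length ns} \<Longrightarrow> is_core ns r l (V l)"
    "a < prod_list (drop (Suc k) ns)" "i < ns ! k" "b < r ! k"
  shows "V_gt ns r V k $$ (i + ns ! k * a, b) = (V (Suc k) i * (V_gt ns r V (Suc k))\<^sup>T) $$ (b, a)"
proof -
  have drop: "drop k ns = ns ! k # drop (Suc k) ns" using assms(1) by (simp add: Cons_nth_drop_Suc)
  have core: "dim_row (V (Suc k) i) = r ! k" "dim_col (V (Suc k) i) = r ! Suc k"
    using is_core_dim[OF assms(3) assms(5)] assms(1) by simp_all
  define xs where "xs = uncolex (drop (Suc k) ns) a"
  have xs: "xs \<in> midx (drop (Suc k) ns)" unfolding xs_def by (rule uncolex_midx[OF assms(4)])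
  have dim: "dim_row (right_prod V (Suc k) xs) = r ! Suc k" "dim_col (right_prod V (Suc k) xs) = 1"
    using dim_right_prod[OF _ assms(2) _ xs, of V] assms(1,3) by auto
  have "V_gt ns r V k $$ (i + ns ! k * a, b) = (V (Suc k) i * right_prod V (Suc k) xs) $$ (b, 0)"
    using assms(4-6) add_mult_less[OF assms(5,4)]
    by (simp add: V_gt_def drop right_prod_Cons xs_def)
  also have "\<dots> = (\<Sum>c<r ! Suc k. V (Suc k) i $$ (b, c) * right_prod V (Suc k) xs $$ (c, 0))"
    using assms(6) by (subst mult_mat_index) (simp_all add: dim core)
  also have "\<dots> = (V (Suc k) i * (V_gt ns r V (Suc k))\<^sup>T) $$ (b, a)"
    using assms(4,6) by (subst mult_mat_index) (simp_all add: core V_gt_def xs_def)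
  finally show ?thesis .
qed

section \<open>Orthonormality of the partial products\<close>

lemma gram_index:
  fixes A :: "real mat"
  assumes "b < dim_col A" "c < dim_col A"
  shows "(A\<^sup>T * A) $$ (b, c) = (\<Sum>x<dim_row A. A $$ (x, b) * A $$ (x, c))"
  using assms by (subst mult_mat_index) simp_all

text \<open>The Gram matrix is the sum over \<open>i\<close> of
  \<open>(C i)\<^sup>T * W\<^sup>T * W * C i\<close>. The inner product is the identity by
  induction, and what remains is the Gram matrix of the left reshaping of the new core.\<close>

lemma U_le_orthonormal:
  assumes "k \<le> length ns" "r ! 0 = 1" "\<And>l. l \<in> {1..k} \<Longrightarrow> left_orthogonal ns r l (U l)"
  shows "(U_le ns r U k)\<^sup>T * U_le ns r U k = 1\<^sub>m (r ! k)"
  using assms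
proof (induction k)
  case 0
  show ?case
    by (rule eq_matI) (simp_all add: gram_index 0 U_le_def del: index_mult_mat(1))
next
  case (Suc k)
  define W W' C where "W = U_le ns r U k" and "W' = U_le ns r U (Suc k)" and "C = U (Suc k)"
  define m n p q where "m = prod_list (take k ns)" and "n = ns ! k" and "p = r ! k" and "q = r ! Suc k"
  have W: "W\<^sup>T * W = 1\<^sub>m p" unfolding W_def p_def using Suc by simp
  have dW: "dim_row W = m" "dim_col W = p" "dim_row W' = m * n" "dim_col W' = q"
    using Suc.prems(1) by (simp_all add: W_def W'_def m_def n_def p_def q_def take_Suc_conv_app_nth)
  have cores: "\<And>l. l \<in> {1..Suc k} \<Longrightarrow> is_core ns r l (U l)"
    using Suc.prems(3) by (auto simp: left_orthogonal_def)
  have dC: "dim_row (C i) = p" "dim_col (C i) = q" if "i < n" for i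
    using is_core_dim[of ns r k C i] cores[of "Suc k"] that by (simp_all add: C_def n_def p_def q_def)
  define M where "M = reshape_left p n q C"
  have M: "M\<^sup>T * M = 1\<^sub>m q"
    using Suc.prems(3)[of "Suc k"]
    by (simp add: left_orthogonal_def Let_def M_def C_def n_def p_def q_def)
  have dM: "dim_row M = p * n" "dim_col M = q" by (simp_all add: M_def reshape_left_def)
  show ?case unfolding W'_def[symmetric] q_def[symmetric]
  proof (rule eq_matI)
    fix b c assume "b < dim_row (1\<^sub>m q :: real mat)" "c < dim_col (1\<^sub>m q :: real mat)"
    then have bc: "b < q" "c < q" by auto
    have "(W'\<^sup>T * W') $$ (b, c) = (\<Sum>i<n. \<Sum>a<m. W' $$ (a + m * i, b) * W' $$ (a + m * i, c))"
      using bc dW by (subst gram_index) (simp_all add: sum_lessThan_mult)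
    also have "\<dots> = (\<Sum>i<n. \<Sum>a<m. (W * C i) $$ (a, b) * (W * C i) $$ (a, c))"
      using bc U_le_Suc[OF Suc.prems(1,2) cores]
      by (intro sum.cong refl) (simp add: W_def W'_def C_def m_def n_def q_def del: index_mult_mat(1))
    also have "\<dots> = (\<Sum>i<n. ((W * C i)\<^sup>T * (W * C i)) $$ (b, c))"
      using bc dC dW by (intro sum.cong refl) (subst gram_index, simp_all del: index_mult_mat(1))
    also have "\<dots> = (\<Sum>i<n. ((C i)\<^sup>T * C i) $$ (b, c))"
      using dC dW
      by (intro sum.cong refl) (simp add: transpose_mult_dim mult_assoc_dim left_inverse_cancel[OF W])
    also have "\<dots> = (\<Sum>i<n. \<Sum>a<p. C i $$ (a, b) * C i $$ (a, c))"
      using bc dC by (intro sum.cong refl) (subst gram_index, simp_all)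
    also have "\<dots> = (M\<^sup>T * M) $$ (b, c)"
    proof -
      have "M $$ (a + p * i, b) = C i $$ (a, b)" if "i < n" "a < p" "b < q" for i a b
        using that add_mult_less[OF that(2,1)] by (simp add: M_def reshape_left_def)
      then show ?thesis
        using bc dM by (subst gram_index) (simp_all add: sum_lessThan_mult)
    qed
    also have "\<dots> = 1\<^sub>m q $$ (b, c)" by (simp add: M)
    finally show "(W'\<^sup>T * W') $$ (b, c) = 1\<^sub>m q $$ (b, c)" .
  qed (simp_all add: dW)
qed

text \<open>Induction from \<open>k = length ns\<close> downwards, adding a core on the left. The
  remaining sum of \<open>C i * (C i)\<^sup>T\<close> is the Gram matrix of the rows of the right
  reshaping.\<close>

lemma V_gt_orthonormal:
  assumes "k \<le> length ns" "r ! length ns = 1"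
    "\<And>l. l \<in> {k+1..length ns} \<Longrightarrow> right_orthogonal ns r l (V l)"
  shows "(V_gt ns r V k)\<^sup>T * V_gt ns r V k = 1\<^sub>m (r ! k)"
  using assms
proof (induction "length ns - k" arbitrary: k)
  case 0
  then have k: "k = length ns" by simp
  show ?case unfolding k
    by (rule eq_matI) (simp_all add: gram_index 0(3) V_gt_def del: index_mult_mat(1))
next
  case (Suc d)
  then have k: "k < length ns" by simp
  define W W' C where "W = V_gt ns r V (Suc k)" and "W' = V_gt ns r V k" and "C = V (Suc k)"
  define m n p q where "m = prod_list (drop (Suc k) ns)" and "n = ns ! k"
    and "p = r ! k" and "q = r ! Suc k"
  have W: "W\<^sup>T * W = 1\<^sub>m q" unfolding W_def q_def using Suc k by simp
  have drop: "drop k ns = ns ! k # drop (Suc k) ns" using k by (simp add: Cons_nth_drop_Suc)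
  have dW: "dim_row W = m" "dim_col W = q" "dim_row W' = n * m" "dim_col W' = p"
    by (simp_all add: W_def W'_def m_def n_def p_def q_def drop)
  have cores: "\<And>l. l \<in> {k+1..length ns} \<Longrightarrow> is_core ns r l (V l)"
    using Suc.prems(3) by (auto simp: right_orthogonal_def)
  have dC: "dim_row (C i) = p" "dim_col (C i) = q" if "i < n" for i
    using is_core_dim[of ns r k C i] cores[of "Suc k"] that k by (simp_all add: C_def n_def p_def q_def)
  define M where "M = reshape_right p n q C"
  have M: "M * M\<^sup>T = 1\<^sub>m p"
    using Suc.prems(3)[of "Suc k"] k
    by (simp add: right_orthogonal_def Let_def M_def C_def n_def p_def q_def)
  have dM: "dim_row M = p" "dim_col M = n * q" by (simp_all add: M_def reshape_right_def)
  show ?case unfolding W'_def[symmetric] p_def[symmetric]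
  proof (rule eq_matI)
    fix b c assume "b < dim_row (1\<^sub>m p :: real mat)" "c < dim_col (1\<^sub>m p :: real mat)"
    then have bc: "b < p" "c < p" by auto
    have "(W'\<^sup>T * W') $$ (b, c) = (\<Sum>a<m. \<Sum>i<n. W' $$ (i + n * a, b) * W' $$ (i + n * a, c))"
      using bc dW by (subst gram_index) (simp_all add: sum_lessThan_mult)
    also have "\<dots> = (\<Sum>a<m. \<Sum>i<n. (C i * W\<^sup>T) $$ (b, a) * (C i * W\<^sup>T) $$ (c, a))"
      using bc V_gt_pred[OF k Suc.prems(2) cores]
      by (intro sum.cong refl) (simp add: W_def W'_def C_def m_def n_def p_def del: index_mult_mat(1))
    also have "\<dots> = (\<Sum>i<n. \<Sum>a<m. (C i * W\<^sup>T) $$ (b, a) * (C i * W\<^sup>T) $$ (c, a))"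
      by (rule sum.swap)
    also have "\<dots> = (\<Sum>i<n. ((C i * W\<^sup>T) * (C i * W\<^sup>T)\<^sup>T) $$ (b, c))"
      using bc dC dW by (intro sum.cong refl) (subst (3) mult_mat_index, simp_all del: index_mult_mat(1))
    also have "\<dots> = (\<Sum>i<n. (C i * (C i)\<^sup>T) $$ (b, c))"
      using dC dW
      by (intro sum.cong refl) (simp add: transpose_mult_dim mult_assoc_dim left_inverse_cancel[OF W])
    also have "\<dots> = (\<Sum>i<n. \<Sum>a<q. C i $$ (b, a) * C i $$ (c, a))"
      using bc dC by (intro sum.cong refl) (subst mult_mat_index, simp_all)
    also have "\<dots> = (\<Sum>a<q. \<Sum>i<n. C i $$ (b, a) * C i $$ (c, a))"
      by (rule sum.swap)
    also have "\<dots> = (M * M\<^sup>T) $$ (b, c)"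
    proof -
      have "M $$ (b, i + n * a) = C i $$ (b, a)" if "i < n" "a < q" "b < p" for i a b
        using that add_mult_less[OF that(1,2)] by (simp add: M_def reshape_right_def)
      then show ?thesis
        using bc dM by (subst mult_mat_index) (simp_all add: sum_lessThan_mult add_mult_less)
    qed
    also have "\<dots> = 1\<^sub>m p $$ (b, c)" by (simp add: M)
    finally show "(W'\<^sup>T * W') $$ (b, c) = 1\<^sub>m p $$ (b, c)" .
  qed (simp_all add: dW)
qed

text \<open>Links tensor entries, which are partial products for one multi-index, with the matrices
  that collect these products as rows: only row \<open>a\<close> of \<open>P\<close> and row
  \<open>b\<close> of \<open>Q\<close> enter the entry.\<close>

lemma sandwich_index:
  fixes A K B P Q :: "real mat"
  assumes "dim_row A = 1" "dim_col A = p" "dim_row K = p" "dim_col K = q" "dim_row B = q" "dim_col B = 1"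
    "dim_col P = p" "dim_col Q = q" "a < dim_row P" "b < dim_row Q"
    "\<And>c. c < p \<Longrightarrow> P $$ (a, c) = A $$ (0, c)" "\<And>c. c < q \<Longrightarrow> Q $$ (b, c) = B $$ (c, 0)"
  shows "(P * K * Q\<^sup>T) $$ (a, b) = (A * K * B) $$ (0, 0)"
proof -
  have "(P * K) $$ (a, c) = (A * K) $$ (0, c)" if "c < q" for c
    using assms that mult_mat_index[of a P c K] mult_mat_index[of 0 A c K] by simp
  then show ?thesis
    using assms mult_mat_index[of a "P * K" b "Q\<^sup>T"] mult_mat_index[of 0 "A * K" 0 B]
    by (simp del: index_mult_mat(1))
qed

lemma slice_tt_core_tensor:
  assumes "1 \<le> j" "j \<le> length ns" "r ! 0 = 1" "r ! length ns = 1"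
    "\<And>l. l \<in> {1..j-1} \<Longrightarrow> is_core ns r l (U l)" "\<And>l. l \<in> {j+1..length ns} \<Longrightarrow> is_core ns r l (V l)"
    "i < ns ! (j - 1)" "dim_row (K i) = r ! (j - 1)" "dim_col (K i) = r ! j"
  shows "slice ns j i (tt_core_tensor ns U j K V) = U_le ns r U (j - 1) * K i * (V_gt ns r V j)\<^sup>T"
proof (rule eq_matI)
  fix a b assume "a < dim_row (U_le ns r U (j - 1) * K i * (V_gt ns r V j)\<^sup>T)"
    "b < dim_col (U_le ns r U (j - 1) * K i * (V_gt ns r V j)\<^sup>T)"
  then have ab: "a < prod_list (take (j - 1) ns)" "b < prod_list (drop j ns)" by simp_all
  define xs ys where "xs = uncolex (take (j - 1) ns) a" and "ys = uncolex (drop j ns) b"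
  have xs: "xs \<in> midx (take (j - 1) ns)" and ys: "ys \<in> midx (drop j ns)"
    using uncolex_midx ab by (simp_all add: xs_def ys_def)
  have "length xs = j - 1" using midx_length[OF xs] assms(2) by simp
  then have split: "take (j - 1) (xs @ i # ys) = xs" "(xs @ i # ys) ! (j - 1) = i" "drop j (xs @ i # ys) = ys"
    using assms(1) by (simp_all add: nth_append drop_Cons' del: One_nat_def)
  have dim: "dim_row (left_prod U xs) = 1" "dim_col (left_prod U xs) = r ! (j - 1)"
    "dim_row (right_prod V j ys) = r ! j" "dim_col (right_prod V j ys) = 1"
    using dim_left_prod[OF _ assms(3) assms(5) xs] dim_right_prod[OF assms(2,4,6) ys] assms(2) by simp_all
  have "slice ns j i (tt_core_tensor ns U j K V) $$ (a, b) = (left_prod U xs * K i * right_prod V j ys) $$ (0, 0)"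
    using ab midx_join[OF assms(1,2) xs assms(7) ys] split
    by (simp add: slice_def tt_core_tensor_def xs_def[symmetric] ys_def[symmetric] del: One_nat_def)
  also have "\<dots> = (U_le ns r U (j - 1) * K i * (V_gt ns r V j)\<^sup>T) $$ (a, b)"
    by (rule sandwich_index[symmetric, OF dim(1,2) assms(8,9) dim(3,4)])
      (use ab in \<open>simp_all add: U_le_def V_gt_def xs_def ys_def del: One_nat_def\<close>)
  finally show "slice ns j i (tt_core_tensor ns U j K V) $$ (a, b) =
      (U_le ns r U (j - 1) * K i * (V_gt ns r V j)\<^sup>T) $$ (a, b)" .
qed simp_all

lemma unfold_tt_mat_tensor:
  assumes "j \<le> length ns" "r ! 0 = 1" "r ! length ns = 1"
    "\<And>l. l \<in> {1..j} \<Longrightarrow> is_core ns r l (U l)" "\<And>l. l \<in> {j+1..length ns} \<Longrightarrow> is_core ns r l (V l)"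
    "dim_row S = r ! j" "dim_col S = r ! j"
  shows "unfold ns j (tt_mat_tensor ns U j S V) = U_le ns r U j * S * (V_gt ns r V j)\<^sup>T"
proof (rule eq_matI)
  fix a b assume "a < dim_row (U_le ns r U j * S * (V_gt ns r V j)\<^sup>T)"
    "b < dim_col (U_le ns r U j * S * (V_gt ns r V j)\<^sup>T)"
  then have ab: "a < prod_list (take j ns)" "b < prod_list (drop j ns)" by simp_all
  define xs ys where "xs = uncolex (take j ns) a" and "ys = uncolex (drop j ns) b"
  have xs: "xs \<in> midx (take j ns)" and ys: "ys \<in> midx (drop j ns)"
    using uncolex_midx ab by (simp_all add: xs_def ys_def)
  have "length xs = j" using midx_length[OF xs] assms(1) by simp
  moreover have "xs @ ys \<in> midx ns" using midx_append[OF xs ys] by simp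
  moreover have dim: "dim_row (left_prod U xs) = 1" "dim_col (left_prod U xs) = r ! j"
    "dim_row (right_prod V j ys) = r ! j" "dim_col (right_prod V j ys) = 1"
    using dim_left_prod[OF assms(1,2,4) xs] dim_right_prod[OF assms(1,3,5) ys] by simp_all
  ultimately have "unfold ns j (tt_mat_tensor ns U j S V) $$ (a, b) =
      (left_prod U xs * S * right_prod V j ys) $$ (0, 0)"
    using ab by (simp add: unfold_def tt_mat_tensor_def xs_def[symmetric] ys_def[symmetric])
  also have "\<dots> = (U_le ns r U j * S * (V_gt ns r V j)\<^sup>T) $$ (a, b)"
    by (rule sandwich_index[symmetric, OF dim(1,2) assms(6,7) dim(3,4)])
      (use ab in \<open>simp_all add: U_le_def V_gt_def xs_def ys_def\<close>)
  finally show "unfold ns j (tt_mat_tensor ns U j S V) $$ (a, b) =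
      (U_le ns r U j * S * (V_gt ns r V j)\<^sup>T) $$ (a, b)" .
qed simp_all

lemma tt_core_tensor_tensors: "tt_core_tensor ns U j K V \<in> tensors ns"
  by (simp add: tensors_def tt_core_tensor_def)

lemma tt_mat_tensor_tensors: "tt_mat_tensor ns U j S V \<in> tensors ns"
  by (simp add: tensors_def tt_mat_tensor_def)

section \<open>Interpolatory operators\<close>

lemma sel_mat_dim:
  assumes "I \<subseteq> midx ns"
  shows "dim_row (sel_mat ns I) = prod_list ns" "dim_col (sel_mat ns I) = card I"
  using midx_list(1)[OF assms] by (simp_all add: sel_mat_def)

lemma sel_mat_transpose_mult:
  assumes "I \<subseteq> midx ns" "dim_row M = prod_list ns"
  shows "(sel_mat ns I)\<^sup>T * M = row_sub ns I M"
proof (rule eq_matI)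
  fix a b assume "a < dim_row (row_sub ns I M)" "b < dim_col (row_sub ns I M)"
  then have ab: "a < card I" "b < dim_col M" by (simp_all add: row_sub_def)
  define p where "p = colex ns (midx_list ns I ! a)"
  have p: "p < prod_list ns" unfolding p_def by (rule colex_less[OF midx_list(3)[OF assms(1) ab(1)]])
  have "((sel_mat ns I)\<^sup>T * M) $$ (a, b) = (\<Sum>c<prod_list ns. sel_mat ns I $$ (c, a) * M $$ (c, b))"
    using ab by (subst mult_mat_index) (simp_all add: sel_mat_dim[OF assms(1)] assms(2))
  also have "\<dots> = (\<Sum>c<prod_list ns. if c = p then M $$ (p, b) else 0)"
  proof (intro sum.cong refl)
    fix c assume "c \<in> {..<prod_list ns}"
    then show "sel_mat ns I $$ (c, a) * M $$ (c, b) = (if c = p then M $$ (p, b) else 0)"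
      using ab p midx_list(1)[OF assms(1)] by (simp add: sel_mat_def mat_of_cols_index p_def)
  qed
  also have "\<dots> = row_sub ns I M $$ (a, b)" using p ab by (simp add: row_sub_def p_def)
  finally show "((sel_mat ns I)\<^sup>T * M) $$ (a, b) = row_sub ns I M $$ (a, b)" .
qed (simp_all add: sel_mat_dim[OF assms(1)] row_sub_def)

lemma row_sub_dim [simp]: "dim_row (row_sub ns I M) = card I" "dim_col (row_sub ns I M) = dim_col M"
  by (simp_all add: row_sub_def)

lemma sel_mat_trivial: "sel_mat [] {[]} = 1\<^sub>m 1"
  by (rule eq_matI) (simp_all add: sel_mat_def midx_list_def mat_of_cols_index)

text \<open>The oblique projector onto the range of \<open>W\<close> determined by the interpolation points \<open>X\<close>.\<close>

definition interp :: "real mat \<Rightarrow> real mat \<Rightarrow> real mat" where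
  "interp W X = W * minv (X\<^sup>T * W) * X\<^sup>T"

lemma interp_dim [simp]: "dim_row (interp W X) = dim_row W" "dim_col (interp W X) = dim_row X"
  by (simp_all add: interp_def)

section \<open>Oblique projectors and change of orthonormal basis\<close>

lemma minv_dim:
  assumes "dim_row A = n" "dim_col A = n" "invertible_mat A"
  shows "dim_row (minv A) = n" "dim_col (minv A) = n"
  using minv(1)[OF carrier_matI[OF assms(1,2)] assms(3)] by (rule carrier_matD)+

text \<open>\<open>interp W X\<close> begins with the factor \<open>W\<close>, on which the
  orthogonal projector \<open>W * W\<^sup>T\<close> acts as the identity.\<close>

lemma interp_fixed:
  assumes "W\<^sup>T * W = 1\<^sub>m r" "dim_col W = r" "dim_row X = dim_row W" "dim_col X = r"
    "invertible_mat (X\<^sup>T * W)" "dim_row M = dim_row X"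
  shows "W * (W\<^sup>T * (interp W X * M)) = interp W X * M"
  using assms minv_dim[of "X\<^sup>T * W" r]
  by (simp add: interp_def mult_assoc_dim left_inverse_cancel[OF assms(1)])

text \<open>Cancelling \<open>W\<^sup>T * W\<close> in the second hypothesis leaves
  \<open>Q\<^sup>T * Q = 1\<close>; for a square matrix this inverse is two-sided.\<close>

lemma orthonormal_change:
  fixes W Q :: "real mat"
  assumes "W\<^sup>T * W = 1\<^sub>m r" "(W * Q)\<^sup>T * (W * Q) = 1\<^sub>m r" "dim_col W = r" "dim_row Q = r" "dim_col Q = r"
  shows "Q * Q\<^sup>T = 1\<^sub>m r"
proof (rule mat_mult_left_right_inverse)
  show "Q\<^sup>T * Q = 1\<^sub>m r"
    using assms(2) by (simp add: assms transpose_mult_dim mult_assoc_dim left_inverse_cancel[OF assms(1)])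
qed (rule carrier_matI; simp add: assms)+

lemma orthonormal_change_proj:
  fixes W Q :: "real mat"
  assumes "W\<^sup>T * W = 1\<^sub>m r" "(W * Q)\<^sup>T * (W * Q) = 1\<^sub>m r" "dim_col W = r" "dim_row Q = r" "dim_col Q = r"
    "dim_row M = dim_row W"
  shows "W * Q * ((W * Q)\<^sup>T * M) = W * (W\<^sup>T * M)"
  using assms by (simp add: transpose_mult_dim mult_assoc_dim left_inverse_cancel[OF orthonormal_change[OF assms(1-5)]])

text \<open>The inverse of \<open>X\<^sup>T * W * Q\<close> is
  \<open>Q\<^sup>T * minv (X\<^sup>T * W)\<close>, and the two orthogonal factors meet and cancel.
  Bases given by TT-cores may therefore replace the arbitrary ones of
  \<open>range_basis\<close>.\<close>

lemma interp_change_basis: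
  fixes W Q :: "real mat"
  assumes "W\<^sup>T * W = 1\<^sub>m r" "(W * Q)\<^sup>T * (W * Q) = 1\<^sub>m r" "dim_col W = r" "dim_row Q = r" "dim_col Q = r"
    "dim_row X = dim_row W" "dim_col X = r" "invertible_mat (X\<^sup>T * W)"
  shows "invertible_mat (X\<^sup>T * (W * Q))" "interp (W * Q) X = interp W X"
proof -
  note QQ = orthonormal_change[OF assms(1-5)]
  define T where "T = X\<^sup>T * W"
  have dT: "dim_row T = r" "dim_col T = r" using assms by (simp_all add: T_def)
  note T = carrier_matI[OF dT] assms(8)[folded T_def]
  note mT = minv_dim[OF dT T(2)]
  have S: "X\<^sup>T * (W * Q) = T * Q" using assms by (simp add: T_def mult_assoc_dim)
  have car: "T * Q \<in> carrier_mat r r" "Q\<^sup>T * minv T \<in> carrier_mat r r"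
    by (rule carrier_matI; simp add: dT mT assms)+
  have inv: "T * Q * (Q\<^sup>T * minv T) = 1\<^sub>m r"
    using minv(3)[OF T] by (simp add: mult_assoc_dim dT mT assms left_inverse_cancel[OF QQ])
  show "invertible_mat (X\<^sup>T * (W * Q))" unfolding S by (rule invertible_matI[OF car inv])
  show "interp (W * Q) X = interp W X"
    unfolding interp_def S minv_unique[OF car inv]
    unfolding T_def[symmetric] using assms(3-7)
    by (simp add: mult_assoc_dim mT left_inverse_cancel[OF QQ])
qed

text \<open>The matrix by which \<open>P_le\<close> multiplies the \<open>k\<close>-th unfolding.
  For \<open>k = 0\<close> that unfolding has a single row, and the convention that the operator is
  the identity becomes the 1 x 1 identity matrix, so that the first substep fits the same
  formula.\<close>

definition left_op :: "nat list \<Rightarrow> selection \<Rightarrow> nat \<Rightarrow> tensor \<Rightarrow> real mat" where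
  "left_op ns J k A = (if k = 0 then 1\<^sub>m 1
     else interp (range_basis (unfold ns k A)) (sel_mat (take k ns) (fst J k)))"

text \<open>Transposed because \<open>interp\<close> projects column vectors, while
  \<open>P_gt\<close> acts on the rows of the unfolding.\<close>

definition right_op :: "nat list \<Rightarrow> selection \<Rightarrow> nat \<Rightarrow> tensor \<Rightarrow> real mat" where
  "right_op ns J k A = (if k = length ns then 1\<^sub>m 1
     else (interp (corange_basis (unfold ns k A)) (sel_mat (drop k ns) (snd J k)))\<^sup>T)"

definition left_wd :: "nat list \<Rightarrow> selection \<Rightarrow> nat \<Rightarrow> tensor \<Rightarrow> bool" where
  "left_wd ns J k A \<longleftrightarrow>
     (0 < k \<longrightarrow> invertible_mat (row_sub (take k ns) (fst J k) (range_basis (unfold ns k A))))"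

definition right_wd :: "nat list \<Rightarrow> selection \<Rightarrow> nat \<Rightarrow> tensor \<Rightarrow> bool" where
  "right_wd ns J k A \<longleftrightarrow>
     (k < length ns \<longrightarrow> invertible_mat (row_sub (drop k ns) (snd J k) (corange_basis (unfold ns k A))))"

lemma proj_wdD:
  assumes "proj_wd ns r J A"
  shows "valid_selection ns r J" "A \<in> tensors ns" "r ! 0 = 1" "0 < length ns \<Longrightarrow> r ! length ns = 1"
    "k < length ns \<Longrightarrow> left_wd ns J k A" "0 < k \<Longrightarrow> right_wd ns J k A"
proof -
  have r: "r = tt_rank ns A" using assms by (auto simp: proj_wd_def tt_manifold_def)
  show "r ! 0 = 1" by (simp add: r tt_rank_def)
  show "0 < length ns \<Longrightarrow> r ! length ns = 1"
    by (simp add: r tt_rank_def nth_Cons' nth_append)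
  show "valid_selection ns r J" "A \<in> tensors ns" "k < length ns \<Longrightarrow> left_wd ns J k A"
    "0 < k \<Longrightarrow> right_wd ns J k A"
    using assms by (auto simp: proj_wd_def tt_manifold_def left_wd_def right_wd_def)
qed

lemma corange_basis_dim [simp]:
  "dim_row (corange_basis M) = dim_col M" "dim_col (corange_basis M) = mat_rank M\<^sup>T"
  by (simp_all add: corange_basis_def)

context
  fixes ns r :: "nat list" and J :: selection and k :: nat
  assumes sel: "valid_selection ns r J"
begin

lemma left_sel:
  assumes "k < length ns" "r ! 0 = 1"
  shows "fst J k \<subseteq> midx (take k ns)" "card (fst J k) = r ! k"
  using sel assms by (cases "k = 0"; auto simp: valid_selection_def)+

lemma right_sel:
  assumes "0 < k" "k \<le> length ns" "r ! length ns = 1"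
  shows "snd J k \<subseteq> midx (drop k ns)" "card (snd J k) = r ! k"
  using sel assms by (cases "k = length ns"; auto simp: valid_selection_def)+

text \<open>An invertible matrix is square: the selected submatrix has \<open>r ! k\<close> rows and
  as many columns as the rank of the unfolding.\<close>

lemma left_rank:
  assumes "0 < k" "k < length ns" "left_wd ns J k A"
  shows "mat_rank (unfold ns k A) = r ! k"
proof -
  have "card (fst J k) = r ! k" using sel assms by (auto simp: valid_selection_def)
  then show ?thesis using assms by (auto simp: left_wd_def invertible_mat_def square_mat.simps)
qed

text \<open>The rank of the transpose is obtained in the same way, from the shape of the submatrix
  of the co-range basis.\<close>

lemma right_rank:
  assumes "0 < k" "k < length ns" "right_wd ns J k A"
  shows "mat_rank (unfold ns k A)\<^sup>T = r ! k"
proof -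
  have "card (snd J k) = r ! k" using sel assms by (auto simp: valid_selection_def)
  then show ?thesis using assms by (auto simp: right_wd_def invertible_mat_def square_mat.simps)
qed

text \<open>By \<open>interp_change_basis\<close> any orthonormal \<open>U\<close> with the same
  range may be used. For \<open>k = 0\<close> the hypotheses make \<open>U\<close> a 1 x 1
  orthogonal matrix, and the formula reduces to the identity.\<close>

lemma left_op_basis:
  assumes "k < length ns" "r ! 0 = 1" "left_wd ns J k A"
    "dim_row U = prod_list (take k ns)" "dim_col U = r ! k" "U\<^sup>T * U = 1\<^sub>m (r ! k)"
    "0 < k \<Longrightarrow> \<exists>Q. dim_row Q = r ! k \<and> dim_col Q = r ! k \<and> U = range_basis (unfold ns k A) * Q"
  shows "invertible_mat (row_sub (take k ns) (fst J k) U)"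
    "left_op ns J k A = interp U (sel_mat (take k ns) (fst J k))"
proof -
  define X where "X = sel_mat (take k ns) (fst J k)"
  note I = left_sel[OF assms(1,2)]
  have dX: "dim_row X = prod_list (take k ns)" "dim_col X = r ! k"
    using sel_mat_dim[OF I(1)] I(2) by (simp_all add: X_def)
  have XU: "X\<^sup>T * M = row_sub (take k ns) (fst J k) M" if "dim_row M = prod_list (take k ns)" for M
    unfolding X_def by (rule sel_mat_transpose_mult[OF I(1) that])
  have "invertible_mat (X\<^sup>T * U) \<and> left_op ns J k A = interp U X"
  proof (cases "k = 0")
    case True
    have X: "X = 1\<^sub>m 1" using sel True by (simp add: X_def valid_selection_def sel_mat_trivial)
    have dU: "dim_row U = 1" "dim_col U = 1" using assms True by simp_all
    have car: "U \<in> carrier_mat 1 1" "U\<^sup>T \<in> carrier_mat 1 1" by (rule carrier_matI; simp add: dU)+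
    have UU: "U\<^sup>T * U = 1\<^sub>m 1" using assms True by simp
    note inv = invertible_matI[OF car mat_mult_left_right_inverse[OF car(2,1) UU]]
    have "U * minv U = 1\<^sub>m 1" by (rule minv(3)[OF car(1) inv])
    then show ?thesis using inv True by (simp add: X interp_def left_op_def dU)
  next
    case False
    define W where "W = range_basis (unfold ns k A)"
    obtain Q where Q: "dim_row Q = r ! k" "dim_col Q = r ! k" "U = W * Q"
      using assms(7) False by (auto simp: W_def)
    have rank: "mat_rank (unfold ns k A) = r ! k" using left_rank False assms(1,3) by simp
    have W: "W\<^sup>T * W = 1\<^sub>m (r ! k)" "dim_col W = r ! k" "dim_row W = prod_list (take k ns)"
      using range_basis_orthonormal[of "unfold ns k A"] by (simp_all add: W_def rank)
    have inv: "invertible_mat (X\<^sup>T * W)"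
      using assms(3) False unfolding XU[OF W(3)] by (simp add: left_wd_def W_def)
    have UU: "(W * Q)\<^sup>T * (W * Q) = 1\<^sub>m (r ! k)" using assms(6) unfolding Q(3) .
    have dXW: "dim_row X = dim_row W" by (simp add: dX W)
    from interp_change_basis[OF W(1) UU W(2) Q(1,2) dXW dX(2) inv] False
    show ?thesis by (simp add: Q(3) left_op_def W_def X_def)
  qed
  then show "invertible_mat (row_sub (take k ns) (fst J k) U)"
    "left_op ns J k A = interp U (sel_mat (take k ns) (fst J k))"
    using XU[OF assms(4)] by (simp_all add: X_def)
qed

lemma right_op_basis:
  assumes "0 < k" "k \<le> length ns" "r ! length ns = 1" "right_wd ns J k A"
    "dim_row V = prod_list (drop k ns)" "dim_col V = r ! k" "V\<^sup>T * V = 1\<^sub>m (r ! k)"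
    "k < length ns \<Longrightarrow> \<exists>Q. dim_row Q = r ! k \<and> dim_col Q = r ! k \<and> V = corange_basis (unfold ns k A) * Q"
  shows "invertible_mat (row_sub (drop k ns) (snd J k) V)"
    "right_op ns J k A = (interp V (sel_mat (drop k ns) (snd J k)))\<^sup>T"
proof -
  define X where "X = sel_mat (drop k ns) (snd J k)"
  note I = right_sel[OF assms(1-3)]
  have dX: "dim_row X = prod_list (drop k ns)" "dim_col X = r ! k"
    using sel_mat_dim[OF I(1)] I(2) by (simp_all add: X_def)
  have XV: "X\<^sup>T * M = row_sub (drop k ns) (snd J k) M" if "dim_row M = prod_list (drop k ns)" for M
    unfolding X_def by (rule sel_mat_transpose_mult[OF I(1) that])
  have "invertible_mat (X\<^sup>T * V) \<and> right_op ns J k A = (interp V X)\<^sup>T"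
  proof (cases "k = length ns")
    case True
    have X: "X = 1\<^sub>m 1" using sel True by (simp add: X_def valid_selection_def sel_mat_trivial)
    have dV: "dim_row V = 1" "dim_col V = 1" using assms True by simp_all
    have car: "V \<in> carrier_mat 1 1" "V\<^sup>T \<in> carrier_mat 1 1" by (rule carrier_matI; simp add: dV)+
    have VV: "V\<^sup>T * V = 1\<^sub>m 1" using assms True by simp
    note inv = invertible_matI[OF car mat_mult_left_right_inverse[OF car(2,1) VV]]
    have "V * minv V = 1\<^sub>m 1" by (rule minv(3)[OF car(1) inv])
    then show ?thesis using inv True by (simp add: X interp_def right_op_def dV)
  next
    case False
    then have k: "k < length ns" using assms(2) by simp
    define W where "W = corange_basis (unfold ns k A)"
    obtain Q where Q: "dim_row Q = r ! k" "dim_col Q = r ! k" "V = W * Q"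
      using assms(8)[OF k] by (auto simp: W_def)
    have rank: "mat_rank (unfold ns k A)\<^sup>T = r ! k" by (rule right_rank[OF assms(1) k assms(4)])
    have W: "W\<^sup>T * W = 1\<^sub>m (r ! k)" "dim_col W = r ! k" "dim_row W = prod_list (drop k ns)"
      using range_basis_orthonormal[of "(unfold ns k A)\<^sup>T"] by (simp_all add: W_def rank corange_basis_def)
    have inv: "invertible_mat (X\<^sup>T * W)"
      using assms(4) k unfolding XV[OF W(3)] by (simp add: right_wd_def W_def)
    have VV: "(W * Q)\<^sup>T * (W * Q) = 1\<^sub>m (r ! k)" using assms(7) unfolding Q(3) .
    have dXW: "dim_row X = dim_row W" by (simp add: dX W)
    from interp_change_basis[OF W(1) VV W(2) Q(1,2) dXW dX(2) inv] False
    show ?thesis by (simp add: Q(3) right_op_def W_def X_def)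
  qed
  then show "invertible_mat (row_sub (drop k ns) (snd J k) V)"
    "right_op ns J k A = (interp V (sel_mat (drop k ns) (snd J k)))\<^sup>T"
    using XV[OF assms(5)] by (simp_all add: X_def)
qed

lemma left_op_dim:
  assumes "k < length ns" "r ! 0 = 1"
  shows "dim_row (left_op ns J k A) = prod_list (take k ns)" "dim_col (left_op ns J k A) = prod_list (take k ns)"
  using sel_mat_dim[OF left_sel(1)[OF assms]] by (auto simp: left_op_def)

lemma right_op_dim:
  assumes "0 < k" "k \<le> length ns" "r ! length ns = 1"
  shows "dim_row (right_op ns J k A) = prod_list (drop k ns)" "dim_col (right_op ns J k A) = prod_list (drop k ns)"
  using sel_mat_dim[OF right_sel(1)[OF assms]] by (auto simp: right_op_def)

lemma unfold_P_le:
  assumes "k < length ns" "r ! 0 = 1"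
  shows "unfold ns k (P_le ns J k A Z) = left_op ns J k A * unfold ns k Z"
proof (cases "k = 0")
  case False
  then have "P_le ns J k A Z = Ten ns k (left_op ns J k A * unfold ns k Z)"
    by (simp add: P_le_def left_op_def interp_def Let_def)
  moreover have "left_op ns J k A * unfold ns k Z \<in> carrier_mat (prod_list (take k ns)) (prod_list (drop k ns))"
    by (rule carrier_matI) (simp_all add: left_op_dim[OF assms])
  ultimately show ?thesis using assms(1) by (simp add: unfold_Ten)
qed (simp add: P_le_def left_op_def)

text \<open>Images under the operator lie in the range of the base point's unfolding, stated in the
  form of the range hypothesis of the constancy lemmas.\<close>

lemma left_op_fixed:
  assumes "0 < k" "k < length ns" "r ! 0 = 1" "left_wd ns J k A" "dim_row M = prod_list (take k ns)"
  shows "range_basis (unfold ns k A) * ((range_basis (unfold ns k A))\<^sup>T * (left_op ns J k A * M)) =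
    left_op ns J k A * M"
proof -
  note I = left_sel[OF assms(2,3)]
  note rank = left_rank[OF assms(1,2,4)]
  have inv: "invertible_mat ((sel_mat (take k ns) (fst J k))\<^sup>T * range_basis (unfold ns k A))"
    using assms(1,4) by (simp add: sel_mat_transpose_mult[OF I(1)] left_wd_def)
  have "left_op ns J k A = interp (range_basis (unfold ns k A)) (sel_mat (take k ns) (fst J k))"
    using assms(1) by (simp add: left_op_def)
  then show ?thesis
    using interp_fixed[OF range_basis_orthonormal _ _ _ inv, of M]
    by (simp add: rank sel_mat_dim[OF I(1)] I(2) assms(5))
qed

text \<open>Transposition turns the statement on rows into one on columns, so that the same
  constancy lemmas apply to the transposed unfolding.\<close>

lemma right_op_fixed:
  assumes "0 < k" "k < length ns" "r ! length ns = 1" "right_wd ns J k A" "dim_row M = prod_list (drop k ns)"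
  shows "corange_basis (unfold ns k A) * ((corange_basis (unfold ns k A))\<^sup>T * ((right_op ns J k A)\<^sup>T * M)) =
    (right_op ns J k A)\<^sup>T * M"
proof -
  note I = right_sel[OF assms(1) less_imp_le[OF assms(2)] assms(3)]
  note rank = right_rank[OF assms(1,2,4)]
  define V where "V = corange_basis (unfold ns k A)"
  have V: "V\<^sup>T * V = 1\<^sub>m (r ! k)" "dim_col V = r ! k" "dim_row V = prod_list (drop k ns)"
    using range_basis_orthonormal[of "(unfold ns k A)\<^sup>T"] by (simp_all add: V_def corange_basis_def rank)
  have inv: "invertible_mat ((sel_mat (drop k ns) (snd J k))\<^sup>T * V)"
    using assms(2,4) V(3) by (simp add: sel_mat_transpose_mult[OF I(1)] right_wd_def V_def)
  have op: "(right_op ns J k A)\<^sup>T = interp V (sel_mat (drop k ns) (snd J k))"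
    using assms(2) by (simp add: right_op_def V_def)
  show ?thesis unfolding op V_def[symmetric]
    by (rule interp_fixed[OF V(1,2) _ _ inv]) (simp_all add: V(3) sel_mat_dim[OF I(1)] I(2) assms(5))
qed

lemma unfold_P_gt:
  assumes "0 < k" "k \<le> length ns" "r ! length ns = 1" "right_wd ns J k A"
  shows "unfold ns k (P_gt ns J k A Z) = unfold ns k Z * right_op ns J k A"
proof (cases "k = length ns")
  case False
  then have k: "k < length ns" using assms(2) by simp
  note I = right_sel[OF assms(1-3)]
  define V where "V = corange_basis (unfold ns k A)"
  define X where "X = sel_mat (drop k ns) (snd J k)"
  have V: "dim_col V = r ! k" "dim_row V = prod_list (drop k ns)"
    by (simp_all add: V_def right_rank[OF assms(1) k assms(4)])
  have X: "dim_row X = prod_list (drop k ns)" "dim_col X = r ! k"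
    using sel_mat_dim[OF I(1)] I(2) by (simp_all add: X_def)
  have "invertible_mat (X\<^sup>T * V)"
    using assms(4) k V(2) by (simp add: X_def sel_mat_transpose_mult[OF I(1)] right_wd_def V_def)
  \<comment> \<open>The dimensions of \<open>minv\<close> are known only for an invertible matrix;
    they are required for transposing the product.\<close>
  then have m: "dim_row (minv (X\<^sup>T * V)) = r ! k" "dim_col (minv (X\<^sup>T * V)) = r ! k"
    by (intro minv_dim; simp add: X V)+
  have op: "right_op ns J k A = X * ((minv (X\<^sup>T * V))\<^sup>T * V\<^sup>T)"
    using False by (simp add: right_op_def interp_def V_def[symmetric] X_def[symmetric]
        transpose_mult_dim mult_assoc_dim m X V)
  have "P_gt ns J k A Z = Ten ns k (unfold ns k Z * X * (minv (X\<^sup>T * V))\<^sup>T * V\<^sup>T)"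
    using False by (simp add: P_gt_def Let_def V_def X_def)
  also have "unfold ns k Z * X * (minv (X\<^sup>T * V))\<^sup>T * V\<^sup>T = unfold ns k Z * right_op ns J k A"
    unfolding op by (simp add: mult_assoc_dim m X V)
  finally have P: "P_gt ns J k A Z = Ten ns k (unfold ns k Z * right_op ns J k A)" .
  have "unfold ns k Z * right_op ns J k A \<in> carrier_mat (prod_list (take k ns)) (prod_list (drop k ns))"
    by (rule carrier_matI) (simp_all add: right_op_dim[OF assms(1-3)])
  then show ?thesis unfolding P using assms(2) by (simp add: unfold_Ten)
qed (simp add: P_gt_def right_op_def)

end

lemma P_le_cong:
  assumes "0 < k \<Longrightarrow> range_basis (unfold ns k A) = range_basis (unfold ns k B)"
  shows "P_le ns J k A Z = P_le ns J k B Z"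
  using assms by (simp add: P_le_def)

lemma P_gt_cong:
  assumes "k < length ns \<Longrightarrow> corange_basis (unfold ns k A) = corange_basis (unfold ns k B)"
    "k \<le> length ns"
  shows "P_gt ns J k A Z = P_gt ns J k B Z"
  using assms by (auto simp: P_gt_def)

section \<open>The operators on slices\<close>

context
  fixes ns :: "nat list" and j :: nat
  assumes j: "1 \<le> j" "j \<le> length ns"
begin

text \<open>Left multiplication acts on each column separately, and a slice is a selection of
  columns of unfolding \<open>j - 1\<close>.\<close>

lemma slice_mult_left:
  assumes "i < ns ! (j - 1)" "unfold ns (j - 1) Z' = L * unfold ns (j - 1) Z"
    "dim_col L = prod_list (take (j - 1) ns)"
  shows "slice ns j i Z' = L * slice ns j i Z"
proof (rule eq_matI)
  have dL: "dim_row L = prod_list (take (j - 1) ns)"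
    using arg_cong[OF assms(2), of dim_row] by simp
  fix a b assume "a < dim_row (L * slice ns j i Z)" "b < dim_col (L * slice ns j i Z)"
  then have ab: "a < prod_list (take (j - 1) ns)" "b < prod_list (drop j ns)" by (simp_all add: dL)
  have c: "i + ns ! (j - 1) * b < prod_list (drop (j - 1) ns)"
    using add_mult_less[OF assms(1) ab(2)] by (simp add: drop_pred[OF j] del: One_nat_def)
  have "slice ns j i Z' $$ (a, b) = (L * unfold ns (j - 1) Z) $$ (a, i + ns ! (j - 1) * b)"
    by (simp add: slice_unfold_left[OF j assms(1) ab] assms(2) del: index_mult_mat(1) One_nat_def)
  also have "\<dots> = (\<Sum>c<prod_list (take (j - 1) ns). L $$ (a, c) * slice ns j i Z $$ (c, b))"
    using c ab by (subst mult_mat_index)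
      (simp_all add: dL assms(3) slice_unfold_left[OF j assms(1) _ ab(2)] del: One_nat_def)
  also have "\<dots> = (L * slice ns j i Z) $$ (a, b)"
    using ab by (subst mult_mat_index) (simp_all add: dL assms(3))
  finally show "slice ns j i Z' $$ (a, b) = (L * slice ns j i Z) $$ (a, b)" .
qed (use arg_cong[OF assms(2), of dim_row] in simp_all)

lemma slice_mult_right:
  assumes "i < ns ! (j - 1)" "unfold ns j Z' = unfold ns j Z * R"
    "dim_row R = prod_list (drop j ns)"
  shows "slice ns j i Z' = slice ns j i Z * R"
proof (rule eq_matI)
  have dR: "dim_col R = prod_list (drop j ns)"
    using arg_cong[OF assms(2), of dim_col] by simp
  define m where "m = prod_list (take (j - 1) ns)"
  fix a b assume "a < dim_row (slice ns j i Z * R)" "b < dim_col (slice ns j i Z * R)"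
  then have ab: "a < m" "b < prod_list (drop j ns)" by (simp_all add: dR m_def)
  have c: "a + m * i < prod_list (take j ns)"
    using add_mult_less[OF ab(1) assms(1)] by (simp add: take_pred[OF j] m_def del: One_nat_def)
  note sl = slice_unfold_right[OF j assms(1), folded m_def]
  have "slice ns j i Z' $$ (a, b) = (unfold ns j Z * R) $$ (a + m * i, b)"
    by (simp add: sl[OF ab] assms(2) del: index_mult_mat(1))
  also have "\<dots> = (\<Sum>c<prod_list (drop j ns). slice ns j i Z $$ (a, c) * R $$ (c, b))"
    using c ab by (subst mult_mat_index) (simp_all add: dR assms(3) sl[OF ab(1)])
  also have "\<dots> = (slice ns j i Z * R) $$ (a, b)"
    using ab by (subst mult_mat_index) (simp_all add: dR assms(3) m_def)
  finally show "slice ns j i Z' $$ (a, b) = (slice ns j i Z * R) $$ (a, b)" .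
qed (use arg_cong[OF assms(2), of dim_col] in simp_all)

text \<open>Every column of unfolding \<open>j - 1\<close> occurs in exactly one slice, so an
  identity that holds for all slices lifts back to the unfolding.\<close>

lemma unfold_left_eqI:
  assumes "\<And>i. i < ns ! (j - 1) \<Longrightarrow> slice ns j i Z' = P * slice ns j i Z"
    "dim_row P = prod_list (take (j - 1) ns)" "dim_col P = prod_list (take (j - 1) ns)"
  shows "unfold ns (j - 1) Z' = P * unfold ns (j - 1) Z"
proof (rule eq_matI)
  define n where "n = ns ! (j - 1)"
  fix a c assume "a < dim_row (P * unfold ns (j - 1) Z)" "c < dim_col (P * unfold ns (j - 1) Z)"
  then have a: "a < prod_list (take (j - 1) ns)" and c: "c < n * prod_list (drop j ns)"
    by (simp_all add: assms(2) n_def drop_pred[OF j] del: One_nat_def)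
  define i b where "i = c mod n" and "b = c div n"
  have "n > 0" using c by (cases n) auto
  then have i: "i < n" by (simp add: i_def)
  have b: "b < prod_list (drop j ns)" using c by (simp add: b_def less_mult_imp_div_less mult.commute)
  have cib: "c = i + n * b" by (simp add: i_def b_def)
  note sl = slice_unfold_left[OF j i[unfolded n_def], folded n_def]
  have "unfold ns (j - 1) Z' $$ (a, c) = (P * slice ns j i Z) $$ (a, b)"
    by (simp add: sl[OF a b, symmetric] assms(1)[OF i[unfolded n_def], symmetric] cib
        del: index_mult_mat(1) One_nat_def)
  also have "\<dots> = (\<Sum>e<prod_list (take (j - 1) ns). P $$ (a, e) * unfold ns (j - 1) Z $$ (e, c))"
    using a b by (subst mult_mat_index) (simp_all add: assms(2,3) sl[OF _ b] cib del: One_nat_def)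
  also have "\<dots> = (P * unfold ns (j - 1) Z) $$ (a, c)"
    using a c by (subst mult_mat_index)
      (simp_all add: assms(2,3) drop_pred[OF j] n_def del: One_nat_def)
  finally show "unfold ns (j - 1) Z' $$ (a, c) = (P * unfold ns (j - 1) Z) $$ (a, c)" .
qed (simp_all add: assms(2))

lemma unfold_right_eqI:
  assumes "\<And>i. i < ns ! (j - 1) \<Longrightarrow> slice ns j i Z' = slice ns j i Z * P"
    "dim_row P = prod_list (drop j ns)" "dim_col P = prod_list (drop j ns)"
  shows "unfold ns j Z' = unfold ns j Z * P"
proof (rule eq_matI)
  define m where "m = prod_list (take (j - 1) ns)"
  fix c b assume "c < dim_row (unfold ns j Z * P)" "b < dim_col (unfold ns j Z * P)"
  then have b: "b < prod_list (drop j ns)" and c: "c < m * ns ! (j - 1)"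
    by (simp_all add: assms(3) m_def take_pred[OF j] del: One_nat_def)
  define i a where "i = c div m" and "a = c mod m"
  have "m > 0" using c by (cases m) auto
  then have a: "a < m" by (simp add: a_def)
  have i: "i < ns ! (j - 1)" using c by (simp add: i_def less_mult_imp_div_less mult.commute)
  have cia: "c = a + m * i" by (simp add: i_def a_def)
  note sl = slice_unfold_right[OF j i, folded m_def]
  have "unfold ns j Z' $$ (c, b) = (slice ns j i Z * P) $$ (a, b)"
    by (simp add: sl[OF a b, symmetric] assms(1)[OF i, symmetric] cia del: index_mult_mat(1))
  also have "\<dots> = (\<Sum>e<prod_list (drop j ns). unfold ns j Z $$ (c, e) * P $$ (e, b))"
    using a b by (subst mult_mat_index) (simp_all add: assms(2,3) sl[OF a] cia m_def[symmetric] del: One_nat_def)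
  also have "\<dots> = (unfold ns j Z * P) $$ (c, b)"
    using b c by (subst mult_mat_index)
      (simp_all add: assms(2,3) take_pred[OF j] m_def del: One_nat_def)
  finally show "unfold ns j Z' $$ (c, b) = (unfold ns j Z * P) $$ (c, b)" .
qed (simp_all add: assms(3))

text \<open>The two factors of \<open>P_plus\<close> live on different unfoldings. On slices both
  become multiplications of one and the same matrix, from the left and from the right.\<close>

lemma slice_P_plus:
  assumes "valid_selection ns r J" "r ! 0 = 1" "r ! length ns = 1" "right_wd ns J j A" "i < ns ! (j - 1)"
  shows "slice ns j i (P_plus ns J j A Z) = left_op ns J (j - 1) A * (slice ns j i Z * right_op ns J j A)"
proof -
  have j': "0 < j" "j - 1 < length ns" using j by auto
  have "slice ns j i (P_plus ns J j A Z) = left_op ns J (j - 1) A * slice ns j i (P_gt ns J j A Z)"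
    unfolding P_plus_def
    by (rule slice_mult_left[OF assms(5) unfold_P_le[OF assms(1) j'(2) assms(2)]
          left_op_dim(2)[OF assms(1) j'(2) assms(2)]])
  also have "slice ns j i (P_gt ns J j A Z) = slice ns j i Z * right_op ns J j A"
    by (rule slice_mult_right[OF assms(5) unfold_P_gt[OF assms(1) j'(1) j(2) assms(3,4)]
          right_op_dim(1)[OF assms(1) j'(1) j(2) assms(3)]])
  finally show ?thesis .
qed

end

lemma unfold_P_minus:
  assumes "valid_selection ns r J" "r ! 0 = 1" "r ! length ns = 1" "right_wd ns J j A" "0 < j" "j < length ns"
  shows "unfold ns j (P_minus ns J j A Z) = left_op ns J j A * (unfold ns j Z * right_op ns J j A)"
  unfolding P_minus_def
  using unfold_P_le[OF assms(1) assms(6,2)] unfold_P_gt[OF assms(1) assms(5) less_imp_le[OF assms(6)] assms(3,4)]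
  by simp

section \<open>Invariance of the ranges along solutions\<close>

lemma mat_deriv_unfold:
  assumes "tensor_deriv ns Y E t I"
  shows "mat_deriv (prod_list (take k ns)) (prod_list (drop k ns)) (\<lambda>s. unfold ns k (Y s)) (unfold ns k E) t I"
  unfolding mat_deriv_def
proof (intro allI impI)
  fix a b assume ab: "a < prod_list (take k ns)" "b < prod_list (drop k ns)"
  have "uncolex (take k ns) a @ uncolex (drop k ns) b \<in> midx ns"
    using midx_append[OF uncolex_midx[OF ab(1)] uncolex_midx[OF ab(2)]] by simp
  then show "((\<lambda>s. unfold ns k (Y s) $$ (a, b)) has_real_derivative unfold ns k E $$ (a, b)) (at t within I)"
    using assms ab by (simp add: tensor_deriv_def unfold_def)
qed

lemma mat_deriv_slice:
  assumes "tensor_deriv ns Y E t I" "1 \<le> j" "j \<le> length ns" "i < ns ! (j - 1)"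
  shows "mat_deriv (prod_list (take (j - 1) ns)) (prod_list (drop j ns))
    (\<lambda>s. slice ns j i (Y s)) (slice ns j i E) t I"
  unfolding mat_deriv_def
proof (intro allI impI)
  fix a b assume ab: "a < prod_list (take (j - 1) ns)" "b < prod_list (drop j ns)"
  have "uncolex (take (j - 1) ns) a @ i # uncolex (drop j ns) b \<in> midx ns"
    using midx_join[OF assms(2,3) uncolex_midx[OF ab(1)] assms(4) uncolex_midx[OF ab(2)]] .
  then show "((\<lambda>s. slice ns j i (Y s) $$ (a, b)) has_real_derivative slice ns j i E $$ (a, b)) (at t within I)"
    using assms(1) ab by (simp add: tensor_deriv_def slice_def del: One_nat_def)
qed

lemma left_basis_invariant:
  assumes deriv: "\<And>s. s \<in> {a..b} \<Longrightarrow> tensor_deriv ns Y (E s) s {a..b}"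
    and rank: "\<And>s. s \<in> {a..b} \<Longrightarrow> mat_rank (unfold ns k (Y s)) = \<rho>"
    and fixed: "\<And>s. s \<in> {a..b} \<Longrightarrow> range_basis (unfold ns k (B s)) *
      ((range_basis (unfold ns k (B s)))\<^sup>T * unfold ns k (E s)) = unfold ns k (E s)"
    and B: "B = Y \<or> B = (\<lambda>_. Y a)" and t: "t \<in> {a..b}"
  shows "range_basis (unfold ns k (Y t)) = range_basis (unfold ns k (Y a))"
proof -
  have car: "unfold ns k Z \<in> carrier_mat (prod_list (take k ns)) (prod_list (drop k ns))" for Z
    by (rule carrier_matI) simp_all
  from B show ?thesis
  proof
    assume "B = Y"
    from range_basis_constant[OF car car rank mat_deriv_unfold[OF deriv] fixed[unfolded this] t]
    show ?thesis .
  next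
    assume "B = (\<lambda>_. Y a)"
    from range_basis_constant_frozen[OF car car rank mat_deriv_unfold[OF deriv] fixed[unfolded this] t]
    show ?thesis .
  qed
qed

lemma right_basis_invariant:
  assumes deriv: "\<And>s. s \<in> {a..b} \<Longrightarrow> tensor_deriv ns Y (E s) s {a..b}"
    and rank: "\<And>s. s \<in> {a..b} \<Longrightarrow> mat_rank (unfold ns k (Y s))\<^sup>T = \<rho>"
    and fixed: "\<And>s. s \<in> {a..b} \<Longrightarrow> corange_basis (unfold ns k (B s)) *
      ((corange_basis (unfold ns k (B s)))\<^sup>T * (unfold ns k (E s))\<^sup>T) = (unfold ns k (E s))\<^sup>T"
    and B: "B = Y \<or> B = (\<lambda>_. Y a)" and t: "t \<in> {a..b}"
  shows "corange_basis (unfold ns k (Y t)) = corange_basis (unfold ns k (Y a))"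
proof -
  have car: "unfold ns k Z \<in> carrier_mat (prod_list (take k ns)) (prod_list (drop k ns))" for Z
    by (rule carrier_matI) simp_all
  have car': "(unfold ns k Z)\<^sup>T \<in> carrier_mat (prod_list (drop k ns)) (prod_list (take k ns))" for Z
    by (rule carrier_matI) simp_all
  note deriv' = mat_deriv_transpose[OF mat_deriv_unfold[OF deriv] car car]
  from B show ?thesis
  proof
    assume "B = Y"
    from range_basis_constant[OF car' car' rank deriv' fixed[unfolded this corange_basis_def] t]
    show ?thesis by (simp add: corange_basis_def)
  next
    assume "B = (\<lambda>_. Y a)"
    from range_basis_constant_frozen[OF car' car' rank deriv' fixed[unfolded this corange_basis_def] t]
    show ?thesis by (simp add: corange_basis_def)
  qed
qed

lemma unfold_uminus: "unfold ns k (\<lambda>is. - Z is) = - unfold ns k Z"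
  by (rule eq_matI) (simp_all add: unfold_def)

text \<open>The left range can be read off directly, as \<open>P_le\<close> is applied last. For the
  co-range one has to look behind \<open>P_le\<close>, which acts on another unfolding; this is done
  slice by slice.\<close>

lemma bases_invariant_plus:
  assumes j: "1 \<le> j" "j \<le> length ns"
    and wd: "\<And>s. s \<in> {t0..t1} \<Longrightarrow> proj_wd ns r (J s) (Z s)"
    and wdB: "\<And>s. s \<in> {t0..t1} \<Longrightarrow> left_wd ns (J s) (j - 1) (B s) \<and> right_wd ns (J s) j (B s)"
    and B: "B = Z \<or> B = (\<lambda>_. Z t0)"
    and sol: "solves_plus ns G J {t0..t1} j B Z" and t: "t \<in> {t0..t1}"
  shows "0 < j - 1 \<Longrightarrow> range_basis (unfold ns (j - 1) (Z t)) = range_basis (unfold ns (j - 1) (Z t0))"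
    and "j < length ns \<Longrightarrow> corange_basis (unfold ns j (Z t)) = corange_basis (unfold ns j (Z t0))"
proof -
  define E where "E s = P_plus ns (J s) j (B s) (G (Z s) s)" for s
  have deriv: "tensor_deriv ns Z (E s) s {t0..t1}" if "s \<in> {t0..t1}" for s
    using sol that by (simp add: solves_plus_def E_def)
  note wdD = proj_wdD[OF wd]
  have "0 < length ns" using j by linarith
  then have r: "r ! 0 = 1" "r ! length ns = 1" using wdD(3,4)[OF t] by blast+
  have j': "0 < j" "j - 1 < length ns" using j by auto
  {
    assume j1: "0 < j - 1"
    have rk: "mat_rank (unfold ns (j - 1) (Z s)) = r ! (j - 1)" if "s \<in> {t0..t1}" for s
      by (rule left_rank[OF wdD(1)[OF that] j1 j'(2) wdD(5)[OF that j'(2)]])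
    have fx: "range_basis (unfold ns (j - 1) (B s)) *
      ((range_basis (unfold ns (j - 1) (B s)))\<^sup>T * unfold ns (j - 1) (E s)) = unfold ns (j - 1) (E s)"
      if "s \<in> {t0..t1}" for s
      unfolding E_def P_plus_def unfold_P_le[OF wdD(1)[OF that] j'(2) r(1)]
      by (rule left_op_fixed[OF wdD(1)[OF that] j1 j'(2) r(1)]) (use wdB[OF that] in simp_all)
    show "range_basis (unfold ns (j - 1) (Z t)) = range_basis (unfold ns (j - 1) (Z t0))"
      by (rule left_basis_invariant[OF deriv rk fx B t])
  }
  {
    assume j2: "j < length ns"
    have rk: "mat_rank (unfold ns j (Z s))\<^sup>T = r ! j" if "s \<in> {t0..t1}" for s
      by (rule right_rank[OF wdD(1)[OF that] j'(1) j2 wdD(6)[OF that j'(1)]])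
    have fx: "corange_basis (unfold ns j (B s)) *
      ((corange_basis (unfold ns j (B s)))\<^sup>T * (unfold ns j (E s))\<^sup>T) = (unfold ns j (E s))\<^sup>T"
      if s: "s \<in> {t0..t1}" for s
    proof -
      define V where "V = corange_basis (unfold ns j (B s))"
      define R where "R = right_op ns (J s) j (B s)"
      have wdR: "right_wd ns (J s) j (B s)" using wdB[OF s] by simp
      have dV: "dim_row V = prod_list (drop j ns)" by (simp add: V_def)
      have dR: "dim_row R = prod_list (drop j ns)" "dim_col R = prod_list (drop j ns)"
        unfolding R_def by (rule right_op_dim[OF wdD(1)[OF s] j'(1) j(2) r(2)])+
      \<comment> \<open>\<open>right_op_fixed\<close> for the identity matrix is an identity between
        the matrices themselves, which can be transposed.\<close>
      have "V * (V\<^sup>T * R\<^sup>T) = R\<^sup>T"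
        using right_op_fixed[OF wdD(1)[OF s] j'(1) j2 r(2) wdR, of "1\<^sub>m (prod_list (drop j ns))"]
        by (simp add: V_def R_def[symmetric] dR)
      from arg_cong[OF this, of transpose_mat]
      have RVV: "R * (V * V\<^sup>T) = R" by (simp add: transpose_mult_dim mult_assoc_dim dV dR)
      \<comment> \<open>On slices the right operator is the last factor, so it absorbs the projector
        \<open>V * V\<^sup>T\<close> whatever stands to its left.\<close>
      have "slice ns j i (E s) = slice ns j i (E s) * (V * V\<^sup>T)" if "i < ns ! (j - 1)" for i
        unfolding E_def slice_P_plus[OF j wdD(1)[OF s] r wdR that] R_def[symmetric]
        by (simp add: mult_assoc_dim dR dV RVV left_op_dim(2)[OF wdD(1)[OF s] j'(2) r(1)] del: One_nat_def)
      then have "unfold ns j (E s) = unfold ns j (E s) * (V * V\<^sup>T)"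
        by (rule unfold_right_eqI[OF j]) (simp_all add: dV)
      from arg_cong[OF this, of transpose_mat] show ?thesis
        by (simp add: transpose_mult_dim mult_assoc_dim dV V_def[symmetric])
    qed
    show "corange_basis (unfold ns j (Z t)) = corange_basis (unfold ns j (Z t0))"
      by (rule right_basis_invariant[OF deriv rk fx B t])
  }
qed

text \<open>Both projections act on the same unfolding, so range and co-range are read off from one
  product of three matrices.\<close>

lemma bases_invariant_minus:
  assumes j: "0 < j" "j < length ns"
    and wd: "\<And>s. s \<in> {t0..t1} \<Longrightarrow> proj_wd ns r (J s) (Z s)"
    and wdB: "\<And>s. s \<in> {t0..t1} \<Longrightarrow> left_wd ns (J s) j (B s) \<and> right_wd ns (J s) j (B s)"
    and B: "B = Z \<or> B = (\<lambda>_. Z t0)"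
    and sol: "solves_minus ns G J {t0..t1} j B Z" and t: "t \<in> {t0..t1}"
  shows "range_basis (unfold ns j (Z t)) = range_basis (unfold ns j (Z t0))"
    and "corange_basis (unfold ns j (Z t)) = corange_basis (unfold ns j (Z t0))"
proof -
  define E where "E s = (\<lambda>is. - P_minus ns (J s) j (B s) (G (Z s) s) is)" for s
  have deriv: "tensor_deriv ns Z (E s) s {t0..t1}" if "s \<in> {t0..t1}" for s
    using sol that by (simp add: solves_minus_def E_def)
  note wdD = proj_wdD[OF wd]
  have "0 < length ns" using j by linarith
  then have r: "r ! 0 = 1" "r ! length ns = 1" using wdD(3,4)[OF t] by blast+
  \<comment> \<open>The sign is moved into the middle factor, so that the derivative is again an
    image under the left operator.\<close>
  have unfE: "unfold ns j (E s) =
      left_op ns (J s) j (B s) * (- unfold ns j (G (Z s) s) * right_op ns (J s) j (B s))"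
    if s: "s \<in> {t0..t1}" for s
    unfolding E_def unfold_uminus
    using unfold_P_minus[OF wdD(1)[OF s] r _ j, of "B s"] wdB[OF s]
    by (simp add: left_op_dim[OF wdD(1)[OF s] j(2) r(1)] right_op_dim[OF wdD(1)[OF s] j(1) less_imp_le[OF j(2)] r(2)])
  have rk: "mat_rank (unfold ns j (Z s)) = r ! j" if "s \<in> {t0..t1}" for s
    by (rule left_rank[OF wdD(1)[OF that] j wdD(5)[OF that j(2)]])
  have fx: "range_basis (unfold ns j (B s)) *
    ((range_basis (unfold ns j (B s)))\<^sup>T * unfold ns j (E s)) = unfold ns j (E s)"
    if s: "s \<in> {t0..t1}" for s
    unfolding unfE[OF s]
    by (rule left_op_fixed[OF wdD(1)[OF s] j r(1)]) (use wdB[OF s] in simp_all)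
  show "range_basis (unfold ns j (Z t)) = range_basis (unfold ns j (Z t0))"
    by (rule left_basis_invariant[OF deriv rk fx B t])
  have rk: "mat_rank (unfold ns j (Z s))\<^sup>T = r ! j" if "s \<in> {t0..t1}" for s
    by (rule right_rank[OF wdD(1)[OF that] j wdD(6)[OF that j(1)]])
  have fx: "corange_basis (unfold ns j (B s)) *
    ((corange_basis (unfold ns j (B s)))\<^sup>T * (unfold ns j (E s))\<^sup>T) = (unfold ns j (E s))\<^sup>T"
    if s: "s \<in> {t0..t1}" for s
  proof -
    note dL = left_op_dim[OF wdD(1)[OF s] j(2) r(1)]
    note dR = right_op_dim[OF wdD(1)[OF s] j(1) less_imp_le[OF j(2)] r(2)]
    have "unfold ns j (E s) =
        (left_op ns (J s) j (B s) * - unfold ns j (G (Z s) s)) * right_op ns (J s) j (B s)"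
      unfolding unfE[OF s] by (rule mult_assoc_dim[symmetric]) (simp_all add: dL dR)
    then have T: "(unfold ns j (E s))\<^sup>T = (right_op ns (J s) j (B s))\<^sup>T *
        (left_op ns (J s) j (B s) * - unfold ns j (G (Z s) s))\<^sup>T"
      by (simp only:) (rule transpose_mult_dim, simp add: dR)
    show ?thesis unfolding T
      by (rule right_op_fixed[OF wdD(1)[OF s] j r(2)]) (use wdB[OF s] in simp_all)
  qed
  show "corange_basis (unfold ns j (Z t)) = corange_basis (unfold ns j (Z t0))"
    by (rule right_basis_invariant[OF deriv rk fx B t])
qed

section \<open>Freezing the base point\<close>

lemma P_plus_cong:
  assumes "0 < j - 1 \<Longrightarrow> range_basis (unfold ns (j - 1) A) = range_basis (unfold ns (j - 1) B)"
    "j < length ns \<Longrightarrow> corange_basis (unfold ns j A) = corange_basis (unfold ns j B)" "j \<le> length ns"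
  shows "P_plus ns J j A Z = P_plus ns J j B Z"
proof -
  have "P_gt ns J j A Z = P_gt ns J j B Z" using assms(2,3) by (intro P_gt_cong) blast+
  then show ?thesis unfolding P_plus_def using P_le_cong[OF assms(1)] by simp
qed

lemma P_minus_cong:
  assumes "range_basis (unfold ns j A) = range_basis (unfold ns j B)"
    "corange_basis (unfold ns j A) = corange_basis (unfold ns j B)" "j \<le> length ns"
  shows "P_minus ns J j A Z = P_minus ns J j B Z"
proof -
  have "P_gt ns J j A Z = P_gt ns J j B Z" using assms(2,3) by (intro P_gt_cong) blast+
  then show ?thesis unfolding P_minus_def using P_le_cong[OF assms(1)] by simp
qed

text \<open>A solution of either equation has constant ranges, by its own version of the invariance.
  The operators at \<open>Z t\<close> and \<open>Z t0\<close> then coincide, so the two right-hand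
  sides are the same.\<close>

lemma solves_plus_frozen_iff:
  assumes j: "1 \<le> j" "j \<le> length ns"
    and wd: "\<And>s. s \<in> {t0..t1} \<Longrightarrow> proj_wd ns r (J s) (Z s)"
    and wd0: "\<And>s. s \<in> {t0..t1} \<Longrightarrow> left_wd ns (J s) (j - 1) (Z t0) \<and> right_wd ns (J s) j (Z t0)"
  shows "solves_plus ns G J {t0..t1} j Z Z \<longleftrightarrow> solves_plus ns G J {t0..t1} j (\<lambda>_. Z t0) Z"
proof -
  have "P_plus ns (J t) j (Z t) W = P_plus ns (J t) j (Z t0) W"
    if sol: "solves_plus ns G J {t0..t1} j Z Z \<or> solves_plus ns G J {t0..t1} j (\<lambda>_. Z t0) Z"
      and t: "t \<in> {t0..t1}" for t W
  proof -
    have wdZ: "left_wd ns (J s) (j - 1) (Z s) \<and> right_wd ns (J s) j (Z s)" if "s \<in> {t0..t1}" for s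
      using proj_wdD(5,6)[OF wd[OF that]] j by simp
    from sol show ?thesis
    proof
      assume s: "solves_plus ns G J {t0..t1} j Z Z"
      note inv = bases_invariant_plus[OF j wd wdZ disjI1[OF refl] s t]
      show ?thesis by (rule P_plus_cong[OF inv j(2)])
    next
      assume s: "solves_plus ns G J {t0..t1} j (\<lambda>_. Z t0) Z"
      note inv = bases_invariant_plus[OF j wd wd0 disjI2[OF refl] s t]
      show ?thesis by (rule P_plus_cong[OF inv j(2)])
    qed
  qed
  then show ?thesis by (auto simp: solves_plus_def)
qed

lemma solves_minus_frozen_iff:
  assumes j: "0 < j" "j < length ns"
    and wd: "\<And>s. s \<in> {t0..t1} \<Longrightarrow> proj_wd ns r (J s) (Z s)"
    and wd0: "\<And>s. s \<in> {t0..t1} \<Longrightarrow> left_wd ns (J s) j (Z t0) \<and> right_wd ns (J s) j (Z t0)"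
  shows "solves_minus ns G J {t0..t1} j Z Z \<longleftrightarrow> solves_minus ns G J {t0..t1} j (\<lambda>_. Z t0) Z"
proof -
  have "P_minus ns (J t) j (Z t) W = P_minus ns (J t) j (Z t0) W"
    if sol: "solves_minus ns G J {t0..t1} j Z Z \<or> solves_minus ns G J {t0..t1} j (\<lambda>_. Z t0) Z"
      and t: "t \<in> {t0..t1}" for t W
  proof -
    have wdZ: "left_wd ns (J s) j (Z s) \<and> right_wd ns (J s) j (Z s)" if "s \<in> {t0..t1}" for s
      using proj_wdD(5,6)[OF wd[OF that]] j by simp
    from sol show ?thesis
    proof
      assume s: "solves_minus ns G J {t0..t1} j Z Z"
      note inv = bases_invariant_minus[OF j wd wdZ disjI1[OF refl] s t]
      show ?thesis by (rule P_minus_cong[OF inv less_imp_le[OF j(2)]])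
    next
      assume s: "solves_minus ns G J {t0..t1} j (\<lambda>_. Z t0) Z"
      note inv = bases_invariant_minus[OF j wd wd0 disjI2[OF refl] s t]
      show ?thesis by (rule P_minus_cong[OF inv less_imp_le[OF j(2)]])
    qed
  qed
  then show ?thesis by (auto simp: solves_minus_def)
qed

lemma left_wd_cong:
  assumes "0 < k \<Longrightarrow> range_basis (unfold ns k A) = range_basis (unfold ns k B)"
  shows "left_wd ns J k A \<longleftrightarrow> left_wd ns J k B"
  using assms by (auto simp: left_wd_def)

lemma right_wd_cong:
  assumes "k < length ns \<Longrightarrow> corange_basis (unfold ns k A) = corange_basis (unfold ns k B)"
  shows "right_wd ns J k A \<longleftrightarrow> right_wd ns J k B"
  using assms by (auto simp: right_wd_def)

section \<open>The equations for the cores\<close>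

text \<open>The range of \<open>M\<close> is contained in that of \<open>U\<close>, and both have
  dimension \<open>r\<close>. Writing the chosen basis as \<open>U * T\<close>, the matrix
  \<open>T\<close> is orthogonal, and \<open>Q\<close> is its transpose.\<close>

lemma range_basis_of_factor:
  assumes "M = U * X" "U\<^sup>T * U = 1\<^sub>m r" "dim_col U = r" "dim_row X = r" "mat_rank M = r"
  shows "\<exists>Q. dim_row Q = r \<and> dim_col Q = r \<and> U = range_basis M * Q"
proof -
  obtain C where C: "C \<in> carrier_mat (dim_col M) (mat_rank M)" "range_basis M = M * C"
    by (rule range_basis_factor)
  have dC: "dim_row C = dim_col X" "dim_col C = r" using C(1) assms(1,5) by auto
  define T where "T = X * C"
  have "M * C = U * T" unfolding T_def assms(1)
    by (rule mult_assoc_dim) (simp_all add: assms(3,4) dC)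
  with C(2) have W: "range_basis M = U * T" by simp
  have dT: "dim_row T = r" "dim_col T = r" by (simp_all add: T_def assms(4) dC)
  have TT: "T * T\<^sup>T = 1\<^sub>m r"
    using orthonormal_change[OF assms(2) _ assms(3) dT] range_basis_orthonormal[of M]
    unfolding W assms(5) by simp
  have "range_basis M * T\<^sup>T = U * (T * T\<^sup>T)"
    unfolding W by (rule mult_assoc_dim) (simp_all add: assms(3) dT)
  then have "U = range_basis M * T\<^sup>T" using assms(3) by (simp add: TT)
  then show ?thesis using dT by (intro exI[of _ "T\<^sup>T"]) simp
qed

lemma range_basis_change_fixed:
  assumes "U = range_basis M * Q" "U\<^sup>T * U = 1\<^sub>m r" "dim_row Q = r" "dim_col Q = r" "mat_rank M = r"
  shows "U * (U\<^sup>T * M) = M"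
  using orthonormal_change_proj[of "range_basis M" r Q M] range_basis_orthonormal[of M]
    range_basis_proj[of M] assms by simp

text \<open>\<open>sel_mat_transpose_mult\<close> selects the rows; applied to the transposed slice
  it selects the columns.\<close>

lemma slice_sub_eq:
  assumes j: "1 \<le> j" "j \<le> length ns" and I: "I \<subseteq> midx (take (j - 1) ns)" "I' \<subseteq> midx (drop j ns)"
  shows "(sel_mat (take (j - 1) ns) I)\<^sup>T * (slice ns j i Z * sel_mat (drop j ns) I') = slice_sub ns j I I' Z i"
proof -
  define X X' where "X = sel_mat (take (j - 1) ns) I" and "X' = sel_mat (drop j ns) I'"
  have dX': "dim_row X' = prod_list (drop j ns)" "dim_col X' = card I'"
    using sel_mat_dim[OF I(2)] by (simp_all add: X'_def)
  have "X'\<^sup>T * (slice ns j i Z)\<^sup>T = row_sub (drop j ns) I' (slice ns j i Z)\<^sup>T"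
    unfolding X'_def by (rule sel_mat_transpose_mult[OF I(2)]) simp
  from arg_cong[OF this, of transpose_mat]
  have SX: "slice ns j i Z * X' = (row_sub (drop j ns) I' (slice ns j i Z)\<^sup>T)\<^sup>T"
    by (simp add: transpose_mult_dim dX')
  have "X\<^sup>T * (slice ns j i Z * X') = row_sub (take (j - 1) ns) I (slice ns j i Z * X')"
    unfolding X_def by (rule sel_mat_transpose_mult[OF I(1)]) simp
  also have "\<dots> = slice_sub ns j I I' Z i"
  proof (rule eq_matI)
    fix a b assume "a < dim_row (slice_sub ns j I I' Z i)" "b < dim_col (slice_sub ns j I I' Z i)"
    then have ab: "a < card I" "b < card I'" by (simp_all add: slice_sub_def)
    note m = midx_list(3)[OF I(1) ab(1)] midx_list(3)[OF I(2) ab(2)]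
    show "row_sub (take (j - 1) ns) I (slice ns j i Z * X') $$ (a, b) = slice_sub ns j I I' Z i $$ (a, b)"
      unfolding SX using ab colex_less[OF m(1)] colex_less[OF m(2)] slice_index[OF j m]
      by (simp add: row_sub_def slice_sub_def del: One_nat_def)
  qed (simp_all add: slice_sub_def dX')
  finally show ?thesis by (simp add: X_def X'_def)
qed

lemma mat_sub_eq:
  assumes I: "I \<subseteq> midx (take j ns)" "I' \<subseteq> midx (drop j ns)"
  shows "(sel_mat (take j ns) I)\<^sup>T * (unfold ns j Z * sel_mat (drop j ns) I') = mat_sub ns j I I' Z"
proof -
  define X X' where "X = sel_mat (take j ns) I" and "X' = sel_mat (drop j ns) I'"
  have dX': "dim_row X' = prod_list (drop j ns)" "dim_col X' = card I'"
    using sel_mat_dim[OF I(2)] by (simp_all add: X'_def)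
  have "X'\<^sup>T * (unfold ns j Z)\<^sup>T = row_sub (drop j ns) I' (unfold ns j Z)\<^sup>T"
    unfolding X'_def by (rule sel_mat_transpose_mult[OF I(2)]) simp
  from arg_cong[OF this, of transpose_mat]
  have SX: "unfold ns j Z * X' = (row_sub (drop j ns) I' (unfold ns j Z)\<^sup>T)\<^sup>T"
    by (simp add: transpose_mult_dim dX')
  have "X\<^sup>T * (unfold ns j Z * X') = row_sub (take j ns) I (unfold ns j Z * X')"
    unfolding X_def by (rule sel_mat_transpose_mult[OF I(1)]) simp
  also have "\<dots> = mat_sub ns j I I' Z"
  proof (rule eq_matI)
    fix a b assume "a < dim_row (mat_sub ns j I I' Z)" "b < dim_col (mat_sub ns j I I' Z)"
    then have ab: "a < card I" "b < card I'" by (simp_all add: mat_sub_def)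
    note m = midx_list(3)[OF I(1) ab(1)] midx_list(3)[OF I(2) ab(2)]
    show "row_sub (take j ns) I (unfold ns j Z * X') $$ (a, b) = mat_sub ns j I I' Z $$ (a, b)"
      unfolding SX using ab colex_less[OF m(1)] colex_less[OF m(2)] unfold_index[OF m]
      by (simp add: row_sub_def mat_sub_def)
  qed (simp_all add: mat_sub_def dX')
  finally show ?thesis by (simp add: X_def X'_def)
qed

text \<open>Compressing with orthonormal \<open>U\<close> and \<open>V\<close> turns the oblique projections into the
  equation for the small matrix.\<close>

lemma interp_compress:
  assumes "U\<^sup>T * U = 1\<^sub>m p" "V\<^sup>T * V = 1\<^sub>m q" "dim_col U = p" "dim_col V = q"
    "dim_row X = dim_row U" "dim_col X = p" "dim_row X' = dim_row V" "dim_col X' = q"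
    "invertible_mat (X\<^sup>T * U)" "invertible_mat (X'\<^sup>T * V)"
    "dim_row M = dim_row U" "dim_col M = dim_row V"
  shows "U\<^sup>T * (interp U X * (M * (interp V X')\<^sup>T)) * V =
    minv (X\<^sup>T * U) * (X\<^sup>T * (M * X')) * (minv (X'\<^sup>T * V))\<^sup>T"
proof -
  define N where "N = minv (X\<^sup>T * U)"
  define N' where "N' = minv (X'\<^sup>T * V)"
  have dN: "dim_row N = p" "dim_col N = p"
    unfolding N_def by (rule minv_dim; simp add: assms)+
  have dN': "dim_row N' = q" "dim_col N' = q"
    unfolding N'_def by (rule minv_dim; simp add: assms)+
  show ?thesis unfolding interp_def N_def[symmetric] N'_def[symmetric]
    by (simp add: mult_assoc_dim transpose_mult_dim dN dN' assms(1-8,11,12)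
        left_inverse_cancel[OF assms(1)])
qed

text \<open>The core is recovered by compressing each slice of \<open>Y t\<close> with the
  orthonormal \<open>UL\<close> and \<open>VR\<close>. This loses nothing if they span the ranges at
  all times: at \<open>t0\<close> by the given representation and equality of ranks, afterwards by
  invariance.\<close>

lemma plus_solution_core:
  assumes j: "1 \<le> j" "j \<le> length ns" and t01: "t0 \<le> t1"
    and wd: "\<And>s. s \<in> {t0..t1} \<Longrightarrow> proj_wd ns r (J s) (Y s)"
    and sol: "solves_plus ns G J {t0..t1} j Y Y"
    and U: "\<And>k. k \<in> {1..j} \<Longrightarrow> left_orthogonal ns r k (U k)"
    and V: "\<And>k. k \<in> {j+1..length ns} \<Longrightarrow> right_orthogonal ns r k (V k)"
    and S: "S \<in> carrier_mat (r ! j) (r ! j)"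
    and init: "Y t0 = tt_core_tensor ns U j (\<lambda>i. U j i * S) V"
  shows "\<exists>K :: real \<Rightarrow> core.
    (\<forall>i < ns ! (j - 1). K t0 i = U j i * S) \<and>
    (\<forall>t \<in> {t0..t1}. is_core ns r j (K t) \<and>
       Y t = tt_core_tensor ns U j (K t) V \<and>
       (\<forall>i < ns ! (j - 1). mat_deriv (r ! (j - 1)) (r ! j) (\<lambda>s. K s i)
          (minv (row_sub (take (j - 1) ns) (fst (J t) (j - 1)) (U_le ns r U (j - 1)))
           * slice_sub ns j (fst (J t) (j - 1)) (snd (J t) j) (G (Y t) t) i
           * (minv (row_sub (drop j ns) (snd (J t) j) (V_gt ns r V j)))\<^sup>T)
          t {t0..t1}))"
proof -
  define UL VR where "UL = U_le ns r U (j - 1)" and "VR = V_gt ns r V j"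
  define p q n where "p = r ! (j - 1)" and "q = r ! j" and "n = ns ! (j - 1)"
  have t0: "t0 \<in> {t0..t1}" using t01 by simp
  note wdD = proj_wdD[OF wd]
  have "0 < length ns" using j by linarith
  then have r: "r ! 0 = 1" "r ! length ns = 1" using wdD(3,4)[OF t0] by blast+
  have j': "0 < j" "j - 1 < length ns" "j - 1 \<le> length ns" using j by auto
  have coreU: "is_core ns r l (U l)" if "l \<in> {1..j-1}" for l
    using U[of l] that by (auto simp: left_orthogonal_def)
  have coreV: "is_core ns r l (V l)" if "l \<in> {j+1..length ns}" for l
    using V[OF that] by (simp add: right_orthogonal_def)
  have UL: "UL\<^sup>T * UL = 1\<^sub>m p"
    unfolding UL_def p_def by (rule U_le_orthonormal[OF j'(3) r(1)]) (rule U, auto)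
  have VR: "VR\<^sup>T * VR = 1\<^sub>m q"
    unfolding VR_def q_def by (rule V_gt_orthonormal[OF j(2) r(2) V])
  have dUL: "dim_row UL = prod_list (take (j - 1) ns)" "dim_col UL = p"
    and dVR: "dim_row VR = prod_list (drop j ns)" "dim_col VR = q"
    by (simp_all add: UL_def VR_def p_def q_def)
  have dS: "dim_row S = q" "dim_col S = q" using S by (simp_all add: q_def)
  have dU: "dim_row (U j i) = p" "dim_col (U j i) = q" if "i < n" for i
    using is_core_dim[of ns r "j - 1" "U j" i] U[of j] j that
    by (simp_all add: left_orthogonal_def n_def p_def q_def)
  have slice_core: "slice ns j i (tt_core_tensor ns U j K V) = UL * K i * VR\<^sup>T"
    if "i < n" "dim_row (K i) = p" "dim_col (K i) = q" for K i
    unfolding UL_def VR_def using that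
    by (intro slice_tt_core_tensor[OF j r coreU coreV]) (simp_all add: n_def p_def q_def)
  have slice0: "slice ns j i (Y t0) = UL * (U j i * S) * VR\<^sup>T" if "i < n" for i
    unfolding init by (rule slice_core[OF that]) (simp_all add: dU[OF that] dS)
  \<comment> \<open>Each initial slice has \<open>UL\<close> as its first factor, so the projector
    \<open>UL * UL\<^sup>T\<close> fixes it; the slices together give the unfolding.\<close>
  have left0: "unfold ns (j - 1) (Y t0) = UL * (UL\<^sup>T * unfold ns (j - 1) (Y t0))"
  proof -
    have "slice ns j i (Y t0) = UL * UL\<^sup>T * slice ns j i (Y t0)" if "i < n" for i
      unfolding slice0[OF that]
      by (simp add: mult_assoc_dim dUL dVR dU[OF that] dS left_inverse_cancel[OF UL])
    then have "unfold ns (j - 1) (Y t0) = UL * UL\<^sup>T * unfold ns (j - 1) (Y t0)"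
      unfolding n_def by (rule unfold_left_eqI[OF j]) (simp_all add: dUL)
    then show ?thesis by (simp add: mult_assoc_dim dUL)
  qed
  have right0: "(unfold ns j (Y t0))\<^sup>T = VR * (VR\<^sup>T * (unfold ns j (Y t0))\<^sup>T)"
  proof -
    have "slice ns j i (Y t0) = slice ns j i (Y t0) * (VR * VR\<^sup>T)" if "i < n" for i
      unfolding slice0[OF that]
      by (simp add: mult_assoc_dim dUL dVR dU[OF that] dS left_inverse_cancel[OF VR])
    then have "unfold ns j (Y t0) = unfold ns j (Y t0) * (VR * VR\<^sup>T)"
      unfolding n_def by (rule unfold_right_eqI[OF j]) (simp_all add: dVR)
    from arg_cong[OF this, of transpose_mat] show ?thesis
      by (simp add: transpose_mult_dim mult_assoc_dim dVR)
  qed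
  have wdY: "left_wd ns (J s) (j - 1) (Y s) \<and> right_wd ns (J s) j (Y s)" if "s \<in> {t0..t1}" for s
    using wdD(5)[OF that j'(2)] wdD(6)[OF that j'(1)] by simp
  have inv:
    "0 < j - 1 \<Longrightarrow> range_basis (unfold ns (j - 1) (Y t)) = range_basis (unfold ns (j - 1) (Y t0))"
    "j < length ns \<Longrightarrow> corange_basis (unfold ns j (Y t)) = corange_basis (unfold ns j (Y t0))"
    if "t \<in> {t0..t1}" for t
    by (rule bases_invariant_plus[OF j wd wdY disjI1[OF refl] sol]; (assumption | rule that))+
  \<comment> \<open>Invariance reduces the claim to \<open>t0\<close>, where the range of the
    unfolding lies in that of \<open>UL\<close> and both have dimension \<open>p\<close>.\<close>
  have left_basis: "\<exists>Q. dim_row Q = p \<and> dim_col Q = p \<and> UL = range_basis (unfold ns (j - 1) (Y t)) * Q"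
    if t: "t \<in> {t0..t1}" and "0 < j - 1" for t
    unfolding inv(1)[OF t that(2)]
    by (rule range_basis_of_factor[OF left0 UL dUL(2)])
      (simp_all add: dUL p_def left_rank[OF wdD(1)[OF t0] that(2) j'(2) wdD(5)[OF t0 j'(2)]] del: One_nat_def)
  have right_basis: "\<exists>Q. dim_row Q = q \<and> dim_col Q = q \<and> VR = corange_basis (unfold ns j (Y t)) * Q"
    if t: "t \<in> {t0..t1}" and "j < length ns" for t
    unfolding inv(2)[OF t that(2)] unfolding corange_basis_def
    by (rule range_basis_of_factor[OF right0 VR dVR(2)])
      (simp_all add: dVR q_def right_rank[OF wdD(1)[OF t0] j'(1) that(2) wdD(6)[OF t0 j'(1)]])
  have fixL: "UL * (UL\<^sup>T * unfold ns (j - 1) (Y t)) = unfold ns (j - 1) (Y t)" if t: "t \<in> {t0..t1}" for t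
  proof (cases "0 < j - 1")
    case True
    obtain Q where Q: "dim_row Q = p" "dim_col Q = p" "UL = range_basis (unfold ns (j - 1) (Y t)) * Q"
      using left_basis[OF t True] by blast
    show ?thesis
      by (rule range_basis_change_fixed[OF Q(3) UL Q(1,2)])
        (simp add: p_def left_rank[OF wdD(1)[OF t] True j'(2) wdD(5)[OF t j'(2)]] del: One_nat_def)
  next
    \<comment> \<open>This is \<open>j = 1\<close>: here \<open>UL\<close> is a 1 x 1 orthogonal
      matrix, so \<open>UL * UL\<^sup>T\<close> is the identity.\<close>
    case False
    then have d1: "dim_row UL = 1" "dim_col UL = 1" "p = 1" using dUL r by (simp_all add: p_def)
    have "UL * UL\<^sup>T = 1\<^sub>m 1"
      by (rule mat_mult_left_right_inverse[OF _ _ UL[unfolded d1(3)]]; rule carrier_matI; simp add: d1)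
    then show ?thesis using False dUL(1) d1
      by (intro left_inverse_cancel) simp_all
  qed
  have fixR: "VR * (VR\<^sup>T * (unfold ns j (Y t))\<^sup>T) = (unfold ns j (Y t))\<^sup>T" if t: "t \<in> {t0..t1}" for t
  proof (cases "j < length ns")
    case True
    obtain Q where Q: "dim_row Q = q" "dim_col Q = q" "VR = corange_basis (unfold ns j (Y t)) * Q"
      using right_basis[OF t True] by blast
    show ?thesis
      by (rule range_basis_change_fixed[OF Q(3)[unfolded corange_basis_def] VR Q(1,2)])
        (simp add: q_def right_rank[OF wdD(1)[OF t] j'(1) True wdD(6)[OF t j'(1)]])
  next
    case False
    then have d1: "dim_row VR = 1" "dim_col VR = 1" "q = 1" using dVR r j by (simp_all add: q_def)
    have "VR * VR\<^sup>T = 1\<^sub>m 1"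
      by (rule mat_mult_left_right_inverse[OF _ _ VR[unfolded d1(3)]]; rule carrier_matI; simp add: d1)
    then show ?thesis using False dVR(1) d1
      by (intro left_inverse_cancel) simp_all
  qed
  define K where "K t i = UL\<^sup>T * slice ns j i (Y t) * VR" for t i
  have dK: "dim_row (K t i) = p" "dim_col (K t i) = q" for t i
    by (simp_all add: K_def dUL dVR)
  have K0: "K t0 i = U j i * S" if "i < n" for i
    unfolding K_def slice0[OF that]
    by (simp add: mult_assoc_dim dUL dVR dU[OF that] dS left_inverse_cancel[OF UL] VR)
  have sliceK: "UL * K t i * VR\<^sup>T = slice ns j i (Y t)" if t: "t \<in> {t0..t1}" and i: "i < n" for t i
  proof -
    have uL: "unfold ns (j - 1) (Y t) = UL * UL\<^sup>T * unfold ns (j - 1) (Y t)"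
      using fixL[OF t] by (simp add: mult_assoc_dim dUL)
    have L: "slice ns j i (Y t) = UL * UL\<^sup>T * slice ns j i (Y t)"
      by (rule slice_mult_left[OF j i[unfolded n_def] uL]) (simp add: dUL)
    have uR: "unfold ns j (Y t) = unfold ns j (Y t) * (VR * VR\<^sup>T)"
      using arg_cong[OF fixR[OF t], of transpose_mat] by (simp add: transpose_mult_dim mult_assoc_dim dVR)
    have R: "slice ns j i (Y t) = slice ns j i (Y t) * (VR * VR\<^sup>T)"
      by (rule slice_mult_right[OF j i[unfolded n_def] uR]) (simp add: dVR)
    have "UL * K t i * VR\<^sup>T = UL * UL\<^sup>T * (slice ns j i (Y t) * (VR * VR\<^sup>T))"
      by (simp add: K_def mult_assoc_dim dUL dVR)
    then show ?thesis using L R by simp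
  qed
  have core: "is_core ns r j (K t)" for t
    unfolding is_core_def by (intro allI impI carrier_matI) (simp_all add: dK p_def q_def del: One_nat_def)
  have form: "Y t = tt_core_tensor ns U j (K t) V" if t: "t \<in> {t0..t1}" for t
  proof (rule tensor_eq_slicesI[OF j wdD(2)[OF t] tt_core_tensor_tensors])
    fix i assume "i < ns ! (j - 1)"
    then have i: "i < n" by (simp add: n_def)
    show "slice ns j i (Y t) = slice ns j i (tt_core_tensor ns U j (K t) V)"
      using slice_core[where K = "K t", OF i dK] sliceK[OF t i] by simp
  qed
  have deriv: "mat_deriv p q (\<lambda>s. K s i)
      (minv (row_sub (take (j - 1) ns) (fst (J t) (j - 1)) UL)
       * slice_sub ns j (fst (J t) (j - 1)) (snd (J t) j) (G (Y t) t) i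
       * (minv (row_sub (drop j ns) (snd (J t) j) VR))\<^sup>T) t {t0..t1}"
    if t: "t \<in> {t0..t1}" and i: "i < n" for t i
  proof -
    define E where "E = P_plus ns (J t) j (Y t) (G (Y t) t)"
    define X X' where "X = sel_mat (take (j - 1) ns) (fst (J t) (j - 1))"
      and "X' = sel_mat (drop j ns) (snd (J t) j)"
    note sL = left_sel[OF wdD(1)[OF t] j'(2) r(1)]
    note sR = right_sel[OF wdD(1)[OF t] j'(1) j(2) r(2)]
    have dX: "dim_row X = dim_row UL" "dim_col X = p" and dX': "dim_row X' = dim_row VR" "dim_col X' = q"
      using sel_mat_dim[OF sL(1)] sel_mat_dim[OF sR(1)] sL(2) sR(2)
      by (simp_all add: X_def X'_def dUL dVR p_def q_def)
    have XU: "X\<^sup>T * UL = row_sub (take (j - 1) ns) (fst (J t) (j - 1)) UL"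
      unfolding X_def by (rule sel_mat_transpose_mult[OF sL(1) dUL(1)])
    have XV: "X'\<^sup>T * VR = row_sub (drop j ns) (snd (J t) j) VR"
      unfolding X'_def by (rule sel_mat_transpose_mult[OF sR(1) dVR(1)])
    have L: "invertible_mat (row_sub (take (j - 1) ns) (fst (J t) (j - 1)) UL)"
        "left_op ns (J t) (j - 1) (Y t) = interp UL X"
      unfolding X_def
      by (rule left_op_basis[OF wdD(1)[OF t] j'(2) r(1) wdD(5)[OF t j'(2)] dUL(1) dUL(2)[unfolded p_def]
            UL[unfolded p_def] left_basis[OF t, unfolded p_def]]; assumption)+
    have R: "invertible_mat (row_sub (drop j ns) (snd (J t) j) VR)"
        "right_op ns (J t) j (Y t) = (interp VR X')\<^sup>T"
      unfolding X'_def
      by (rule right_op_basis[OF wdD(1)[OF t] j'(1) j(2) r(2) wdD(6)[OF t j'(1)] dVR(1) dVR(2)[unfolded q_def]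
            VR[unfolded q_def] right_basis[OF t, unfolded q_def]]; assumption)+
    have "tensor_deriv ns Y E t {t0..t1}" using sol t by (simp add: solves_plus_def E_def)
    note md = mat_deriv_slice[OF this j i[unfolded n_def]]
    have cars: "UL\<^sup>T \<in> carrier_mat p (prod_list (take (j - 1) ns))" "VR \<in> carrier_mat (prod_list (drop j ns)) q"
      "slice ns j i Z \<in> carrier_mat (prod_list (take (j - 1) ns)) (prod_list (drop j ns))" for Z
      by (rule carrier_matI; simp add: dUL dVR)+
    \<comment> \<open>\<open>UL\<close> and \<open>VR\<close> do not depend on time, so compression
      commutes with differentiation; it remains to compress the right-hand side.\<close>
    note md' = mat_deriv_mult_right[OF mat_deriv_mult_left[OF md cars(1,3,3)] cars(2)
        mult_carrier_mat[OF cars(1,3)] mult_carrier_mat[OF cars(1,3)]]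
    have "slice ns j i E = interp UL X * (slice ns j i (G (Y t) t) * (interp VR X')\<^sup>T)"
      unfolding E_def slice_P_plus[OF j wdD(1)[OF t] r wdD(6)[OF t j'(1)] i[unfolded n_def]] L(2) R(2) ..
    then have "UL\<^sup>T * slice ns j i E * VR =
        minv (X\<^sup>T * UL) * (X\<^sup>T * (slice ns j i (G (Y t) t) * X')) * (minv (X'\<^sup>T * VR))\<^sup>T"
      using interp_compress[OF UL VR dUL(2) dVR(2) dX dX' L(1)[folded XU] R(1)[folded XV],
          of "slice ns j i (G (Y t) t)"]
      by (simp add: dUL dVR)
    also have "X\<^sup>T * (slice ns j i (G (Y t) t) * X') =
        slice_sub ns j (fst (J t) (j - 1)) (snd (J t) j) (G (Y t) t) i"
      unfolding X_def X'_def by (rule slice_sub_eq[OF j sL(1) sR(1)])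
    finally show ?thesis using md' unfolding XU XV K_def by simp
  qed
  show ?thesis
    by (rule exI[of _ K]) (use K0 core form deriv in \<open>simp add: p_def q_def n_def UL_def VR_def del: One_nat_def\<close>)
qed

text \<open>The same scheme on a single unfolding. As \<open>0 < j < length ns\<close>, the
  conventions for the outer operators do not come into play.\<close>

lemma minus_solution_matrix:
  assumes j: "0 < j" "j < length ns" and t01: "t0 \<le> t1"
    and wd: "\<And>s. s \<in> {t0..t1} \<Longrightarrow> proj_wd ns r (J s) (Y s)"
    and sol: "solves_minus ns G J {t0..t1} j Y Y"
    and U: "\<And>k. k \<in> {1..j} \<Longrightarrow> left_orthogonal ns r k (U k)"
    and V: "\<And>k. k \<in> {j+1..length ns} \<Longrightarrow> right_orthogonal ns r k (V k)"
    and S0: "S0 \<in> carrier_mat (r ! j) (r ! j)"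
    and init: "Y t0 = tt_mat_tensor ns U j S0 V"
  shows "\<exists>S :: real \<Rightarrow> real mat.
    S t0 = S0 \<and>
    (\<forall>t \<in> {t0..t1}. S t \<in> carrier_mat (r ! j) (r ! j) \<and>
       Y t = tt_mat_tensor ns U j (S t) V \<and>
       mat_deriv (r ! j) (r ! j) S
          (- (minv (row_sub (take j ns) (fst (J t) j) (U_le ns r U j))
              * mat_sub ns j (fst (J t) j) (snd (J t) j) (G (Y t) t)
              * (minv (row_sub (drop j ns) (snd (J t) j) (V_gt ns r V j)))\<^sup>T))
          t {t0..t1})"
proof -
  define UL VR q where "UL = U_le ns r U j" and "VR = V_gt ns r V j" and "q = r ! j"
  have t0: "t0 \<in> {t0..t1}" using t01 by simp
  note wdD = proj_wdD[OF wd]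
  have "0 < length ns" using j by linarith
  then have r: "r ! 0 = 1" "r ! length ns = 1" using wdD(3,4)[OF t0] by blast+
  have j': "j \<le> length ns" using j by simp
  have coreU: "is_core ns r l (U l)" if "l \<in> {1..j}" for l
    using U[OF that] by (simp add: left_orthogonal_def)
  have coreV: "is_core ns r l (V l)" if "l \<in> {j+1..length ns}" for l
    using V[OF that] by (simp add: right_orthogonal_def)
  have UL: "UL\<^sup>T * UL = 1\<^sub>m q"
    unfolding UL_def q_def by (rule U_le_orthonormal[OF j' r(1) U])
  have VR: "VR\<^sup>T * VR = 1\<^sub>m q"
    unfolding VR_def q_def by (rule V_gt_orthonormal[OF j' r(2) V])
  have dUL: "dim_row UL = prod_list (take j ns)" "dim_col UL = q"
    and dVR: "dim_row VR = prod_list (drop j ns)" "dim_col VR = q"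
    by (simp_all add: UL_def VR_def q_def)
  have dS0: "dim_row S0 = q" "dim_col S0 = q" using S0 by (simp_all add: q_def)
  have unfold_mat: "unfold ns j (tt_mat_tensor ns U j S V) = UL * S * VR\<^sup>T"
    if "dim_row S = q" "dim_col S = q" for S
    unfolding UL_def VR_def using that
    by (intro unfold_tt_mat_tensor[OF j' r coreU coreV]) (simp_all add: q_def)
  have unf0: "unfold ns j (Y t0) = UL * S0 * VR\<^sup>T"
    unfolding init by (rule unfold_mat[OF dS0])
  \<comment> \<open>Two groupings of the same product, exhibiting \<open>UL\<close> and
    \<open>VR\<close> as first factors. That they span the range and the co-range follows from the
    ranks through \<open>range_basis_of_factor\<close>.\<close>
  have left0: "unfold ns j (Y t0) = UL * (S0 * VR\<^sup>T)"
    unfolding unf0 by (simp add: mult_assoc_dim dUL dVR dS0)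
  have right0: "(unfold ns j (Y t0))\<^sup>T = VR * (S0\<^sup>T * UL\<^sup>T)"
    unfolding unf0 by (simp add: transpose_mult_dim dUL dVR dS0)
  have wdY: "left_wd ns (J s) j (Y s) \<and> right_wd ns (J s) j (Y s)" if "s \<in> {t0..t1}" for s
    using wdD(5)[OF that j(2)] wdD(6)[OF that j(1)] by simp
  have inv: "range_basis (unfold ns j (Y t)) = range_basis (unfold ns j (Y t0))"
    "corange_basis (unfold ns j (Y t)) = corange_basis (unfold ns j (Y t0))"
    if "t \<in> {t0..t1}" for t
    by (rule bases_invariant_minus[OF j wd wdY disjI1[OF refl] sol]; (assumption | rule that))+
  have left_basis: "\<exists>Q. dim_row Q = q \<and> dim_col Q = q \<and> UL = range_basis (unfold ns j (Y t)) * Q"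
    if t: "t \<in> {t0..t1}" for t
    unfolding inv(1)[OF t]
    by (rule range_basis_of_factor[OF left0 UL dUL(2)])
      (simp_all add: dS0 q_def left_rank[OF wdD(1)[OF t0] j wdD(5)[OF t0 j(2)]] dS0[unfolded q_def])
  have right_basis: "\<exists>Q. dim_row Q = q \<and> dim_col Q = q \<and> VR = corange_basis (unfold ns j (Y t)) * Q"
    if t: "t \<in> {t0..t1}" for t
    unfolding inv(2)[OF t] unfolding corange_basis_def
    by (rule range_basis_of_factor[OF right0 VR dVR(2)])
      (simp_all add: q_def right_rank[OF wdD(1)[OF t0] j wdD(6)[OF t0 j(1)]] dS0[unfolded q_def])
  define S where "S t = UL\<^sup>T * unfold ns j (Y t) * VR" for t
  have dS: "dim_row (S t) = q" "dim_col (S t) = q" for t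
    by (simp_all add: S_def dUL dVR)
  have St0: "S t0 = S0"
    unfolding S_def unf0 by (simp add: mult_assoc_dim dUL dVR dS0 left_inverse_cancel[OF UL] VR)
  have form: "Y t = tt_mat_tensor ns U j (S t) V" if t: "t \<in> {t0..t1}" for t
  proof (rule tensor_eq_unfoldI[OF wdD(2)[OF t] tt_mat_tensor_tensors])
    obtain Q where Q: "dim_row Q = q" "dim_col Q = q" "UL = range_basis (unfold ns j (Y t)) * Q"
      using left_basis[OF t] by blast
    have fixL: "UL * (UL\<^sup>T * unfold ns j (Y t)) = unfold ns j (Y t)"
      by (rule range_basis_change_fixed[OF Q(3) UL Q(1,2)])
        (simp add: q_def left_rank[OF wdD(1)[OF t] j wdD(5)[OF t j(2)]])
    obtain Q' where Q': "dim_row Q' = q" "dim_col Q' = q" "VR = corange_basis (unfold ns j (Y t)) * Q'"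
      using right_basis[OF t] by blast
    have "VR * (VR\<^sup>T * (unfold ns j (Y t))\<^sup>T) = (unfold ns j (Y t))\<^sup>T"
      by (rule range_basis_change_fixed[OF Q'(3)[unfolded corange_basis_def] VR Q'(1,2)])
        (simp add: q_def right_rank[OF wdD(1)[OF t] j wdD(6)[OF t j(1)]])
    from arg_cong[OF this, of transpose_mat]
    have fixR: "unfold ns j (Y t) * (VR * VR\<^sup>T) = unfold ns j (Y t)"
      by (simp add: transpose_mult_dim mult_assoc_dim dVR)
    have "UL * S t * VR\<^sup>T = UL * (UL\<^sup>T * (unfold ns j (Y t) * (VR * VR\<^sup>T)))"
      by (simp add: S_def mult_assoc_dim dUL dVR)
    then show "unfold ns j (Y t) = unfold ns j (tt_mat_tensor ns U j (S t) V)"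
      by (simp add: unfold_mat[OF dS] fixL fixR)
  qed
  have deriv: "mat_deriv q q S
      (- (minv (row_sub (take j ns) (fst (J t) j) UL)
          * mat_sub ns j (fst (J t) j) (snd (J t) j) (G (Y t) t)
          * (minv (row_sub (drop j ns) (snd (J t) j) VR))\<^sup>T)) t {t0..t1}"
    if t: "t \<in> {t0..t1}" for t
  proof -
    define P where "P = P_minus ns (J t) j (Y t) (G (Y t) t)"
    define X X' where "X = sel_mat (take j ns) (fst (J t) j)" and "X' = sel_mat (drop j ns) (snd (J t) j)"
    note sL = left_sel[OF wdD(1)[OF t] j(2) r(1)]
    note sR = right_sel[OF wdD(1)[OF t] j(1) j' r(2)]
    have dX: "dim_row X = dim_row UL" "dim_col X = q" and dX': "dim_row X' = dim_row VR" "dim_col X' = q"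
      using sel_mat_dim[OF sL(1)] sel_mat_dim[OF sR(1)] sL(2) sR(2)
      by (simp_all add: X_def X'_def dUL dVR q_def)
    have XU: "X\<^sup>T * UL = row_sub (take j ns) (fst (J t) j) UL"
      unfolding X_def by (rule sel_mat_transpose_mult[OF sL(1) dUL(1)])
    have XV: "X'\<^sup>T * VR = row_sub (drop j ns) (snd (J t) j) VR"
      unfolding X'_def by (rule sel_mat_transpose_mult[OF sR(1) dVR(1)])
    note L = left_op_basis[OF wdD(1)[OF t] j(2) r(1) wdD(5)[OF t j(2)] dUL(1) dUL(2)[unfolded q_def]
        UL[unfolded q_def] left_basis[OF t, unfolded q_def], folded X_def]
    note R = right_op_basis[OF wdD(1)[OF t] j(1) j' r(2) wdD(6)[OF t j(1)] dVR(1) dVR(2)[unfolded q_def]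
        VR[unfolded q_def] right_basis[OF t, unfolded q_def], folded X'_def]
    have "tensor_deriv ns Y (\<lambda>is. - P is) t {t0..t1}" using sol t by (simp add: solves_minus_def P_def)
    note md = mat_deriv_unfold[OF this, of j]
    have cars: "UL\<^sup>T \<in> carrier_mat q (prod_list (take j ns))" "VR \<in> carrier_mat (prod_list (drop j ns)) q"
      "unfold ns j Z \<in> carrier_mat (prod_list (take j ns)) (prod_list (drop j ns))" for Z
      by (rule carrier_matI; simp add: dUL dVR)+
    note md' = mat_deriv_mult_right[OF mat_deriv_mult_left[OF md cars(1,3,3)] cars(2)
        mult_carrier_mat[OF cars(1,3)] mult_carrier_mat[OF cars(1,3)]]
    have "unfold ns j P = interp UL X * (unfold ns j (G (Y t) t) * (interp VR X')\<^sup>T)"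
      unfolding P_def unfold_P_minus[OF wdD(1)[OF t] r wdD(6)[OF t j(1)] j] L(2) R(2) ..
    then have "UL\<^sup>T * unfold ns j P * VR =
        minv (X\<^sup>T * UL) * (X\<^sup>T * (unfold ns j (G (Y t) t) * X')) * (minv (X'\<^sup>T * VR))\<^sup>T"
      using interp_compress[OF UL VR dUL(2) dVR(2) dX dX' L(1)[folded XU] R(1)[folded XV],
          of "unfold ns j (G (Y t) t)"]
      by (simp add: dUL dVR)
    also have "X\<^sup>T * (unfold ns j (G (Y t) t) * X') =
        mat_sub ns j (fst (J t) j) (snd (J t) j) (G (Y t) t)"
      unfolding X_def X'_def by (rule mat_sub_eq[OF sL(1) sR(1)])
    finally have "UL\<^sup>T * unfold ns j P * VR =
        minv (X\<^sup>T * UL) * mat_sub ns j (fst (J t) j) (snd (J t) j) (G (Y t) t) * (minv (X'\<^sup>T * VR))\<^sup>T" .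
    moreover have "UL\<^sup>T * unfold ns j (\<lambda>is. - P is) * VR = - (UL\<^sup>T * unfold ns j P * VR)"
      by (simp add: unfold_uminus dUL dVR)
    ultimately show ?thesis using md' unfolding XU XV S_def[abs_def] by simp
  qed
  have S: "S t \<in> carrier_mat q q" for t by (rule carrier_matI) (simp_all add: dS)
  show ?thesis
    by (rule exI[of _ S]) (use St0 S form deriv in \<open>simp add: q_def UL_def VR_def\<close>)
qed

theorem theorem6p1:
  fixes d :: nat and ns r :: "nat list"
    and G :: "tensor \<Rightarrow> real \<Rightarrow> tensor"
    and T t0 t1 \<Delta>t :: real
    and Y0 :: tensor
    and Yp Ym :: "nat \<Rightarrow> real \<Rightarrow> tensor"
    and Jp Jm :: "nat \<Rightarrow> real \<Rightarrow> selection"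
  assumes d: "d \<ge> 2" "length ns = d" "\<forall>n \<in> set ns. n > 0"
    and time: "0 \<le> t0" "0 < \<Delta>t" "t1 = t0 + \<Delta>t" "t1 \<le> T"
    and G: "\<And>Z t. Z \<in> tensors ns \<Longrightarrow> t \<in> {0..T} \<Longrightarrow> G Z t \<in> tensors ns"
    and Y0: "Y0 \<in> tt_manifold ns r"
    and split_plus: "\<And>j. j \<in> {1..d} \<Longrightarrow> solves_plus ns G (Jp j) {t0..t1} j (Yp j) (Yp j)"
    and split_minus: "\<And>j. j \<in> {1..d-1} \<Longrightarrow> solves_minus ns G (Jm j) {t0..t1} j (Ym j) (Ym j)"
    and init: "Yp 1 t0 = Y0"
    and init_minus: "\<And>j. j \<in> {1..d-1} \<Longrightarrow> Ym j t0 = Yp j t1"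
    and init_plus: "\<And>j. j \<in> {1..d-1} \<Longrightarrow> Yp (j + 1) t0 = Ym j t1"
    and wd_plus: "\<And>j t. j \<in> {1..d} \<Longrightarrow> t \<in> {t0..t1} \<Longrightarrow> proj_wd ns r (Jp j t) (Yp j t)"
    and wd_minus: "\<And>j t. j \<in> {1..d-1} \<Longrightarrow> t \<in> {t0..t1} \<Longrightarrow> proj_wd ns r (Jm j t) (Ym j t)"
  shows
    \<comment> \<open>(i) along the solutions the operators are those at the initial value, and the split
        equations have the same solutions as the equations with these frozen operators\<close>
    "(\<forall>j \<in> {1..d}.
        (\<forall>t \<in> {t0..t1}. \<forall>W \<in> tensors ns.
           P_plus ns (Jp j t) j (Yp j t) W = P_plus ns (Jp j t) j (Yp j t0) W) \<and>
        solves_plus ns G (Jp j) {t0..t1} j (\<lambda>_. Yp j t0) (Yp j) \<and>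
        (\<forall>Z. Z t0 = Yp j t0 \<longrightarrow> (\<forall>t \<in> {t0..t1}. proj_wd ns r (Jp j t) (Z t)) \<longrightarrow>
           (solves_plus ns G (Jp j) {t0..t1} j Z Z \<longleftrightarrow>
            solves_plus ns G (Jp j) {t0..t1} j (\<lambda>_. Yp j t0) Z)))
   \<and> (\<forall>j \<in> {1..d-1}.
        (\<forall>t \<in> {t0..t1}. \<forall>W \<in> tensors ns.
           P_minus ns (Jm j t) j (Ym j t) W = P_minus ns (Jm j t) j (Ym j t0) W) \<and>
        solves_minus ns G (Jm j) {t0..t1} j (\<lambda>_. Ym j t0) (Ym j) \<and>
        (\<forall>Z. Z t0 = Ym j t0 \<longrightarrow> (\<forall>t \<in> {t0..t1}. proj_wd ns r (Jm j t) (Z t)) \<longrightarrow>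
           (solves_minus ns G (Jm j) {t0..t1} j Z Z \<longleftrightarrow>
            solves_minus ns G (Jm j) {t0..t1} j (\<lambda>_. Ym j t0) Z)))
    \<comment> \<open>(ii)\<close>
   \<and> (\<forall>j \<in> {1..d}. \<forall>U V S.
        (\<forall>k \<in> {1..j}. left_orthogonal ns r k (U k)) \<longrightarrow>
        (\<forall>k \<in> {j+1..d}. right_orthogonal ns r k (V k)) \<longrightarrow>
        S \<in> carrier_mat (r ! j) (r ! j) \<longrightarrow>
        Yp j t0 = tt_core_tensor ns U j (\<lambda>i. U j i * S) V \<longrightarrow>
        (\<exists>K :: real \<Rightarrow> core.
           (\<forall>i < ns ! (j - 1). K t0 i = U j i * S) \<and>
           (\<forall>t \<in> {t0..t1}. is_core ns r j (K t) \<and>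
              Yp j t = tt_core_tensor ns U j (K t) V \<and>
              (\<forall>i < ns ! (j - 1). mat_deriv (r ! (j - 1)) (r ! j) (\<lambda>s. K s i)
                 (minv (row_sub (take (j - 1) ns) (fst (Jp j t) (j - 1)) (U_le ns r U (j - 1)))
                  * slice_sub ns j (fst (Jp j t) (j - 1)) (snd (Jp j t) j) (G (Yp j t) t) i
                  * (minv (row_sub (drop j ns) (snd (Jp j t) j) (V_gt ns r V j)))\<^sup>T)
                 t {t0..t1}))))
    \<comment> \<open>(iii)\<close>
   \<and> (\<forall>j \<in> {1..d-1}. \<forall>U V S0.
        (\<forall>k \<in> {1..j}. left_orthogonal ns r k (U k)) \<longrightarrow>
        (\<forall>k \<in> {j+1..d}. right_orthogonal ns r k (V k)) \<longrightarrow>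
        S0 \<in> carrier_mat (r ! j) (r ! j) \<longrightarrow>
        Ym j t0 = tt_mat_tensor ns U j S0 V \<longrightarrow>
        (\<exists>S :: real \<Rightarrow> real mat.
           S t0 = S0 \<and>
           (\<forall>t \<in> {t0..t1}. S t \<in> carrier_mat (r ! j) (r ! j) \<and>
              Ym j t = tt_mat_tensor ns U j (S t) V \<and>
              mat_deriv (r ! j) (r ! j) S
                 (- (minv (row_sub (take j ns) (fst (Jm j t) j) (U_le ns r U j))
                     * mat_sub ns j (fst (Jm j t) j) (snd (Jm j t) j) (G (Ym j t) t)
                     * (minv (row_sub (drop j ns) (snd (Jm j t) j) (V_gt ns r V j)))\<^sup>T))
                 t {t0..t1})))"
proof (intro conjI ballI allI impI)
  have t01: "t0 \<le> t1" using time by simp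
  have t0: "t0 \<in> {t0..t1}" using t01 by simp
  {
    fix j assume j: "j \<in> {1..d}"
    then have j': "1 \<le> j" "j \<le> length ns" "0 < j" "j - 1 < length ns" using d by auto
    have wdY: "left_wd ns (Jp j s) (j - 1) (Yp j s) \<and> right_wd ns (Jp j s) j (Yp j s)" if "s \<in> {t0..t1}" for s
      using proj_wdD(5)[OF wd_plus[OF j that] j'(4)] proj_wdD(6)[OF wd_plus[OF j that] j'(3)] by blast
    \<comment> \<open>Freezing the operators and transferring well-definedness to
      \<open>Yp j t0\<close> both use this invariance, which comes from the split equation for
      \<open>Yp j\<close> itself.\<close>
    have inv:
      "0 < j - 1 \<Longrightarrow> range_basis (unfold ns (j - 1) (Yp j t)) = range_basis (unfold ns (j - 1) (Yp j t0))"
      "j < length ns \<Longrightarrow> corange_basis (unfold ns j (Yp j t)) = corange_basis (unfold ns j (Yp j t0))"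
      if "t \<in> {t0..t1}" for t
      by (rule bases_invariant_plus[OF j'(1,2) wd_plus[OF j] wdY disjI1[OF refl] split_plus[OF j]];
          (assumption | rule that))+
    \<comment> \<open>The selections are admissible for the frozen base point as well, because \<open>Yp j\<close> keeps its ranges.\<close>
    have wd0: "left_wd ns (Jp j s) (j - 1) (Yp j t0) \<and> right_wd ns (Jp j s) j (Yp j t0)"
      if s: "s \<in> {t0..t1}" for s
      using wdY[OF s] left_wd_cong[OF inv(1)[OF s]] right_wd_cong[OF inv(2)[OF s]] by blast
    show "P_plus ns (Jp j t) j (Yp j t) W = P_plus ns (Jp j t) j (Yp j t0) W" if "t \<in> {t0..t1}" for t W
      by (rule P_plus_cong[OF inv(1)[OF that] inv(2)[OF that] j'(2)])
    \<comment> \<open>Rewriting with \<open>that(1)\<close> replaces \<open>Z t0\<close> by the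
      initial value of \<open>Yp j\<close>, so the admissibility \<open>wd0\<close>, derived from
      \<open>Yp j\<close>, serves every competitor \<open>Z\<close>.\<close>
    have iff: "solves_plus ns G (Jp j) {t0..t1} j Z Z \<longleftrightarrow> solves_plus ns G (Jp j) {t0..t1} j (\<lambda>_. Yp j t0) Z"
      if "Z t0 = Yp j t0" "\<forall>t \<in> {t0..t1}. proj_wd ns r (Jp j t) (Z t)" for Z
      by (rule solves_plus_frozen_iff[OF j'(1,2), of t0 t1 r "Jp j" Z G, unfolded that(1),
            OF that(2)[rule_format] wd0]; assumption)
    \<comment> \<open>\<open>Yp j\<close> is itself one of the functions \<open>Z\<close>.\<close>
    show "solves_plus ns G (Jp j) {t0..t1} j (\<lambda>_. Yp j t0) (Yp j)"
      using iff[of "Yp j", OF refl] wd_plus[OF j] split_plus[OF j] by simp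
    show "solves_plus ns G (Jp j) {t0..t1} j Z Z \<longleftrightarrow> solves_plus ns G (Jp j) {t0..t1} j (\<lambda>_. Yp j t0) Z"
      if "Z t0 = Yp j t0" "\<forall>t \<in> {t0..t1}. proj_wd ns r (Jp j t) (Z t)" for Z
      by (rule iff[OF that])
    show "\<exists>K :: real \<Rightarrow> core.
           (\<forall>i < ns ! (j - 1). K t0 i = U j i * S) \<and>
           (\<forall>t \<in> {t0..t1}. is_core ns r j (K t) \<and>
              Yp j t = tt_core_tensor ns U j (K t) V \<and>
              (\<forall>i < ns ! (j - 1). mat_deriv (r ! (j - 1)) (r ! j) (\<lambda>s. K s i)
                 (minv (row_sub (take (j - 1) ns) (fst (Jp j t) (j - 1)) (U_le ns r U (j - 1)))
                  * slice_sub ns j (fst (Jp j t) (j - 1)) (snd (Jp j t) j) (G (Yp j t) t) i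
                  * (minv (row_sub (drop j ns) (snd (Jp j t) j) (V_gt ns r V j)))\<^sup>T)
                 t {t0..t1}))"
      if "\<forall>k \<in> {1..j}. left_orthogonal ns r k (U k)" "\<forall>k \<in> {j+1..d}. right_orthogonal ns r k (V k)"
        "S \<in> carrier_mat (r ! j) (r ! j)" "Yp j t0 = tt_core_tensor ns U j (\<lambda>i. U j i * S) V" for U V S
      by (rule plus_solution_core[OF j'(1,2) t01 wd_plus[OF j] split_plus[OF j] _ _ that(3,4)])
        (use that(1,2) d(2) in auto)
  }
  {
    fix j assume j: "j \<in> {1..d - 1}"
    then have j': "0 < j" "j < length ns" using d by auto
    have wdY: "left_wd ns (Jm j s) j (Ym j s) \<and> right_wd ns (Jm j s) j (Ym j s)" if "s \<in> {t0..t1}" for s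
      using proj_wdD(5)[OF wd_minus[OF j that] j'(2)] proj_wdD(6)[OF wd_minus[OF j that] j'(1)] by blast
    have inv: "range_basis (unfold ns j (Ym j t)) = range_basis (unfold ns j (Ym j t0))"
      "corange_basis (unfold ns j (Ym j t)) = corange_basis (unfold ns j (Ym j t0))"
      if "t \<in> {t0..t1}" for t
      by (rule bases_invariant_minus[OF j' wd_minus[OF j] wdY disjI1[OF refl] split_minus[OF j]];
          (assumption | rule that))+
    \<comment> \<open>The selection of time \<open>s\<close> is admissible at \<open>Ym j s\<close>,
      whose range and co-range are those of the initial value.\<close>
    have wd0: "left_wd ns (Jm j s) j (Ym j t0) \<and> right_wd ns (Jm j s) j (Ym j t0)"
      if s: "s \<in> {t0..t1}" for s
      using wdY[OF s] left_wd_cong[OF inv(1)[OF s]] right_wd_cong[OF inv(2)[OF s]] by blast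
    show "P_minus ns (Jm j t) j (Ym j t) W = P_minus ns (Jm j t) j (Ym j t0) W" if "t \<in> {t0..t1}" for t W
      by (rule P_minus_cong[OF inv(1)[OF that] inv(2)[OF that] less_imp_le[OF j'(2)]])
    have iff: "solves_minus ns G (Jm j) {t0..t1} j Z Z \<longleftrightarrow> solves_minus ns G (Jm j) {t0..t1} j (\<lambda>_. Ym j t0) Z"
      if "Z t0 = Ym j t0" "\<forall>t \<in> {t0..t1}. proj_wd ns r (Jm j t) (Z t)" for Z
      by (rule solves_minus_frozen_iff[OF j', of t0 t1 r "Jm j" Z G, unfolded that(1),
            OF that(2)[rule_format] wd0]; assumption)
    show "solves_minus ns G (Jm j) {t0..t1} j (\<lambda>_. Ym j t0) (Ym j)"
      using iff[of "Ym j", OF refl] wd_minus[OF j] split_minus[OF j] by simp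
    show "solves_minus ns G (Jm j) {t0..t1} j Z Z \<longleftrightarrow> solves_minus ns G (Jm j) {t0..t1} j (\<lambda>_. Ym j t0) Z"
      if "Z t0 = Ym j t0" "\<forall>t \<in> {t0..t1}. proj_wd ns r (Jm j t) (Z t)" for Z
      by (rule iff[OF that])
    show "\<exists>S :: real \<Rightarrow> real mat.
           S t0 = S0 \<and>
           (\<forall>t \<in> {t0..t1}. S t \<in> carrier_mat (r ! j) (r ! j) \<and>
              Ym j t = tt_mat_tensor ns U j (S t) V \<and>
              mat_deriv (r ! j) (r ! j) S
                 (- (minv (row_sub (take j ns) (fst (Jm j t) j) (U_le ns r U j))
                     * mat_sub ns j (fst (Jm j t) j) (snd (Jm j t) j) (G (Ym j t) t)
                     * (minv (row_sub (drop j ns) (snd (Jm j t) j) (V_gt ns r V j)))\<^sup>T))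
                 t {t0..t1})"
      if "\<forall>k \<in> {1..j}. left_orthogonal ns r k (U k)" "\<forall>k \<in> {j+1..d}. right_orthogonal ns r k (V k)"
        "S0 \<in> carrier_mat (r ! j) (r ! j)" "Ym j t0 = tt_mat_tensor ns U j S0 V" for U V S0
      by (rule minus_solution_matrix[OF j' t01 wd_minus[OF j] split_minus[OF j] _ _ that(3,4)])
        (use that(1,2) d(2) in auto)
  }
qed

end
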